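(* Assume that $\mathbf{H}f(x):=\mathcal{H}(x,\mathrm{d}f(x))$ defines an operator $\mathbf{H}\subseteq C_b^1(M)\times C_b(M)$ with domain $\mathcal{D}(\mathbf{H})=\{f\in C_b^1(M):\sup_z\{-\mathbf{H}f(z)\}<\infty\}$. Then for every initial point $x(0)\in M$ and every $f\in\mathcal{D}(\mathbf{H})$ there exists an absolutely continuous curve $x:[0,\infty)\to M$ starting at $x(0)$ such that for all $t>0$ $$\int_0^t\mathcal{H}(x(s),\mathrm{d}f(x(s)))\,\mathrm{d}s+\int_0^t\mathcal{L}(x(s),\dot x(s))\,\mathrm{d}s=\int_0^t\mathrm{d}f(x(s))\,\dot x(s)\,\mathrm{d}s.$$
   Context: $(M,g)$ is a $d$-dimensional connected complete Riemannian manifold with distance $d(\cdot,\cdot)$; $S=\{1,\dots,N\}$, $N<\infty$; for each $i\in S$, $b(\cdot,i)$ is a $C^1$ vector field on $M$; $q_{ij}:M\to\mathbb{R}$. Standing assumptions: there are $x_0\in M$, $C>0$ with $|b(x,i)|\le C(1+d(x,x_0))$ for all $x,i$; for every $x$, $(q_{ij}(x))$ is a conservative, irreducible transition rate matrix; for every compact $K\subseteq M$ there is $C_K$ with $|q_{ij}(x)-q_{ij}(y)|\le C_Kd(x,y)$ for $x,y\in K$, $i,j\in S$. $C_b(M)$: bounded continuous functions; $C_b^1(M)$: bounded continuously differentiable functions. A curve on $[0,\infty)$ is absolutely continuous if it is so on every $[0,T]$. For $x\in M$, $p\in T_x^*M$, $v\in T_xM$: $$\mathcal{H}(x,p)=\sup_{\pi\in\mathcal{P}(S)}\Big\{\int_S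 B_{x,p}(z)\pi(\mathrm{d}z)-\mathcal{I}(x,\pi)\Big\},\quad B_{x,p}(z)=p\,b(x,z)+\tfrac12|p|^2,$$ $$\mathcal{I}(x,\pi)=-\inf_{g:S\to(0,\infty)}\int_S\frac{R_xg(z)}{g(z)}\pi(\mathrm{d}z),\quad R_xg(z)=\sum_{j\in S}q_{zj}(x)(g(j)-g(z)),$$ $$\mathcal{L}(x,v)=\sup_{p\in T_x^*M}\{\langle p,v\rangle-\mathcal{H}(x,p)\}.$$ *)

theory Defs
  imports "HOL-Analysis.Analysis" "HOL-Probability.Probability_Mass_Function"
begin

section \<open>Riemannian manifolds\<close>

text \<open>For open \<open>U\<close> this is the usual class \<open>C\<^sup>k(U)\<close>: the derivative \<open>y \<mapsto> Df(y)\<close> is of class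
  \<open>C\<^sup>k\<close> iff all directional derivatives \<open>y \<mapsto> Df(y) v\<close> are, the domain being finite-dimensional.\<close>

primrec ck_on :: "nat \<Rightarrow> 'a set \<Rightarrow> ('a::euclidean_space \<Rightarrow> 'b::real_normed_vector) \<Rightarrow> bool" where
  "ck_on 0 U f \<longleftrightarrow> continuous_on U f"
| "ck_on (Suc k) U f \<longleftrightarrow>
     (\<forall>y\<in>U. f differentiable (at y)) \<and> (\<forall>v. ck_on k U (\<lambda>y. frechet_derivative f (at y) v))"

definition smooth_on :: "'a set \<Rightarrow> ('a::euclidean_space \<Rightarrow> 'b::real_normed_vector) \<Rightarrow> bool" where
  "smooth_on U f \<longleftrightarrow> (\<forall>k. ck_on k U f)"

type_synonym ('m, 'e) chart = "'m set \<times> ('m \<Rightarrow> 'e)"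

abbreviation cdom :: "('m, 'e) chart \<Rightarrow> 'm set" where
  "cdom c \<equiv> fst c"

abbreviation cmap :: "('m, 'e) chart \<Rightarrow> 'm \<Rightarrow> 'e" where
  "cmap c \<equiv> snd c"

abbreviation cinv :: "('m, 'e) chart \<Rightarrow> 'e \<Rightarrow> 'm" where
  "cinv c \<equiv> inv_into (fst c) (snd c)"

definition is_chart :: "('m::topological_space, 'e::euclidean_space) chart \<Rightarrow> bool" where
  "is_chart c \<longleftrightarrow> open (cdom c) \<and> open (cmap c ` cdom c) \<and>
     homeomorphism (cdom c) (cmap c ` cdom c) (cmap c) (cinv c)"

text \<open>The derivative at \<open>x\<close> of the change of coordinates from \<open>c\<close> to \<open>c'\<close>; it takes the components
  of a tangent vector at \<open>x\<close> with respect to \<open>c\<close> to those with respect to \<open>c'\<close>.\<close>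

definition change_deriv ::
    "('m, 'e::euclidean_space) chart \<Rightarrow> ('m, 'e) chart \<Rightarrow> 'm \<Rightarrow> 'e \<Rightarrow> 'e" where
  "change_deriv c c' x = frechet_derivative (cmap c' \<circ> cinv c) (at (cmap c x))"

text \<open>The manifold is the whole type \<open>'m\<close>, its dimension is \<open>DIM('e)\<close>. The field \<open>chart_at\<close> selects
  for every point \<open>x\<close> a chart of the atlas around \<open>x\<close>, with no regularity in \<open>x\<close>. It is used only
  to represent the tangent space at \<open>x\<close>: a tangent vector at \<open>x\<close> is given by its components
  \<open>v :: 'e\<close> with respect to the chart \<open>chart_at M x\<close>, and accordingly the cotangent space at \<open>x\<close> is
  the dual space \<open>'e \<Rightarrow>\<^sub>L real\<close>. The form \<open>riem_metric M x\<close> is the Riemannian inner product on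
  the tangent space at \<open>x\<close>, in this representation. It has nothing to do with the inner product
  of the model space \<open>'e\<close>.\<close>

record ('m, 'e) riem_structure =
  atlas :: "('m, 'e) chart set"
  chart_at :: "'m \<Rightarrow> ('m, 'e) chart"
  riem_metric :: "'m \<Rightarrow> 'e \<Rightarrow> 'e \<Rightarrow> real"

definition smooth_manifold :: "('m::topological_space, 'e::euclidean_space) riem_structure \<Rightarrow> bool" where
  "smooth_manifold M \<longleftrightarrow>
     (\<forall>c\<in>atlas M. is_chart c) \<and>
     (\<forall>x. chart_at M x \<in> atlas M \<and> x \<in> cdom (chart_at M x)) \<and>
     (\<forall>c\<in>atlas M. \<forall>c'\<in>atlas M. smooth_on (cmap c ` (cdom c \<inter> cdom c')) (cmap c' \<circ> cinv c))"

definition metric_in_chart ::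
    "('m, 'e::euclidean_space) riem_structure \<Rightarrow> ('m, 'e) chart \<Rightarrow> 'e \<Rightarrow> 'e \<Rightarrow> 'e \<Rightarrow> real" where
  "metric_in_chart M c u v y =
     (let x = cinv c y; T = change_deriv c (chart_at M x) x in riem_metric M x (T u) (T v))"

definition riemannian_manifold ::
    "('m::topological_space, 'e::euclidean_space) riem_structure \<Rightarrow> bool" where
  "riemannian_manifold M \<longleftrightarrow> smooth_manifold M \<and>
     (\<forall>x. bilinear (riem_metric M x) \<and>
          (\<forall>u v. riem_metric M x u v = riem_metric M x v u) \<and>
          (\<forall>v. v \<noteq> 0 \<longrightarrow> riem_metric M x v v > 0)) \<and>
     (\<forall>c\<in>atlas M. \<forall>u v. smooth_on (cmap c ` cdom c) (metric_in_chart M c u v))"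

definition tnorm :: "('m, 'e) riem_structure \<Rightarrow> 'm \<Rightarrow> 'e \<Rightarrow> real" where
  "tnorm M x v = sqrt (riem_metric M x v v)"

definition conorm :: "('m, 'e::euclidean_space) riem_structure \<Rightarrow> 'm \<Rightarrow> ('e \<Rightarrow>\<^sub>L real) \<Rightarrow> real" where
  "conorm M x p = (SUP v\<in>{v. tnorm M x v \<le> 1}. blinfun_apply p v)"

text \<open>The velocity is meaningful only where the curve is differentiable.\<close>

definition velocity :: "('m, 'e::euclidean_space) riem_structure \<Rightarrow> (real \<Rightarrow> 'm) \<Rightarrow> real \<Rightarrow> 'e" where
  "velocity M \<gamma> t = vector_derivative (cmap (chart_at M (\<gamma> t)) \<circ> \<gamma>) (at t)"

definition c1_curve_on ::
    "('m::topological_space, 'e::euclidean_space) riem_structure \<Rightarrow> real \<Rightarrow> real \<Rightarrow> (real \<Rightarrow> 'm) \<Rightarrow> bool" where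
  "c1_curve_on M s t \<gamma> \<longleftrightarrow> continuous_on {s..t} \<gamma> \<and>
     (\<forall>c\<in>atlas M. \<exists>D. continuous_on {r\<in>{s..t}. \<gamma> r \<in> cdom c} D \<and>
        (\<forall>r\<in>{s..t}. \<gamma> r \<in> cdom c \<longrightarrow>
           ((cmap c \<circ> \<gamma>) has_vector_derivative D r) (at r within {s..t})))"

definition piecewise_c1_path ::
    "('m::topological_space, 'e::euclidean_space) riem_structure \<Rightarrow> (real \<Rightarrow> 'm) \<Rightarrow> bool" where
  "piecewise_c1_path M \<gamma> \<longleftrightarrow>
     (\<exists>n (\<tau>::nat \<Rightarrow> real). \<tau> 0 = 0 \<and> \<tau> n = 1 \<and>
        (\<forall>i<n. \<tau> i < \<tau> (Suc i) \<and> c1_curve_on M (\<tau> i) (\<tau> (Suc i)) \<gamma>))"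

definition curve_length :: "('m, 'e::euclidean_space) riem_structure \<Rightarrow> (real \<Rightarrow> 'm) \<Rightarrow> real" where
  "curve_length M \<gamma> = (LINT t:{0..1}|lebesgue. tnorm M (\<gamma> t) (velocity M \<gamma> t))"

definition riem_dist ::
    "('m::topological_space, 'e::euclidean_space) riem_structure \<Rightarrow> 'm \<Rightarrow> 'm \<Rightarrow> real" where
  "riem_dist M x y = Inf {curve_length M \<gamma> |\<gamma>. piecewise_c1_path M \<gamma> \<and> \<gamma> 0 = x \<and> \<gamma> 1 = y}"


section \<open>Differentiability of functions and vector fields\<close>

definition c1_function ::
    "('m, 'e::euclidean_space) riem_structure \<Rightarrow> ('m \<Rightarrow> real) \<Rightarrow> bool" where
  "c1_function M f \<longleftrightarrow> (\<forall>c\<in>atlas M. ck_on 1 (cmap c ` cdom c) (f \<circ> cinv c))"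

definition Cb1 :: "('m::topological_space, 'e::euclidean_space) riem_structure \<Rightarrow> ('m \<Rightarrow> real) set" where
  "Cb1 M = {f. c1_function M f \<and> bounded (range f)}"

definition differential ::
    "('m, 'e::euclidean_space) riem_structure \<Rightarrow> ('m \<Rightarrow> real) \<Rightarrow> 'm \<Rightarrow> ('e \<Rightarrow>\<^sub>L real)" where
  "differential M f x =
     (let c = chart_at M x in Blinfun (frechet_derivative (f \<circ> cinv c) (at (cmap c x))))"

definition c1_vector_field ::
    "('m, 'e::euclidean_space) riem_structure \<Rightarrow> ('m \<Rightarrow> 'e) \<Rightarrow> bool" where
  "c1_vector_field M X \<longleftrightarrow> (\<forall>c\<in>atlas M. ck_on 1 (cmap c ` cdom c)
     (\<lambda>y. let x = cinv c y in change_deriv (chart_at M x) c x (X x)))"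

definition abs_continuous_curve_on :: "real \<Rightarrow> (real \<Rightarrow> 'm::metric_space) \<Rightarrow> bool" where
  "abs_continuous_curve_on T \<gamma> \<longleftrightarrow>
     (\<forall>\<epsilon>>0. \<exists>\<delta>>0. \<forall>D. finite D \<longrightarrow>
        (\<forall>(u, v)\<in>D. 0 \<le> u \<and> u < v \<and> v \<le> T) \<longrightarrow>
        pairwise (\<lambda>(u, v) (u', v'). {u<..<v} \<inter> {u'<..<v'} = {}) D \<longrightarrow>
        (\<Sum>(u, v)\<in>D. v - u) < \<delta> \<longrightarrow> (\<Sum>(u, v)\<in>D. dist (\<gamma> u) (\<gamma> v)) < \<epsilon>)"

definition abs_continuous_curve :: "(real \<Rightarrow> 'm::metric_space) \<Rightarrow> bool" where
  "abs_continuous_curve \<gamma> \<longleftrightarrow> (\<forall>T>0. abs_continuous_curve_on T \<gamma>)"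


section \<open>Transition rates, Hamiltonian and Lagrangian\<close>

definition conservative_rates :: "('s::finite \<Rightarrow> 's \<Rightarrow> real) \<Rightarrow> bool" where
  "conservative_rates Q \<longleftrightarrow> (\<forall>i j. i \<noteq> j \<longrightarrow> Q i j \<ge> 0) \<and> (\<forall>i. (\<Sum>j\<in>UNIV. Q i j) = 0)"

definition irreducible_rates :: "('s::finite \<Rightarrow> 's \<Rightarrow> real) \<Rightarrow> bool" where
  "irreducible_rates Q \<longleftrightarrow> (\<forall>i j. (i, j) \<in> {(k, l). k \<noteq> l \<and> Q k l > 0}\<^sup>*)"

definition Rgen :: "('s::finite \<Rightarrow> 's \<Rightarrow> 'm \<Rightarrow> real) \<Rightarrow> 'm \<Rightarrow> ('s \<Rightarrow> real) \<Rightarrow> 's \<Rightarrow> real" where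
  "Rgen q x g z = (\<Sum>j\<in>UNIV. q z j x * (g j - g z))"

text \<open>The infimum and the suprema below are taken in the reals. For conservative rates and a
  Riemannian metric they are over nonempty sets that are bounded on the relevant side, so they
  agree with those in the extended reals:
  \<open>Rgen q x g z / g z \<ge> q z z x\<close> for \<open>g > 0\<close>; hence \<open>0 \<le> DV q x \<pi> \<le> (\<Sum>z. \<bar>q z z x\<bar>)\<close>,
  where \<open>g = 1\<close> gives the lower bound; hence \<open>Ham\<close> is finite and
  \<open>Ham M b q x p \<ge> \<bar>p\<bar>\<^sup>2 / 2 - \<beta> \<bar>p\<bar> - \<kappa>\<close> with \<open>\<beta>\<close>, \<open>\<kappa>\<close> depending on \<open>x\<close> only, so that
  \<open>Lag M b q x v\<close> is finite for every \<open>v\<close>.\<close>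

definition DV :: "('s::finite \<Rightarrow> 's \<Rightarrow> 'm \<Rightarrow> real) \<Rightarrow> 'm \<Rightarrow> 's pmf \<Rightarrow> real" where
  "DV q x \<pi> = - (INF g\<in>{g. \<forall>z. g z > 0}. measure_pmf.expectation \<pi> (\<lambda>z. Rgen q x g z / g z))"

definition Bfun ::
    "('m, 'e::euclidean_space) riem_structure \<Rightarrow> ('m \<Rightarrow> 's \<Rightarrow> 'e) \<Rightarrow> 'm \<Rightarrow> ('e \<Rightarrow>\<^sub>L real) \<Rightarrow> 's \<Rightarrow> real" where
  "Bfun M b x p z = blinfun_apply p (b x z) + (conorm M x p)\<^sup>2 / 2"

definition Ham ::
    "('m, 'e::euclidean_space) riem_structure \<Rightarrow> ('m \<Rightarrow> 's::finite \<Rightarrow> 'e) \<Rightarrow> ('s \<Rightarrow> 's \<Rightarrow> 'm \<Rightarrow> real)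
      \<Rightarrow> 'm \<Rightarrow> ('e \<Rightarrow>\<^sub>L real) \<Rightarrow> real" where
  "Ham M b q x p = (SUP \<pi>::'s pmf. measure_pmf.expectation \<pi> (Bfun M b x p) - DV q x \<pi>)"

definition Lag ::
    "('m, 'e::euclidean_space) riem_structure \<Rightarrow> ('m \<Rightarrow> 's::finite \<Rightarrow> 'e) \<Rightarrow> ('s \<Rightarrow> 's \<Rightarrow> 'm \<Rightarrow> real)
      \<Rightarrow> 'm \<Rightarrow> 'e \<Rightarrow> real" where
  "Lag M b q x v = (SUP p. blinfun_apply p v - Ham M b q x p)"

definition Hop ::
    "('m, 'e::euclidean_space) riem_structure \<Rightarrow> ('m \<Rightarrow> 's::finite \<Rightarrow> 'e) \<Rightarrow> ('s \<Rightarrow> 's \<Rightarrow> 'm \<Rightarrow> real)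
      \<Rightarrow> ('m \<Rightarrow> real) \<Rightarrow> 'm \<Rightarrow> real" where
  "Hop M b q f x = Ham M b q x (differential M f x)"

definition domH ::
    "('m::topological_space, 'e::euclidean_space) riem_structure \<Rightarrow> ('m \<Rightarrow> 's::finite \<Rightarrow> 'e)
      \<Rightarrow> ('s \<Rightarrow> 's \<Rightarrow> 'm \<Rightarrow> real) \<Rightarrow> ('m \<Rightarrow> real) set" where
  "domH M b q = {f\<in>Cb1 M. (SUP z. ereal (- Hop M b q f z)) < \<infinity>}"

end

theory Submission
  imports Defs "HOL-Complex_Analysis.Great_Picard"
begin

text \<open>
  The curve is an integral curve of the vector field that sends \<open>x\<close> to a velocity \<open>v\<close> at which the
  supremum defining \<open>\<L>(x, v)\<close> is attained at \<open>p = df(x)\<close>. Along such a curve the identity holds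
  pointwise in time, and integrating it gives the claim. What has to be shown is that this
  velocity can be chosen continuously in \<open>x\<close>, and that the curve does not leave \<open>M\<close> in finite time.

  \<^emph>\<open>Choice of the velocity.\<close> Put \<open>V(z) = p b(x, z)\<close>. By the Donsker--Varadhan formula,
  \<open>\<H>(x, p) - |p|\<^sup>2 / 2\<close> is the principal eigenvalue \<open>l\<close> of the matrix \<open>A = R\<^sub>x + diag V\<close>. If \<open>u\<close> and \<open>w\<close>
  are its positive right and left eigenvectors, the supremum over \<open>\<pi>\<close> is attained at the
  normalisation of \<open>\<pi>(z) = u(z) w(z)\<close>: testing \<open>\<I>\<close> with \<open>g = u\<close> shows that no \<open>\<pi>\<close> gives more than \<open>l\<close>, and
  \<open>ln r \<le> r - 1\<close> shows that \<open>g = u\<close> is optimal for this \<open>\<pi>\<close> (\<open>twisted_weight_minimises\<close>). With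
  this \<open>\<pi>\<close> the vector \<open>v = grad f(x) + \<Sum> \<pi>(z) b(x, z)\<close> is a subgradient of \<open>\<H>(x, \<sqdot>)\<close> at \<open>df(x)\<close>, hence
  \<open>\<L>(x, v) = df(x) v - \<H>(x, df(x))\<close> (\<open>Lag_optimal_velocity\<close>). Existence of \<open>u\<close> and \<open>w\<close> comes from Brouwer's theorem. They are unique
  and live in a compact simplex, so the closed graph theorem makes them, and with them \<open>\<pi>\<close>,
  continuous in the matrix. The gradient is continuous because the metric is locally uniformly
  elliptic.

  \<^emph>\<open>Local existence.\<close> The field is only continuous, so solutions come from Peano's theorem
  in a chart and need not be unique. Global solutions are obtained by greedily extending a
  given solution (\<open>global_continuation\<close>), which needs only that a solution on every \<open>[0, S]\<close> with
  \<open>S < T\<close> can be extended to \<open>[0, T]\<close>. By completeness this holds when its length is finite.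

  \<^emph>\<open>Finite length.\<close> The computation of \<open>\<L>\<close> also gives
  \<open>df(x) v - \<H>(x, df(x)) = |df(x)|\<^sup>2 / 2 + \<I>(x, \<pi>) \<ge> |df(x)|\<^sup>2 / 2\<close>. Since \<open>f\<close> and \<open>\<^bold>Hf\<close> are bounded and
  \<open>df(x) v\<close> is the time derivative of \<open>f\<close> along the curve, \<open>\<integral> |df(x(s))|\<^sup>2 ds\<close> is bounded on bounded
  time intervals. As \<open>|v| \<le> |df| + max |b|\<close> and \<open>b\<close> grows at most linearly, Gronwall's argument
  bounds the length (\<open>optimal_curve_length_bound\<close>).
\<close>

section \<open>Perron vectors of irreducible Metzler matrices\<close>

text \<open>The sign of the diagonal is left open, so that irreducible transition rates stay in this class when
  a potential is added to them.\<close>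

definition irreducible_metzler :: "real^'n^'n \<Rightarrow> bool" where
  "irreducible_metzler A \<longleftrightarrow> (\<forall>i j. i \<noteq> j \<longrightarrow> 0 \<le> A $ i $ j) \<and>
     (\<forall>i j. (i, j) \<in> {(k, l). k \<noteq> l \<and> 0 < A $ k $ l}\<^sup>*)"

definition prob_simplex :: "(real^'n) set" where
  "prob_simplex = {u. (\<forall>i. 0 \<le> u $ i) \<and> (\<Sum>i\<in>UNIV. u $ i) = 1}"

lemma irreducible_metzler_transpose:
  assumes "irreducible_metzler A"
  shows "irreducible_metzler (transpose A)"
proof -
  have eq: "{(k, l). k \<noteq> l \<and> 0 < transpose A $ k $ l} = {(k, l). k \<noteq> l \<and> 0 < A $ k $ l}\<inverse>"
    by (auto simp: transpose_def)
  show ?thesis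
    using assms unfolding irreducible_metzler_def eq rtrancl_converse by (auto simp: transpose_def)
qed

lemma compact_prob_simplex: "compact (prob_simplex :: (real^'n) set)"
proof (rule compact_eq_bounded_closed[THEN iffD2, OF conjI])
  have "norm u \<le> 1" if "u \<in> prob_simplex" for u :: "real^'n"
  proof -
    have "norm u \<le> (\<Sum>i\<in>UNIV. \<bar>u $ i\<bar>)" by (rule norm_le_l1_cart)
    also have "\<dots> = 1" using that by (simp add: prob_simplex_def)
    finally show ?thesis .
  qed
  then show "bounded (prob_simplex :: (real^'n) set)" unfolding bounded_iff by blast
  show "closed (prob_simplex :: (real^'n) set)"
    unfolding prob_simplex_def
    by (intro closed_Collect_conj closed_Collect_all closed_Collect_le closed_Collect_eq continuous_intros)
qed

lemma convex_prob_simplex: "convex prob_simplex"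
  unfolding convex_def prob_simplex_def
  by (auto simp: sum.distrib sum_distrib_left[symmetric])

text \<open>At a zero of \<open>u\<close> the eigenvalue equation is a vanishing sum of nonnegative terms. So zeros spread
  along the edges of the graph, and one zero makes \<open>u\<close> vanish everywhere.\<close>

lemma nonneg_eigenvector_pos:
  fixes A :: "real^'n^'n"
  assumes A: "irreducible_metzler A" and eig: "A *v u = l *\<^sub>R u"
    and nn: "\<And>i. 0 \<le> u $ i" and "u \<noteq> 0"
  shows "0 < u $ i"
proof (rule ccontr)
  assume "\<not> 0 < u $ i"
  with nn[of i] have ui: "u $ i = 0" by simp
  have "u $ j = 0" if "(i, j) \<in> {(k, l). k \<noteq> l \<and> 0 < A $ k $ l}\<^sup>*" for j
    using that
  proof induction
    case base show ?case by (rule ui)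
  next
    case (step k j)
    have "(\<Sum>m\<in>UNIV. A $ k $ m * u $ m) = 0"
      using arg_cong[OF eig, of "\<lambda>v. v $ k"] step.IH by (simp add: matrix_vector_mult_def)
    moreover have "0 \<le> A $ k $ m * u $ m" for m
      using A nn[of m] step.IH by (cases "k = m") (auto simp: irreducible_metzler_def)
    ultimately have "A $ k $ j * u $ j = 0"
      by (simp add: sum_nonneg_eq_0_iff)
    then show ?case using step.hyps(2) by auto
  qed
  then have "u = 0" using A by (simp add: irreducible_metzler_def vec_eq_iff)
  with \<open>u \<noteq> 0\<close> show False by simp
qed

lemma prob_simplex_nonzero: "u \<in> prob_simplex \<Longrightarrow> u \<noteq> 0"
  by (auto simp: prob_simplex_def)

text \<open>Adding a large multiple of the identity makes the matrix nonnegative without changing its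
  eigenvectors. The normalised map then sends the simplex into itself, and Brouwer's theorem
  gives a fixed point.\<close>

lemma exists_perron_vector:
  fixes A :: "real^'n^'n"
  assumes A: "irreducible_metzler A"
  shows "\<exists>u\<in>prob_simplex. \<exists>l. A *v u = l *\<^sub>R u"
proof -
  \<comment> \<open>Large enough for the diagonal of \<open>A + c\<close> to be at least \<open>1\<close>, so that \<open>F u \<ge> u\<close> on the simplex.\<close>
  define c where "c = 1 + (\<Sum>i\<in>UNIV. \<bar>A $ i $ i\<bar>)"
  define F where "F u = A *v u + c *\<^sub>R u" for u
  define s where "s u = (\<Sum>i\<in>UNIV. F u $ i)" for u
  have F_ge: "u $ i \<le> F u $ i" if "u \<in> prob_simplex" for u i
  proof -
    have "\<bar>A $ i $ i\<bar> \<le> (\<Sum>i\<in>UNIV. \<bar>A $ i $ i\<bar>)" by (rule member_le_sum) auto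
    then have ci: "1 \<le> A $ i $ i + c" unfolding c_def by linarith
    have u0: "0 \<le> u $ j" for j using that by (simp add: prob_simplex_def)
    have "F u $ i = (\<Sum>j\<in>UNIV. A $ i $ j * u $ j) + c * u $ i"
      by (simp add: F_def matrix_vector_mult_def)
    also have "\<dots> = (A $ i $ i + c) * u $ i + (\<Sum>j\<in>UNIV - {i}. A $ i $ j * u $ j)"
      by (subst sum.remove[of _ i]) (auto simp: algebra_simps)
    also have "\<dots> \<ge> 1 * u $ i + 0"
      using A u0 ci
      by (intro add_mono mult_right_mono sum_nonneg mult_nonneg_nonneg) (auto simp: irreducible_metzler_def)
    finally show ?thesis by simp
  qed
  have s_ge: "1 \<le> s u" if "u \<in> prob_simplex" for u
    using sum_mono[of UNIV "\<lambda>i. u $ i" "\<lambda>i. F u $ i"] F_ge[OF that] that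
    by (simp add: s_def prob_simplex_def)
  have contF: "continuous_on X F" for X
    unfolding F_def by (intro continuous_intros matrix_vector_mult_linear_continuous_on)
  obtain u where u: "u \<in> prob_simplex" "(1 / s u) *\<^sub>R F u = u"
  proof (rule brouwer[of prob_simplex "\<lambda>u. (1 / s u) *\<^sub>R F u"])
    show "prob_simplex \<noteq> ({} :: (real^'n) set)"
    proof -
      have "(\<chi> i. 1 / real CARD('n)) \<in> (prob_simplex :: (real^'n) set)" by (simp add: prob_simplex_def)
      then show ?thesis by blast
    qed
    show "continuous_on prob_simplex (\<lambda>u. (1 / s u) *\<^sub>R F u)"
      using s_ge unfolding s_def
      by (intro continuous_intros contF) (use s_ge s_def in fastforce)
    show "(\<lambda>u. (1 / s u) *\<^sub>R F u) \<in> prob_simplex \<rightarrow> prob_simplex"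
    proof
      fix u :: "real^'n" assume u: "u \<in> prob_simplex"
      have "0 \<le> F u $ i" for i using F_ge[OF u, of i] u by (auto simp: prob_simplex_def intro: order_trans)
      moreover have "(\<Sum>i\<in>UNIV. F u $ i / s u) = 1"
        using s_ge[OF u] by (simp add: sum_divide_distrib[symmetric] s_def[symmetric])
      ultimately show "(1 / s u) *\<^sub>R F u \<in> prob_simplex"
        using s_ge[OF u] by (simp add: prob_simplex_def)
    qed
  qed (auto simp: compact_prob_simplex convex_prob_simplex)
  have "F u = s u *\<^sub>R ((1 / s u) *\<^sub>R F u)" using s_ge[OF u(1)] by simp
  also have "\<dots> = s u *\<^sub>R u" using u(2) by simp
  finally have "A *v u = (s u - c) *\<^sub>R u" unfolding F_def by (simp add: algebra_simps)
  with u(1) show ?thesis by blast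
qed

text \<open>Pair the two eigenvectors: \<open>w \<bullet> A u\<close> is \<open>l (w \<bullet> u)\<close> as well as \<open>k (w \<bullet> u)\<close>, and \<open>w \<bullet> u > 0\<close>.\<close>

lemma perron_eigenvalue_eq_left:
  fixes A :: "real^'n^'n"
  assumes "irreducible_metzler A"
    and u: "u \<in> prob_simplex" "A *v u = l *\<^sub>R u"
    and w: "w \<in> prob_simplex" "transpose A *v w = k *\<^sub>R w"
  shows "l = k"
proof -
  have wpos: "0 < w $ i" for i
    using nonneg_eigenvector_pos[OF irreducible_metzler_transpose[OF assms(1)] w(2)] w(1)
      prob_simplex_nonzero[OF w(1)] by (auto simp: prob_simplex_def)
  have upos: "0 < u $ i" for i
    using nonneg_eigenvector_pos[OF assms(1) u(2)] u(1)
      prob_simplex_nonzero[OF u(1)] by (auto simp: prob_simplex_def)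
  have "l * (w \<bullet> u) = w \<bullet> (A *v u)" using u(2) by simp
  also have "\<dots> = (transpose A *v w) \<bullet> u" by (simp add: dot_lmul_matrix)
  also have "\<dots> = k * (w \<bullet> u)" using w(2) by simp
  finally have "l * (w \<bullet> u) = k * (w \<bullet> u)" .
  moreover have "0 < w \<bullet> u" unfolding inner_vec_def using upos wpos by (auto intro!: sum_pos)
  ultimately show ?thesis by simp
qed

text \<open>Both eigenvalues agree with the one of a left eigenvector. Subtracting from \<open>v\<close> the largest
  multiple of \<open>u\<close> that keeps the difference nonnegative gives an eigenvector with a zero entry,
  which must vanish.\<close>

lemma perron_vector_unique:
  fixes A :: "real^'n^'n"
  assumes A: "irreducible_metzler A"
    and u: "u \<in> prob_simplex" "A *v u = l *\<^sub>R u"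
    and v: "v \<in> prob_simplex" "A *v v = m *\<^sub>R v"
  shows "u = v"
proof -
  obtain w k where w: "w \<in> prob_simplex" "transpose A *v w = k *\<^sub>R w"
    using exists_perron_vector[OF irreducible_metzler_transpose[OF A]] by blast
  have ml: "m = l"
    using perron_eigenvalue_eq_left[OF A u w] perron_eigenvalue_eq_left[OF A v w] by simp
  have upos: "0 < u $ i" for i
    using nonneg_eigenvector_pos[OF A u(2)] u(1)
      prob_simplex_nonzero[OF u(1)] by (auto simp: prob_simplex_def)
  \<comment> \<open>The largest multiple of \<open>u\<close> below \<open>v\<close>.\<close>
  define t where "t = Min (range (\<lambda>i. v $ i / u $ i))"
  have "t \<in> range (\<lambda>i. v $ i / u $ i)" unfolding t_def by (rule Min_in) auto
  then obtain i0 where i0: "t = v $ i0 / u $ i0" by blast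
  define d where "d = v - t *\<^sub>R u"
  have "t \<le> v $ i / u $ i" for i unfolding t_def by (rule Min_le) auto
  then have dnn: "0 \<le> d $ i" for i using upos[of i] by (simp add: d_def pos_le_divide_eq[symmetric])
  have d0: "d $ i0 = 0" using upos[of i0] by (simp add: d_def i0)
  have "A *v d = l *\<^sub>R d"
    unfolding d_def using u(2) v(2) ml
    by (simp add: matrix_vector_mult_diff_distrib matrix_vector_mult_scaleR algebra_simps)
  then have "d = 0" using nonneg_eigenvector_pos[OF A _ dnn, of l i0] d0 by fastforce
  then have vt: "v = t *\<^sub>R u" by (simp add: d_def)
  then have "(\<Sum>i\<in>UNIV. v $ i) = t * (\<Sum>i\<in>UNIV. u $ i)" by (simp add: sum_distrib_left)
  then have "t = 1" using u(1) v(1) by (simp add: prob_simplex_def)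
  with vt show ?thesis by simp
qed

definition perron_vector :: "real^'n^'n \<Rightarrow> real^'n" where
  "perron_vector A = (THE u. u \<in> prob_simplex \<and> (\<exists>l. A *v u = l *\<^sub>R u))"

lemma perron_vector_eqI:
  assumes "irreducible_metzler A" "u \<in> prob_simplex" "A *v u = l *\<^sub>R u"
  shows "perron_vector A = u"
  unfolding perron_vector_def using perron_vector_unique[OF assms(1)] assms(2,3) by (intro the_equality) blast+

lemma perron_vector:
  assumes "irreducible_metzler A"
  shows "perron_vector A \<in> prob_simplex" "\<exists>l. A *v perron_vector A = l *\<^sub>R perron_vector A"
    "0 < perron_vector A $ i"
proof -
  obtain u l where u: "u \<in> prob_simplex" "A *v u = l *\<^sub>R u"
    using exists_perron_vector[OF assms] by blast
  have eq: "perron_vector A = u" by (rule perron_vector_eqI[OF assms u])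
  show "perron_vector A \<in> prob_simplex" "\<exists>l. A *v perron_vector A = l *\<^sub>R perron_vector A"
    using eq u by auto
  show "0 < perron_vector A $ i"
    unfolding eq using nonneg_eigenvector_pos[OF assms u(2)] u(1)
      prob_simplex_nonzero[OF u(1)] by (auto simp: prob_simplex_def)
qed

text \<open>The eigenvalue of a vector in the simplex is the sum of the entries of its image. This makes the
  eigenvector condition a closed condition on the pair of matrix and vector, so by uniqueness the
  graph is closed; its target is compact.\<close>

lemma continuous_on_perron_vector:
  "continuous_on {A :: real^'n^'n. irreducible_metzler A} perron_vector"
proof -
  let ?S = "{A :: real^'n^'n. irreducible_metzler A}"
  let ?T = "prob_simplex :: (real^'n) set"
  define C where "C = {p :: (real^'n^'n) \<times> (real^'n). \<forall>i. (\<Sum>j\<in>UNIV. fst p $ i $ j * snd p $ j)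
     = (\<Sum>k\<in>UNIV. \<Sum>j\<in>UNIV. fst p $ k $ j * snd p $ j) * snd p $ i}"
  have clC: "closed C" unfolding C_def
    by (intro closed_Collect_all closed_Collect_eq continuous_intros)
  have "(\<lambda>A. (A, perron_vector A)) ` ?S = (?S \<times> ?T) \<inter> C"
  proof (intro equalityI subsetI)
    fix p assume "p \<in> (\<lambda>A. (A, perron_vector A)) ` ?S"
    then obtain A where A: "irreducible_metzler A" and p: "p = (A, perron_vector A)" by auto
    let ?u = "perron_vector A"
    obtain l where l: "A *v ?u = l *\<^sub>R ?u" using perron_vector(2)[OF A] by blast
    have li: "(\<Sum>j\<in>UNIV. A $ i $ j * ?u $ j) = l * ?u $ i" for i
      using arg_cong[OF l, of "\<lambda>v. v $ i"] by (simp add: matrix_vector_mult_def)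
    have "(\<Sum>k\<in>UNIV. l * ?u $ k) = l"
      using perron_vector(1)[OF A] by (simp add: prob_simplex_def sum_distrib_left[symmetric])
    with li show "p \<in> (?S \<times> ?T) \<inter> C"
      using A perron_vector(1)[OF A] by (simp add: p C_def)
  next
    fix p assume "p \<in> (?S \<times> ?T) \<inter> C"
    then obtain A u where p: "p = (A, u)" and A: "irreducible_metzler A" and u: "u \<in> prob_simplex"
      and C: "(A, u) \<in> C" by (cases p) auto
    have "A *v u = (\<Sum>k\<in>UNIV. \<Sum>j\<in>UNIV. A $ k $ j * u $ j) *\<^sub>R u"
      using C unfolding C_def mem_Collect_eq fst_conv snd_conv
        vec_eq_iff matrix_vector_mult_def vec_lambda_beta vector_scaleR_component real_scaleR_def .
    then show "p \<in> (\<lambda>A. (A, perron_vector A)) ` ?S"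
      using perron_vector_eqI[OF A u] A p by auto
  qed
  then have "closedin (top_of_set (?S \<times> ?T)) ((\<lambda>A. (A, perron_vector A)) ` ?S)"
    using clC by (simp add: closedin_closed_Int)
  then show ?thesis
    using continuous_closed_graph_eq[OF compact_prob_simplex, of perron_vector ?S] perron_vector(1) by auto
qed

text \<open>The invariant distribution of the Markov chain with rates \<open>A(i, j) u(j) / u(i)\<close>, which is the Doob
  transform of \<open>A\<close> by its Perron vector \<open>u\<close>.\<close>

definition twisted_weight :: "real^'n^'n \<Rightarrow> 'n \<Rightarrow> real" where
  "twisted_weight A i = perron_vector A $ i * perron_vector (transpose A) $ i
     / (perron_vector A \<bullet> perron_vector (transpose A))"

lemma twisted_weight_sum_pos:
  fixes A :: "real^'n^'n"
  assumes "irreducible_metzler A"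
  shows "0 < perron_vector A \<bullet> perron_vector (transpose A)"
  unfolding inner_vec_def
  using perron_vector(3)[OF assms] perron_vector(3)[OF irreducible_metzler_transpose[OF assms]]
  by (auto intro!: sum_pos)

lemma twisted_weight_nonneg:
  assumes "irreducible_metzler A" shows "0 \<le> twisted_weight A i"
  unfolding twisted_weight_def
  using perron_vector(3)[OF assms] perron_vector(3)[OF irreducible_metzler_transpose[OF assms]]
    twisted_weight_sum_pos[OF assms] by (auto simp: less_imp_le)

lemma twisted_weight_sum:
  fixes A :: "real^'n^'n"
  assumes "irreducible_metzler A" shows "(\<Sum>i\<in>UNIV. twisted_weight A i) = 1"
  unfolding twisted_weight_def sum_divide_distrib[symmetric]
  using twisted_weight_sum_pos[OF assms] by (simp add: inner_vec_def)

lemma continuous_on_twisted_weight: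
  "continuous_on {A :: real^'n^'n. irreducible_metzler A} (\<lambda>A. twisted_weight A i)"
proof -
  have tr: "continuous_on S (transpose :: real^'n^'n \<Rightarrow> _)" for S
    unfolding transpose_def by (intro continuous_intros)
  have "continuous_on {A :: real^'n^'n. irreducible_metzler A} (\<lambda>A. perron_vector (transpose A))"
    by (rule continuous_on_compose2[OF continuous_on_perron_vector tr])
       (auto intro: irreducible_metzler_transpose)
  then show ?thesis unfolding twisted_weight_def
    by (intro continuous_intros continuous_on_perron_vector)
       (use twisted_weight_sum_pos in fastforce)+
qed

text \<open>Write \<open>g = r u\<close> and use \<open>r(j) / r(i) \<ge> 1 + ln r(j) - ln r(i)\<close>. The two logarithmic terms cancel,
  since the weights are invariant for the transformed chain, and the constant term contributes
  the eigenvalue. Equality holds for \<open>g = u\<close>.\<close>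

lemma twisted_weight_minimises:
  fixes A :: "real^'n^'n"
  assumes A: "irreducible_metzler A" and eig: "A *v perron_vector A = l *\<^sub>R perron_vector A"
    and g: "\<And>i. 0 < g i"
  shows "l \<le> (\<Sum>i\<in>UNIV. twisted_weight A i * ((\<Sum>j\<in>UNIV. A $ i $ j * g j) / g i))"
proof -
  define u where "u = perron_vector A"
  define w where "w = perron_vector (transpose A)"
  define s where "s = u \<bullet> w"
  have s: "0 < s" unfolding s_def u_def w_def by (rule twisted_weight_sum_pos[OF A])
  have upos: "0 < u $ i" and wpos: "0 < w $ i" for i
    unfolding u_def w_def using perron_vector(3)[OF A] perron_vector(3)[OF irreducible_metzler_transpose[OF A]] by auto
  obtain k where k: "transpose A *v w = k *\<^sub>R w"
    using perron_vector(2)[OF irreducible_metzler_transpose[OF A]] unfolding w_def by blast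
  have kl: "k = l"
    using perron_eigenvalue_eq_left[OF A perron_vector(1)[OF A] eig _ k]
      perron_vector(1)[OF irreducible_metzler_transpose[OF A]] w_def by simp
  have Au: "(\<Sum>j\<in>UNIV. A $ i $ j * u $ j) = l * u $ i" for i
    using arg_cong[OF eig, of "\<lambda>v. v $ i"] by (simp add: matrix_vector_mult_def u_def)
  have wA: "(\<Sum>i\<in>UNIV. A $ i $ j * w $ i) = l * w $ j" for j
    using arg_cong[OF k, of "\<lambda>v. v $ j"] by (simp add: matrix_vector_mult_def transpose_def kl)
  define r where "r i = g i / u $ i" for i
  have rpos: "0 < r i" for i using g upos by (simp add: r_def)
  have g_eq: "g i = r i * u $ i" for i using upos[of i] by (simp add: r_def)
  \<comment> \<open>For \<open>i = j\<close> both sides agree, whatever the sign of \<open>A $ i $ i\<close>.\<close>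
  have ineq: "w $ i * A $ i $ j * u $ j * (1 + ln (r j) - ln (r i)) \<le> w $ i * u $ i * (A $ i $ j * g j / g i)" for i j
  proof -
    have eq: "w $ i * u $ i * (A $ i $ j * g j / g i) = w $ i * A $ i $ j * u $ j * (r j / r i)"
      using upos[of i] rpos[of i] by (simp add: g_eq field_simps)
    show ?thesis
    proof (cases "i = j")
      case True
      then show ?thesis unfolding eq using rpos[of j] by simp
    next
      case False
      have "1 + ln (r j) - ln (r i) \<le> r j / r i"
        using ln_le_minus_one[of "r j / r i"] rpos[of i] rpos[of j] by (simp add: ln_divide_pos)
      moreover have "0 \<le> w $ i * A $ i $ j * u $ j"
        using A False upos[of j] wpos[of i] by (simp add: irreducible_metzler_def)
      ultimately show ?thesis unfolding eq by (rule mult_left_mono)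
    qed
  qed
  have sum1: "(\<Sum>i\<in>UNIV. \<Sum>j\<in>UNIV. w $ i * A $ i $ j * u $ j) = l * s"
  proof -
    have "(\<Sum>j\<in>UNIV. w $ i * A $ i $ j * u $ j) = l * (u $ i * w $ i)" for i
      using Au[of i] by (simp add: mult.assoc sum_distrib_left[symmetric])
    then show ?thesis by (simp add: s_def inner_vec_def sum_distrib_left)
  qed
  have sum2: "(\<Sum>i\<in>UNIV. \<Sum>j\<in>UNIV. w $ i * A $ i $ j * u $ j * ln (r j)) = (\<Sum>i\<in>UNIV. l * u $ i * w $ i * ln (r i))"
  proof -
    have "(\<Sum>i\<in>UNIV. w $ i * A $ i $ j * u $ j * ln (r j)) = l * u $ j * w $ j * ln (r j)" for j
    proof -
      have "(\<Sum>i\<in>UNIV. w $ i * A $ i $ j * u $ j * ln (r j)) = (\<Sum>i\<in>UNIV. A $ i $ j * w $ i) * (u $ j * ln (r j))"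
        unfolding sum_distrib_right by (simp add: mult_ac)
      then show ?thesis by (simp add: wA)
    qed
    then show ?thesis by (subst sum.swap) simp
  qed
  have sum3: "(\<Sum>i\<in>UNIV. \<Sum>j\<in>UNIV. w $ i * A $ i $ j * u $ j * ln (r i)) = (\<Sum>i\<in>UNIV. l * u $ i * w $ i * ln (r i))"
  proof -
    have "(\<Sum>j\<in>UNIV. w $ i * A $ i $ j * u $ j * ln (r i)) = (\<Sum>j\<in>UNIV. A $ i $ j * u $ j) * (w $ i * ln (r i))" for i
      unfolding sum_distrib_right by (simp add: mult_ac)
    then show ?thesis unfolding Au by (simp add: mult.assoc)
  qed
  have "l * s = (\<Sum>i\<in>UNIV. \<Sum>j\<in>UNIV. w $ i * A $ i $ j * u $ j * (1 + ln (r j) - ln (r i)))"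
    using sum1 sum2 sum3 by (simp add: algebra_simps sum.distrib sum_subtractf)
  also have "\<dots> \<le> (\<Sum>i\<in>UNIV. \<Sum>j\<in>UNIV. w $ i * u $ i * (A $ i $ j * g j / g i))"
    by (intro sum_mono ineq)
  also have "\<dots> = (\<Sum>i\<in>UNIV. twisted_weight A i * ((\<Sum>j\<in>UNIV. A $ i $ j * g j) / g i)) * s"
    unfolding sum_distrib_right twisted_weight_def u_def[symmetric] w_def[symmetric] s_def[symmetric]
    using s by (intro sum.cong refl) (simp add: sum_divide_distrib sum_distrib_left mult_ac)
  finally show ?thesis using s by simp
qed

section \<open>Peano's theorem and continuation of solutions\<close>

lemma norm_integral_diff_le:
  fixes f :: "real \<Rightarrow> 'a::euclidean_space"
  assumes f: "continuous_on UNIV f" and B: "\<And>t. norm (f t) \<le> B"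
  shows "norm (integral {0..s} f - integral {0..t} f) \<le> B * \<bar>s - t\<bar>"
proof -
  have B0: "0 \<le> B" using B[of 0] norm_ge_zero order_trans by blast
  have cont: "continuous_on {a..b} f" for a b using f continuous_on_subset by blast
  have *: "norm (integral {0..t} f - integral {0..s} f) \<le> B * (t - s)" if "s \<le> t" for s t
  proof (cases "0 \<le> s")
    case True
    have "integral {0..s} f + integral {s..t} f = integral {0..t} f"
      by (rule Henstock_Kurzweil_Integration.integral_combine) (use True that cont in \<open>auto intro: integrable_continuous_real\<close>)
    moreover have "norm (integral {s..t} f) \<le> B * (t - s)"
      by (rule integral_bound) (use that cont B in auto)
    ultimately show ?thesis by (metis add_diff_cancel_left')
  next
    case False
    then have s: "integral {0..s} f = 0" by simp
    show ?thesis
    proof (cases "0 \<le> t")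
      case True
      have "norm (integral {0..t} f) \<le> B * (t - 0)"
        by (rule integral_bound) (use True cont B in auto)
      also have "\<dots> \<le> B * (t - s)" using B0 False by (intro mult_left_mono) auto
      finally show ?thesis by (simp add: s)
    next
      case False
      then show ?thesis using B0 that s by simp
    qed
  qed
  show ?thesis using *[of s t] *[of t s] by (cases "s \<le> t") (auto simp: norm_minus_commute abs_if)
qed

text \<open>Tonelli's approximations solve \<open>x'(t) = F (x (t - h))\<close>. Since the right-hand side only looks
  back by \<open>h\<close>, Picard iteration becomes stationary on \<open>[0, 1]\<close> after finitely many steps. The
  approximations are uniformly Lipschitz, so by Arzela--Ascoli a subsequence converges as \<open>h\<close> tends
  to \<open>0\<close>, and dominated convergence passes to the limit in the integral equation.\<close>

lemma peano_existence_bounded: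
  fixes F :: "'a::euclidean_space \<Rightarrow> 'a"
  assumes F: "continuous_on UNIV F" and B: "\<And>z. norm (F z) \<le> B"
  obtains x where "x 0 = x0" "\<And>t. t \<in> {0..1} \<Longrightarrow> norm (x t - x0) \<le> B * t"
    "\<And>t. t \<in> {0..1} \<Longrightarrow> (x has_vector_derivative F (x t)) (at t within {0..1::real})"
proof -
  have B0: "0 \<le> B" using B[of 0] norm_ge_zero order_trans by blast
  define G where "G h = rec_nat (\<lambda>t::real. x0) (\<lambda>k g t. x0 + integral {0..t} (\<lambda>s. F (g (s - h))))" for h
  have G0: "G h 0 t = x0" and GS: "G h (Suc k) t = x0 + integral {0..t} (\<lambda>s. F (G h k (s - h)))" for h k t
    by (simp_all add: G_def)
  have lip: "norm (G h k s - G h k t) \<le> B * \<bar>s - t\<bar>" and cont: "continuous_on UNIV (G h k)" for h k s t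
  proof (induction k arbitrary: s t)
    case 0
    show "norm (G h 0 s - G h 0 t) \<le> B * \<bar>s - t\<bar>" for s t using B0 by (simp add: G0)
    show "continuous_on UNIV (G h 0)" unfolding G0[abs_def] by simp
  next
    case (Suc k)
    have c: "continuous_on UNIV (\<lambda>s. F (G h k (s - h)))"
      by (intro continuous_on_compose2[OF F] continuous_on_compose2[OF Suc(2)] continuous_intros) auto
    show lip: "norm (G h (Suc k) s - G h (Suc k) t) \<le> B * \<bar>s - t\<bar>" for s t
      using norm_integral_diff_le[OF c B, of s t] by (simp add: GS)
    have "B-lipschitz_on UNIV (G h (Suc k))"
      using lip B0 by (intro lipschitz_onI) (auto simp: dist_norm)
    then show "continuous_on UNIV (G h (Suc k))" by (rule lipschitz_on_continuous_on)
  qed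
  have stable: "G h (Suc k) t = G h k t" if "0 \<le> h" "t \<le> real k * h" for h k t
    using that(2)
  proof (induction k arbitrary: t)
    case 0
    then show ?case by (cases "t = 0") (auto simp: G0 GS)
  next
    case (Suc k)
    have "integral {0..t} (\<lambda>s. F (G h (Suc k) (s - h))) = integral {0..t} (\<lambda>s. F (G h k (s - h)))"
    proof (rule integral_cong)
      fix s assume "s \<in> {0..t}"
      then have "s - h \<le> real k * h" using Suc.prems by (auto simp: algebra_simps)
      then show "F (G h (Suc k) (s - h)) = F (G h k (s - h))" by (simp only: Suc.IH)
    qed
    then show ?case by (simp only: GS)
  qed
  \<comment> \<open>Delay \<open>1 / (n + 1)\<close> and \<open>n + 1\<close> iterations: just enough to cover \<open>[0, 1]\<close>.\<close>
  define d where "d n = 1 / real (Suc n)" for n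
  define X where "X n = G (d n) (Suc n)" for n
  have X_eq: "X n t = x0 + integral {0..t} (\<lambda>s. F (X n (s - d n)))" if "t \<le> 1" for n t
    using stable[of "d n" t "Suc n"] that unfolding X_def by (simp add: GS d_def)
  have X_lip: "norm (X n s - X n t) \<le> B * \<bar>s - t\<bar>" for n s t unfolding X_def by (rule lip)
  have X0: "X n 0 = x0" for n by (simp add: X_eq)
  have X_cont: "continuous_on UNIV (X n)" for n unfolding X_def by (rule cont)
  obtain g k where g: "continuous_on {0..1::real} g" and k: "strict_mono (k :: nat \<Rightarrow> nat)"
    and lim: "\<And>e. 0 < e \<Longrightarrow> \<exists>N. \<forall>n x. n \<ge> N \<and> x \<in> {0..1} \<longrightarrow> norm (X (k n) x - g x) < e"
  proof (rule Arzela_Ascoli[of "{0..1::real}" X "norm x0 + B"])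
    fix n and t :: real assume t: "t \<in> {0..1}"
    have "norm (X n t) \<le> norm x0 + norm (X n t - X n 0)"
      using norm_triangle_ineq[of x0 "X n t - X n 0"] by (simp add: X0)
    also have "norm (X n t - X n 0) \<le> B * 1"
      by (rule order_trans[OF X_lip]) (use t B0 in \<open>auto intro: mult_left_le\<close>)
    finally show "norm (X n t) \<le> norm x0 + B" by simp
  next
    fix t e :: real assume "t \<in> {0..1}" "0 < e"
    have "norm (X n t - X n y) < e" if "norm (t - y) < e / (B + 1)" for n y
    proof -
      have "B * \<bar>t - y\<bar> \<le> (B + 1) * \<bar>t - y\<bar>" by (simp add: mult_right_mono)
      also have "\<dots> < e" using that B0 by (simp add: field_simps)
      finally show ?thesis using X_lip[of n t y] by simp
    qed
    then show "\<exists>d>0. \<forall>n y. y \<in> {0..1} \<and> norm (t - y) < d \<longrightarrow> norm (X n t - X n y) < e"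
      using B0 \<open>0 < e\<close> by (intro exI[of _ "e / (B + 1)"]) auto
  qed auto
  have lim_g: "(\<lambda>n. X (k n) t) \<longlonglongrightarrow> g t" if "t \<in> {0..1}" for t
    unfolding LIMSEQ_iff using lim that by blast
  have dk: "(\<lambda>n. d (k n)) \<longlonglongrightarrow> 0"
    using LIMSEQ_subseq_LIMSEQ[OF LIMSEQ_inverse_real_of_nat k]
    by (simp add: d_def o_def inverse_eq_divide)
  have lim_delay: "(\<lambda>n. X (k n) (t - d (k n))) \<longlonglongrightarrow> g t" if t: "t \<in> {0..1}" for t
  proof -
    have "(\<lambda>n. X (k n) (t - d (k n)) - X (k n) t) \<longlonglongrightarrow> 0"
    proof (rule Lim_null_comparison)
      show "\<forall>\<^sub>F n in sequentially. norm (X (k n) (t - d (k n)) - X (k n) t) \<le> B * d (k n)"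
        using X_lip[of _ "t - d _" t] by (intro always_eventually) (simp add: d_def)
      show "(\<lambda>n. B * d (k n)) \<longlonglongrightarrow> 0" using tendsto_mult_right_zero[OF dk] by simp
    qed
    from tendsto_add[OF this lim_g[OF t]] show ?thesis by simp
  qed
  have Fg: "continuous_on {0..1} (\<lambda>s. F (g s))"
    by (rule continuous_on_compose2[OF F g]) auto
  have g_eq: "g t = x0 + integral {0..t} (\<lambda>s. F (g s))" if t: "t \<in> {0..1}" for t
  proof -
    have "(\<lambda>n. integral {0..t} (\<lambda>s. F (X (k n) (s - d (k n))))) \<longlonglongrightarrow> integral {0..t} (\<lambda>s. F (g s))"
    proof (rule dominated_convergence(2)[where h = "\<lambda>_. B"])
      show "(\<lambda>s. F (X (k n) (s - d (k n)))) integrable_on {0..t}" for n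
        by (intro integrable_continuous_real continuous_on_compose2[OF F] continuous_on_compose2[OF X_cont]
              continuous_intros) auto
      show "(\<lambda>n. F (X (k n) (s - d (k n)))) \<longlonglongrightarrow> F (g s)" if "s \<in> {0..t}" for s
        by (rule continuous_on_tendsto_compose[OF F lim_delay]) (use that t in auto)
    qed (use B in \<open>auto intro: integrable_continuous_real\<close>)
    then have "(\<lambda>n. X (k n) t) \<longlonglongrightarrow> x0 + integral {0..t} (\<lambda>s. F (g s))"
      using t by (subst X_eq) (auto intro: tendsto_intros)
    then show ?thesis using lim_g[OF t] LIMSEQ_unique by blast
  qed
  show thesis
  proof
    show "g 0 = x0" using g_eq[of 0] by simp
    show "norm (g t - x0) \<le> B * t" if t: "t \<in> {0..1}" for t
    proof -
      have "norm (integral {0..t} (\<lambda>s. F (g s))) \<le> B * (t - 0)"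
        by (rule integral_bound) (use t B Fg in \<open>auto intro: continuous_on_subset\<close>)
      then show ?thesis using g_eq[OF t] by simp
    qed
    show "(g has_vector_derivative F (g t)) (at t within {0..1})" if t: "t \<in> {0..1}" for t
    proof (rule has_vector_derivative_transform[OF t])
      show "((\<lambda>t. x0 + integral {0..t} (\<lambda>s. F (g s))) has_vector_derivative F (g t)) (at t within {0..1})"
        using has_vector_derivative_add[OF has_vector_derivative_const integral_has_vector_derivative[OF Fg t]] by simp
    qed (rule g_eq)
  qed
qed

text \<open>Composing \<open>F\<close> with the projection onto a small closed ball gives a bounded field on the whole
  space; a solution for it does not leave the ball during a short time.\<close>

lemma peano_existence:
  fixes F :: "'a::euclidean_space \<Rightarrow> 'a"
  assumes "open U" "continuous_on U F" "z0 \<in> U"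
  obtains e x where "0 < e" "x 0 = z0" "\<And>t. t \<in> {0..e} \<Longrightarrow> x t \<in> U"
    "\<And>t. t \<in> {0..e} \<Longrightarrow> (x has_vector_derivative F (x t)) (at t within {0..e::real})"
proof -
  obtain r where r: "0 < r" "cball z0 r \<subseteq> U" using assms open_contains_cball by blast
  let ?P = "closest_point (cball z0 r)"
  have P_in: "?P z \<in> cball z0 r" for z using r(1) by (intro closest_point_in_set) auto
  have contP: "continuous_on UNIV ?P" using r(1) by (intro continuous_on_closest_point) auto
  have FU: "continuous_on (cball z0 r) F" using assms(2) r(2) continuous_on_subset by blast
  have FP: "continuous_on UNIV (\<lambda>z. F (?P z))"
    by (rule continuous_on_compose2[OF FU contP]) (use P_in in auto)
  have "bounded (F ` cball z0 r)"
    using compact_continuous_image[OF FU] compact_imp_bounded by auto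
  then obtain B where B: "0 < B" "\<And>z. z \<in> cball z0 r \<Longrightarrow> norm (F z) \<le> B"
    unfolding bounded_pos by auto
  obtain x where x: "x 0 = z0" "\<And>t. t \<in> {0..1} \<Longrightarrow> norm (x t - z0) \<le> B * t"
    "\<And>t. t \<in> {0..1} \<Longrightarrow> (x has_vector_derivative F (?P (x t))) (at t within {0..1::real})"
    by (rule peano_existence_bounded[OF FP B(2)[OF P_in]]) blast
  \<comment> \<open>At speed at most \<open>B\<close> the solution stays in the ball of radius \<open>r\<close> up to this time.\<close>
  define e where "e = min 1 (r / B)"
  have e: "0 < e" "e \<le> 1" "B * e \<le> r" using r B by (auto simp: e_def min_def field_simps)
  have ball: "x t \<in> cball z0 r" if "t \<in> {0..e}" for t
  proof -
    have "norm (x t - z0) \<le> B * t" using that e by (intro x(2)) auto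
    also have "\<dots> \<le> B * e" using that B by (intro mult_left_mono) auto
    finally show ?thesis using e by (simp add: dist_norm norm_minus_commute)
  qed
  show thesis
  proof
    show "0 < e" "x 0 = z0" by fact+
    show "x t \<in> U" if "t \<in> {0..e}" for t using ball[OF that] r(2) by blast
    show "(x has_vector_derivative F (x t)) (at t within {0..e})" if t: "t \<in> {0..e}" for t
    proof -
      have "?P (x t) = x t" using ball[OF t] by (intro closest_point_self) auto
      then show ?thesis
        using has_vector_derivative_within_subset[OF x(3)[of t], of "{0..e}"] t e by auto
    qed
  qed
qed

text \<open>Read \<open>P T \<gamma>\<close> as: \<open>\<gamma>\<close> is a solution on \<open>[0, T]\<close>. In each step the solution is extended by the
  largest possible length of the form \<open>1 / (k + 1)\<close>. If the times stayed bounded, the limit would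
  again extend beyond its endpoint, say by more than \<open>1 / (k + 1)\<close>; then every step could have been
  that long, a contradiction. As solutions need not be unique, there is no single maximal solution to
  take instead.\<close>

lemma global_continuation:
  fixes P :: "real \<Rightarrow> (real \<Rightarrow> 'a) \<Rightarrow> bool"
  assumes cong: "\<And>T \<gamma> \<delta>. P T \<gamma> \<Longrightarrow> (\<And>t. t \<in> {0..T} \<Longrightarrow> \<gamma> t = \<delta> t) \<Longrightarrow> P T \<delta>"
    and restrict: "\<And>S T \<gamma>. P T \<gamma> \<Longrightarrow> 0 \<le> S \<Longrightarrow> S \<le> T \<Longrightarrow> P S \<gamma>"
    and extend: "\<And>T \<gamma>. 0 \<le> T \<Longrightarrow> P T \<gamma> \<Longrightarrow> \<exists>e>0. \<exists>\<delta>. P (T + e) \<delta> \<and> (\<forall>t\<in>{0..T}. \<delta> t = \<gamma> t)"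
    and limit: "\<And>T \<gamma>. 0 < T \<Longrightarrow> (\<And>S. 0 \<le> S \<Longrightarrow> S < T \<Longrightarrow> P S \<gamma>) \<Longrightarrow>
        \<exists>\<delta>. P T \<delta> \<and> (\<forall>t\<in>{0..<T}. \<delta> t = \<gamma> t)"
    and init: "P 0 \<gamma>0"
  shows "\<exists>\<gamma>. \<gamma> 0 = \<gamma>0 0 \<and> (\<forall>T\<ge>0. P T \<gamma>)"
proof -
  define ext where "ext T \<gamma> e \<delta> \<longleftrightarrow> P (T + e) \<delta> \<and> (\<forall>t\<in>{0..T}. \<delta> t = \<gamma> t)" for T \<gamma> e \<delta>
  define ok where "ok p \<longleftrightarrow> 0 \<le> fst p \<and> P (fst p) (snd p)" for p :: "real \<times> (real \<Rightarrow> 'a)"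
  define step where "step p p' \<longleftrightarrow> fst p < fst p' \<and> (\<forall>t\<in>{0..fst p}. snd p' t = snd p t) \<and>
     (\<forall>k. (\<exists>\<delta>. ext (fst p) (snd p) (1 / real (Suc k)) \<delta>) \<longrightarrow> fst p + 1 / real (Suc k) \<le> fst p')" for p p'
  have "\<exists>p :: nat \<Rightarrow> real \<times> (real \<Rightarrow> 'a). \<forall>n. (ok (p n) \<and> (n = 0 \<longrightarrow> p n = (0, \<gamma>0))) \<and> step (p n) (p (Suc n))"
  proof (rule dependent_nat_choice)
    show "\<exists>p. ok p \<and> (0 = 0 \<longrightarrow> p = (0, \<gamma>0))" using init by (auto simp: ok_def)
  next
    fix p :: "real \<times> (real \<Rightarrow> 'a)" and n :: nat
    assume "ok p \<and> (n = 0 \<longrightarrow> p = (0, \<gamma>0))"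
    then obtain T \<gamma> where p: "p = (T, \<gamma>)" and T: "0 \<le> T" "P T \<gamma>" by (cases p) (auto simp: ok_def)
    obtain e \<delta> where e: "0 < e" and \<delta>: "P (T + e) \<delta>" "\<forall>t\<in>{0..T}. \<delta> t = \<gamma> t" using extend[OF T] by blast
    obtain k0 where "1 / real (Suc k0) < e" using e nat_approx_posE by blast
    then have "ext T \<gamma> (1 / real (Suc k0)) \<delta>"
      unfolding ext_def using restrict[OF \<delta>(1), of "T + 1 / real (Suc k0)"] \<delta>(2) T by auto
    then have ex: "\<exists>k \<delta>. ext T \<gamma> (1 / real (Suc k)) \<delta>" by blast
    define k where "k = (LEAST k. \<exists>\<delta>. ext T \<gamma> (1 / real (Suc k)) \<delta>)"
    obtain \<delta>' where \<delta>': "ext T \<gamma> (1 / real (Suc k)) \<delta>'" using LeastI_ex[OF ex] unfolding k_def by blast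
    have "1 / real (Suc j) \<le> 1 / real (Suc k)" if "\<exists>\<delta>. ext T \<gamma> (1 / real (Suc j)) \<delta>" for j
      using Least_le[of "\<lambda>k. \<exists>\<delta>. ext T \<gamma> (1 / real (Suc k)) \<delta>", OF that] unfolding k_def[symmetric]
      by (intro divide_left_mono) auto
    then have "step p (T + 1 / real (Suc k), \<delta>')" using \<delta>' by (auto simp: step_def p ext_def)
    moreover have "ok (T + 1 / real (Suc k), \<delta>')" using \<delta>' T by (auto simp: ok_def ext_def)
    ultimately show "\<exists>p'. (ok p' \<and> (Suc n = 0 \<longrightarrow> p' = (0, \<gamma>0))) \<and> step p p'" by blast
  qed
  then obtain p :: "nat \<Rightarrow> real \<times> (real \<Rightarrow> 'a)" where p: "\<And>n. ok (p n)" "p 0 = (0, \<gamma>0)" "\<And>n. step (p n) (p (Suc n))"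
    by blast
  define T where "T n = fst (p n)" for n
  define g where "g n = snd (p n)" for n
  have T0: "T 0 = 0" and g0: "g 0 = \<gamma>0" using p(2) by (simp_all add: T_def g_def)
  have Tstrict: "strict_mono T" using p(3) by (simp add: strict_mono_Suc_iff step_def T_def)
  have P_g: "P (T n) (g n)" for n using p(1)[of n] by (simp add: ok_def T_def g_def)
  have T_nn: "0 \<le> T n" for n using p(1)[of n] by (simp add: ok_def T_def)
  have agree: "g n t = g m t" if "m \<le> n" "0 \<le> t" "t \<le> T m" for m n t
    using that(1)
  proof (induction rule: dec_induct)
    case base show ?case ..
  next
    case (step n)
    have "t \<le> T n" using that(3) step.hyps Tstrict by (meson order_trans strict_mono_less_eq)
    then show ?case using p(3)[of n] step.IH that(2) by (simp add: step_def T_def g_def)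
  qed
  define \<gamma> where "\<gamma> t = g (LEAST n. t \<le> T n) t" for t
  have \<gamma>_eq: "\<gamma> t = g n t" if "0 \<le> t" "t \<le> T n" for t n
    unfolding \<gamma>_def
    using agree[of "LEAST n. t \<le> T n" n t] LeastI[of "\<lambda>n. t \<le> T n" n] Least_le[of "\<lambda>n. t \<le> T n" n] that by simp
  have P_\<gamma>: "P S \<gamma>" if "0 \<le> S" "S \<le> T n" for S n
  proof (rule cong[OF restrict[OF P_g that]])
    show "g n t = \<gamma> t" if "t \<in> {0..S}" for t
      using \<gamma>_eq[of t n] that \<open>S \<le> T n\<close> by simp
  qed
  have unbounded: "\<exists>n. S \<le> T n" for S
  proof (rule ccontr)
    assume "\<not> (\<exists>n. S \<le> T n)"
    then have bdd: "bdd_above (range T)" by (intro bdd_aboveI[of _ S]) (auto simp: not_le less_imp_le)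
    define L where "L = (SUP n. T n)"
    have T_less: "T n < L" for n
      using cSUP_upper[OF _ bdd, of "Suc n"] strict_monoD[OF Tstrict, of n "Suc n"] by (simp add: L_def)
    have "\<exists>n. S' \<le> T n" if "S' < L" for S'
      using less_cSUP_iff[OF _ bdd] that unfolding L_def by (metis UNIV_not_empty less_imp_le)
    moreover have "0 < L" using T_less[of 0] T0 by simp
    ultimately obtain \<delta> where \<delta>: "P L \<delta>" "\<forall>t\<in>{0..<L}. \<delta> t = \<gamma> t" using limit[of L \<gamma>] P_\<gamma> by blast
    obtain e \<delta>' where e: "0 < e" and \<delta>': "P (L + e) \<delta>'" "\<forall>t\<in>{0..L}. \<delta>' t = \<delta> t"
      using extend[OF less_imp_le[OF \<open>0 < L\<close>] \<delta>(1)] by blast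
    obtain k where k: "1 / real (Suc k) < e" using e nat_approx_posE by blast
    have "ext (T n) (g n) (1 / real (Suc k)) \<delta>'" for n
      unfolding ext_def
    proof (intro conjI ballI)
      show "P (T n + 1 / real (Suc k)) \<delta>'"
        by (rule restrict[OF \<delta>'(1)]) (use k T_less[of n] T_nn[of n] in auto)
      show "\<delta>' t = g n t" if "t \<in> {0..T n}" for t
        using that \<delta>'(2) \<delta>(2) \<gamma>_eq[of t n] T_less[of n] by auto
    qed
    then have inc: "T n + 1 / real (Suc k) \<le> T (Suc n)" for n
      using p(3)[of n] unfolding step_def T_def g_def by blast
    have "real n * (1 / real (Suc k)) \<le> T n" for n
    proof (induction n)
      case 0 show ?case by (simp add: T0)
    next
      case (Suc n)
      have "real (Suc n) * (1 / real (Suc k)) = real n * (1 / real (Suc k)) + 1 / real (Suc k)"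
        by (simp add: distrib_right add_divide_distrib)
      then show ?case using inc[of n] Suc.IH by linarith
    qed
    moreover obtain n where "L < real n * (1 / real (Suc k))"
      using reals_Archimedean3[of "1 / real (Suc k)"] by auto
    ultimately show False using T_less[of n] by (meson less_imp_le less_le_trans not_less)
  qed
  have "\<gamma> 0 = \<gamma>0 0" using \<gamma>_eq[of 0 0] by (simp add: T0 g0)
  moreover have "P S \<gamma>" if "0 \<le> S" for S using P_\<gamma>[OF that] unbounded by blast
  ultimately show ?thesis by blast
qed

section \<open>Inner products on the tangent spaces and Riesz vectors\<close>

definition inner_form :: "('e::euclidean_space \<Rightarrow> 'e \<Rightarrow> real) \<Rightarrow> bool" where
  "inner_form g \<longleftrightarrow> bilinear g \<and> (\<forall>u v. g u v = g v u) \<and> (\<forall>v. v \<noteq> 0 \<longrightarrow> 0 < g v v)"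

lemma inner_form_riem_metric: "riemannian_manifold M \<Longrightarrow> inner_form (riem_metric M x)"
  by (simp add: riemannian_manifold_def inner_form_def)

context
  fixes g :: "'e::euclidean_space \<Rightarrow> 'e \<Rightarrow> real"
  assumes g: "inner_form g"
begin

lemma inner_form_bilinear: "bilinear g" and inner_form_sym: "g u v = g v u"
  and inner_form_pos: "v \<noteq> 0 \<Longrightarrow> 0 < g v v"
  using g by (auto simp: inner_form_def)

lemmas inner_form_simps =
  bilinear_ladd[OF inner_form_bilinear] bilinear_radd[OF inner_form_bilinear]
  bilinear_lsub[OF inner_form_bilinear] bilinear_rsub[OF inner_form_bilinear]
  bilinear_lmul[OF inner_form_bilinear] bilinear_rmul[OF inner_form_bilinear]
  bilinear_lzero[OF inner_form_bilinear] bilinear_rzero[OF inner_form_bilinear]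

lemma linear_inner_form: "linear (g u)"
  using inner_form_bilinear by (simp add: bilinear_def)

lemma inner_form_nonneg: "0 \<le> g v v"
  using inner_form_pos[of v] by (cases "v = 0") (auto simp: inner_form_simps)

lemma inner_form_Cauchy_Schwarz: "\<bar>g u v\<bar> \<le> sqrt (g u u) * sqrt (g v v)"
proof (cases "v = 0")
  case True
  then show ?thesis by (simp add: inner_form_simps)
next
  case False
  define w where "w = g v v *\<^sub>R u - g u v *\<^sub>R v"
  have "g w w = g v v * (g v v * g u u - (g u v)\<^sup>2)"
    by (simp add: w_def inner_form_simps inner_form_sym[of v u] power2_eq_square algebra_simps)
  then have "(g u v)\<^sup>2 \<le> g v v * g u u"
    using inner_form_nonneg[of w] inner_form_pos[OF False] by (simp add: zero_le_mult_iff)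
  then have "sqrt ((g u v)\<^sup>2) \<le> sqrt (g v v * g u u)" by (rule real_sqrt_le_mono)
  then show ?thesis by (simp add: real_sqrt_mult mult.commute)
qed

lemma riesz_representation:
  assumes "linear p"
  shows "\<exists>!n. \<forall>v. g n v = p v"
proof -
  define T where "T n = (\<Sum>i\<in>Basis. g n i *\<^sub>R i)" for n
  have T_inner: "T n \<bullet> v = g n v" for n v
  proof -
    have "g n v = g n (\<Sum>i\<in>Basis. (v \<bullet> i) *\<^sub>R i)" by (simp add: euclidean_representation)
    also have "\<dots> = (\<Sum>i\<in>Basis. (v \<bullet> i) * g n i)"
      by (simp only: linear_sum[OF linear_inner_form] inner_form_simps real_scaleR_def)
    also have "\<dots> = T n \<bullet> v" by (simp add: T_def inner_sum_left inner_sum_right inner_commute mult.commute)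
    finally show ?thesis ..
  qed
  have "linear T"
    by (intro linearI; simp add: T_def inner_form_simps scaleR_add_left sum.distrib scaleR_sum_right)
  moreover have inj: "inj T"
  proof (rule linear_injective_0[OF \<open>linear T\<close>, THEN iffD2], intro allI impI)
    fix n assume "T n = 0"
    then have "g n n = 0" using T_inner[of n n] by simp
    then show "n = 0" using inner_form_pos[of n] by auto
  qed
  ultimately have "surj T" using linear_injective_imp_surjective[of T] by simp
  then obtain n where n: "T n = (\<Sum>i\<in>Basis. p i *\<^sub>R i)" by (metis surjD)
  have "g n v = p v" for v
  proof -
    have "p v = p (\<Sum>i\<in>Basis. (v \<bullet> i) *\<^sub>R i)" by (simp add: euclidean_representation)
    also have "\<dots> = (\<Sum>i\<in>Basis. (v \<bullet> i) * p i)"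
      by (simp add: linear_sum[OF assms] linear_cmul[OF assms])
    also have "\<dots> = T n \<bullet> v" unfolding n inner_sum_left by (simp add: inner_commute mult.commute)
    finally show ?thesis by (simp add: T_inner)
  qed
  moreover have "m = n" if "\<forall>v. g m v = p v" "\<forall>v. g n v = p v" for m n
  proof -
    have "T m \<bullet> v = T n \<bullet> v" for v using that by (simp add: T_inner)
    then have "T m = T n" by (rule vector_eq_rdot[THEN iffD1, OF allI])
    with inj show ?thesis by (simp add: inj_eq)
  qed
  ultimately show ?thesis by blast
qed

end

definition riesz_vector :: "('e::euclidean_space \<Rightarrow> 'e \<Rightarrow> real) \<Rightarrow> ('e \<Rightarrow> real) \<Rightarrow> 'e" where
  "riesz_vector g p = (THE n. \<forall>v. g n v = p v)"

lemma riesz_vector: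
  assumes "inner_form g" "linear p"
  shows "g (riesz_vector g p) v = p v"
  using theI'[OF riesz_representation[OF assms]] unfolding riesz_vector_def by blast

lemma riesz_vector_unique:
  assumes "inner_form g" "linear p" "\<And>v. g n v = p v"
  shows "riesz_vector g p = n"
  using riesz_representation[OF assms(1,2)] riesz_vector[OF assms(1,2)] assms(3) by blast

lemma tnorm_nonneg: "riemannian_manifold M \<Longrightarrow> 0 \<le> tnorm M x v"
  unfolding tnorm_def using inner_form_nonneg[OF inner_form_riem_metric] by simp

lemma tnorm_power2: "riemannian_manifold M \<Longrightarrow> (tnorm M x v)\<^sup>2 = riem_metric M x v v"
  unfolding tnorm_def using inner_form_nonneg[OF inner_form_riem_metric] by simp

text \<open>Cauchy--Schwarz bounds the supremum, and the normalised Riesz vector attains it.\<close>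

lemma conorm_eq_tnorm_riesz:
  assumes M: "riemannian_manifold M"
  shows "conorm M x p = tnorm M x (riesz_vector (riem_metric M x) (blinfun_apply p))"
proof -
  let ?g = "riem_metric M x"
  let ?n = "riesz_vector ?g (blinfun_apply p)"
  note g = inner_form_riem_metric[OF M, of x]
  have pn: "blinfun_apply p v = ?g ?n v" for v
    using riesz_vector[OF g] by (simp add: blinfun.bounded_linear_right bounded_linear.linear)
  show ?thesis unfolding conorm_def
  proof (rule cSup_eq_maximum)
    show "tnorm M x ?n \<in> blinfun_apply p ` {v. tnorm M x v \<le> 1}"
    proof (cases "?n = 0")
      case True
      then show ?thesis
        by (intro image_eqI[of _ _ 0]) (auto simp: tnorm_def inner_form_simps[OF g] blinfun.zero_right)
    next
      case False
      let ?s = "tnorm M x ?n"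
      have s: "0 < ?s" using inner_form_pos[OF g False] by (simp add: tnorm_def)
      have "?g ?n ?n = ?s * ?s" using tnorm_power2[OF M, of x ?n] by (simp add: power2_eq_square)
      then have "blinfun_apply p ((1 / ?s) *\<^sub>R ?n) = ?s" "tnorm M x ((1 / ?s) *\<^sub>R ?n) = 1"
        using s by (simp_all add: pn inner_form_simps[OF g] tnorm_def[of M x "(1 / ?s) *\<^sub>R ?n"])
      then show ?thesis by (intro image_eqI[of _ _ "(1 / ?s) *\<^sub>R ?n"]) auto
    qed
    fix y assume "y \<in> blinfun_apply p ` {v. tnorm M x v \<le> 1}"
    then obtain v where v: "tnorm M x v \<le> 1" "y = ?g ?n v" by (auto simp: pn)
    have "y \<le> tnorm M x ?n * tnorm M x v"
      using inner_form_Cauchy_Schwarz[OF g, of ?n v] v(2) by (simp add: tnorm_def)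
    also have "\<dots> \<le> tnorm M x ?n * 1" using v(1) tnorm_nonneg[OF M] by (intro mult_left_mono) auto
    finally show "y \<le> tnorm M x ?n" by simp
  qed
qed


section \<open>An optimal velocity for every covector\<close>

text \<open>The Feynman--Kac generator of the jump process with potential \<open>V\<close>; its principal eigenvalue is the
  supremum over \<open>\<pi>\<close> of \<open>\<integral> V d\<pi> - \<I>(x, \<pi>)\<close>.\<close>

definition tilted_rates :: "('s::finite \<Rightarrow> 's \<Rightarrow> 'm \<Rightarrow> real) \<Rightarrow> 'm \<Rightarrow> ('s \<Rightarrow> real) \<Rightarrow> real^'s^'s" where
  "tilted_rates q x V = (\<chi> i j. q i j x + (if i = j then V i else 0))"

lemma irreducible_metzler_tilted_rates:
  assumes "conservative_rates (\<lambda>i j. q i j x)" "irreducible_rates (\<lambda>i j. q i j x)"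
  shows "irreducible_metzler (tilted_rates q x V)"
proof -
  have "{(k, l). k \<noteq> l \<and> 0 < tilted_rates q x V $ k $ l} = {(k, l). k \<noteq> l \<and> 0 < q k l x}"
    by (auto simp: tilted_rates_def)
  then show ?thesis
    using assms unfolding irreducible_metzler_def conservative_rates_def irreducible_rates_def
    by (auto simp: tilted_rates_def)
qed

lemma expectation_finite:
  fixes \<pi> :: "'s::finite pmf" and f :: "'s \<Rightarrow> real"
  shows "measure_pmf.expectation \<pi> f = (\<Sum>z\<in>UNIV. pmf \<pi> z * f z)"
  by (subst integral_measure_pmf_real[of UNIV]) (auto simp: mult.commute)

lemma sum_pmf_finite: "(\<Sum>z\<in>UNIV. pmf \<pi> z) = (1::real)" for \<pi> :: "'s::finite pmf"
  by (rule sum_pmf_eq_1) auto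

context
  fixes q :: "'s::finite \<Rightarrow> 's \<Rightarrow> 'm \<Rightarrow> real" and x :: 'm
  assumes cons: "conservative_rates (\<lambda>i j. q i j x)"
begin

lemma Rgen_eq_sum: "Rgen q x g z = (\<Sum>j\<in>UNIV. q z j x * g j)"
  using cons by (simp add: Rgen_def conservative_rates_def algebra_simps sum_subtractf
      sum_distrib_left[symmetric])

lemma tilted_rates_quotient:
  assumes "\<And>z. 0 < g z"
  shows "(\<Sum>j\<in>UNIV. tilted_rates q x V $ z $ j * g j) / g z = Rgen q x g z / g z + V z"
proof -
  have "(\<Sum>j\<in>UNIV. tilted_rates q x V $ z $ j * g j) = Rgen q x g z + (\<Sum>j\<in>UNIV. if z = j then V z * g j else 0)"
  proof -
    have "tilted_rates q x V $ z $ j * g j = q z j x * g j + (if z = j then V z * g j else 0)" for j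
      by (simp add: tilted_rates_def distrib_right)
    then show ?thesis by (simp add: Rgen_eq_sum sum.distrib)
  qed
  then show ?thesis using assms[of z] by (simp add: add_divide_distrib)
qed

text \<open>This bound does not depend on \<open>g\<close> and makes the infimum in the definition of \<open>DV\<close> a genuine one.\<close>

lemma Rgen_quotient_ge:
  assumes "\<And>z. 0 < g z"
  shows "q z z x \<le> Rgen q x g z / g z"
proof -
  have "q z z x * g z + 0 \<le> q z z x * g z + (\<Sum>j\<in>UNIV - {z}. q z j x * g j)"
    using cons assms by (intro add_mono sum_nonneg mult_nonneg_nonneg)
      (auto simp: conservative_rates_def less_imp_le)
  also have "\<dots> = Rgen q x g z" unfolding Rgen_eq_sum by (subst sum.remove[of UNIV z]) auto
  finally show ?thesis using assms[of z] by (simp add: pos_le_divide_eq)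
qed

lemma DV_integrals_bdd_below:
  "bdd_below ((\<lambda>g. measure_pmf.expectation \<pi> (\<lambda>z. Rgen q x g z / g z)) ` {g. \<forall>z. g z > 0})"
proof (rule bdd_belowI2)
  fix g :: "'s \<Rightarrow> real" assume "g \<in> {g. \<forall>z. g z > 0}"
  then show "(\<Sum>z\<in>UNIV. pmf \<pi> z * q z z x) \<le> measure_pmf.expectation \<pi> (\<lambda>z. Rgen q x g z / g z)"
    unfolding expectation_finite by (intro sum_mono mult_left_mono Rgen_quotient_ge) auto
qed

lemma DV_ge:
  assumes "\<And>z. 0 < g z"
  shows "- measure_pmf.expectation \<pi> (\<lambda>z. Rgen q x g z / g z) \<le> DV q x \<pi>"
  unfolding DV_def neg_le_iff_le
  by (rule cINF_lower[OF DV_integrals_bdd_below]) (use assms in auto)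

lemma DV_nonneg: "0 \<le> DV q x \<pi>"
  using DV_ge[of "\<lambda>_. 1" \<pi>] by (simp add: Rgen_def)

text \<open>Test the infimum in \<open>DV\<close> with \<open>g = u\<close>, for which \<open>R g / g = l - V\<close>.\<close>

lemma integral_minus_DV_le_eigenvalue:
  assumes u: "\<And>z. 0 < u $ z" and eig: "tilted_rates q x V *v u = l *\<^sub>R u"
  shows "measure_pmf.expectation \<pi> V - DV q x \<pi> \<le> l"
proof -
  have "Rgen q x (($) u) z / u $ z = l - V z" for z
  proof -
    have "(\<Sum>j\<in>UNIV. tilted_rates q x V $ z $ j * u $ j) = l * u $ z"
      using arg_cong[OF eig, of "\<lambda>v. v $ z"] by (simp add: matrix_vector_mult_def)
    then show ?thesis using tilted_rates_quotient[of "($) u" V z] u[of z] u by auto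
  qed
  then have "measure_pmf.expectation \<pi> (\<lambda>z. Rgen q x (($) u) z / u $ z) = l - measure_pmf.expectation \<pi> V"
    by (simp add: expectation_finite right_diff_distrib sum_subtractf sum_distrib_right[symmetric] sum_pmf_finite)
  then show ?thesis using DV_ge[of "($) u" \<pi>] u by simp
qed

lemma DV_twisted_le:
  assumes A: "irreducible_metzler (tilted_rates q x V)"
    and eig: "tilted_rates q x V *v perron_vector (tilted_rates q x V) = l *\<^sub>R perron_vector (tilted_rates q x V)"
    and \<pi>: "\<And>z. pmf \<pi> z = twisted_weight (tilted_rates q x V) z"
  shows "DV q x \<pi> \<le> measure_pmf.expectation \<pi> V - l"
proof -
  have "l - measure_pmf.expectation \<pi> V \<le> (INF g\<in>{g. \<forall>z. g z > 0}. measure_pmf.expectation \<pi> (\<lambda>z. Rgen q x g z / g z))"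
  proof (rule cINF_greatest)
    show "{g::'s \<Rightarrow> real. \<forall>z. g z > 0} \<noteq> {}" by (auto intro: exI[of _ "\<lambda>_. 1"])
    fix g :: "'s \<Rightarrow> real" assume "g \<in> {g. \<forall>z. g z > 0}"
    then have g: "\<And>z. 0 < g z" by simp
    have "l \<le> (\<Sum>z\<in>UNIV. pmf \<pi> z * (Rgen q x g z / g z + V z))"
      using twisted_weight_minimises[OF A eig g] by (simp add: tilted_rates_quotient[OF g] \<pi>)
    then show "l - measure_pmf.expectation \<pi> V \<le> measure_pmf.expectation \<pi> (\<lambda>z. Rgen q x g z / g z)"
      by (simp add: expectation_finite distrib_left sum.distrib)
  qed
  then show ?thesis unfolding DV_def by simp
qed

end

lemma exists_pmf_twisted_weight:
  fixes A :: "real^'s^'s"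
  assumes "irreducible_metzler A"
  shows "\<exists>\<pi>. \<forall>z. pmf \<pi> z = twisted_weight A z"
proof -
  have "(\<integral>\<^sup>+ z. ennreal (twisted_weight A z) \<partial>count_space UNIV) = 1"
    using twisted_weight_nonneg[OF assms]
    by (simp add: nn_integral_count_space_finite sum_ennreal twisted_weight_sum[OF assms])
  then have "pmf (embed_pmf (twisted_weight A)) z = twisted_weight A z" for z
    by (intro pmf_embed_pmf twisted_weight_nonneg[OF assms])
  then show ?thesis by blast
qed

text \<open>One measure \<open>\<pi>\<close> attains the supremum for \<open>p\<close> and competes in the supremum for every other
  \<open>p'\<close>. So its affine-quadratic function of \<open>p'\<close> lies below the Hamiltonian and touches it
  at \<open>p\<close>.\<close>

lemma Ham_optimal_measure:
  fixes M :: "('m, 'e::euclidean_space) riem_structure" and b :: "'m \<Rightarrow> 's::finite \<Rightarrow> 'e"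
  assumes "conservative_rates (\<lambda>i j. q i j x)" "irreducible_rates (\<lambda>i j. q i j x)"
  obtains \<pi> where "\<And>z. pmf \<pi> z = twisted_weight (tilted_rates q x (\<lambda>z. blinfun_apply p (b x z))) z"
    "Ham M b q x p = measure_pmf.expectation \<pi> (Bfun M b x p) - DV q x \<pi>"
    "\<And>p'. measure_pmf.expectation \<pi> (Bfun M b x p') - DV q x \<pi> \<le> Ham M b q x p'"
proof -
  define V where "V z = blinfun_apply p (b x z)" for z
  let ?A = "tilted_rates q x V"
  have A: "irreducible_metzler ?A" by (rule irreducible_metzler_tilted_rates[of q, OF assms])
  obtain \<pi> where \<pi>: "\<And>z. pmf \<pi> z = twisted_weight ?A z" using exists_pmf_twisted_weight[OF A] by blast
  obtain l where l: "?A *v perron_vector ?A = l *\<^sub>R perron_vector ?A" using perron_vector(2)[OF A] by blast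
  have B: "measure_pmf.expectation \<rho> (Bfun M b x p) = measure_pmf.expectation \<rho> V + (conorm M x p)\<^sup>2 / 2" for \<rho>
    by (simp add: expectation_finite Bfun_def V_def distrib_left sum.distrib
        sum_distrib_right[symmetric] sum_divide_distrib[symmetric] sum_pmf_finite)
  have bdd: "bdd_above (range (\<lambda>\<rho>. measure_pmf.expectation \<rho> (Bfun M b x p') - DV q x \<rho>))" for p'
  proof (rule bdd_aboveI2)
    fix \<rho>
    have "pmf \<rho> z * Bfun M b x p' z \<le> \<bar>Bfun M b x p' z\<bar>" for z
      using mult_left_mono[OF abs_ge_self, of "pmf \<rho> z" "Bfun M b x p' z"]
        mult_right_mono[OF pmf_le_1, of "\<bar>Bfun M b x p' z\<bar>" \<rho> z] by simp
    then have "measure_pmf.expectation \<rho> (Bfun M b x p') \<le> (\<Sum>z\<in>UNIV. \<bar>Bfun M b x p' z\<bar>)"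
      unfolding expectation_finite by (rule sum_mono)
    then show "measure_pmf.expectation \<rho> (Bfun M b x p') - DV q x \<rho> \<le> (\<Sum>z\<in>UNIV. \<bar>Bfun M b x p' z\<bar>)"
      using DV_nonneg[of q x \<rho>, OF assms(1)] by simp
  qed
  have upper: "measure_pmf.expectation \<rho> (Bfun M b x p) - DV q x \<rho> \<le> l + (conorm M x p)\<^sup>2 / 2" for \<rho>
    using integral_minus_DV_le_eigenvalue[of q x, OF assms(1) perron_vector(3)[OF A] l, of \<rho>]
    by (simp add: B)
  have attained: "l + (conorm M x p)\<^sup>2 / 2 \<le> measure_pmf.expectation \<pi> (Bfun M b x p) - DV q x \<pi>"
    using DV_twisted_le[of q x, OF assms(1) A l \<pi>] by (simp add: B)
  show thesis
  proof
    show "pmf \<pi> z = twisted_weight (tilted_rates q x (\<lambda>z. blinfun_apply p (b x z))) z" for z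
      using \<pi> by (simp add: V_def[abs_def])
    show "Ham M b q x p = measure_pmf.expectation \<pi> (Bfun M b x p) - DV q x \<pi>"
      unfolding Ham_def
      by (rule cSup_eq_maximum) (use upper attained order_trans in blast)+
    show "measure_pmf.expectation \<pi> (Bfun M b x p') - DV q x \<pi> \<le> Ham M b q x p'" for p'
      unfolding Ham_def by (rule cSUP_upper[OF _ bdd]) simp
  qed
qed

text \<open>The derivative at \<open>p\<close> of \<open>p' \<mapsto> \<integral> B(x, p') d\<pi>\<close> for the maximising measure \<open>\<pi>\<close>.\<close>

definition optimal_velocity :: "('m, 'e::euclidean_space) riem_structure \<Rightarrow> ('m \<Rightarrow> 's::finite \<Rightarrow> 'e)
      \<Rightarrow> ('s \<Rightarrow> 's \<Rightarrow> 'm \<Rightarrow> real) \<Rightarrow> 'm \<Rightarrow> ('e \<Rightarrow>\<^sub>L real) \<Rightarrow> 'e" where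
  "optimal_velocity M b q x p = riesz_vector (riem_metric M x) (blinfun_apply p) +
     (\<Sum>z\<in>UNIV. twisted_weight (tilted_rates q x (\<lambda>z. blinfun_apply p (b x z))) z *\<^sub>R b x z)"

text \<open>Let \<open>n\<close> be the Riesz vector of \<open>p\<close>. For the maximising measure \<open>\<pi>\<close>, replacing the Hamiltonian at \<open>p'\<close> by its minorant bounds
  \<open>p' v - \<H>(x, p')\<close> by \<open>p' n - |p'|\<^sup>2 / 2 + \<I>(x, \<pi>)\<close>, which by Young's inequality is at most
  \<open>|p|\<^sup>2 / 2 + \<I>(x, \<pi>)\<close>. At \<open>p' = p\<close> all these inequalities are equalities, and \<open>\<I> \<ge> 0\<close> gives
  the second claim.\<close>

lemma Lag_optimal_velocity:
  fixes M :: "('m::topological_space, 'e::euclidean_space) riem_structure" and b :: "'m \<Rightarrow> 's::finite \<Rightarrow> 'e"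
    and p :: "'e \<Rightarrow>\<^sub>L real"
  assumes M: "riemannian_manifold M"
    and q: "conservative_rates (\<lambda>i j. q i j x)" "irreducible_rates (\<lambda>i j. q i j x)"
  defines "v \<equiv> optimal_velocity M b q x p"
  shows "Lag M b q x v = blinfun_apply p v - Ham M b q x p"
    and "(conorm M x p)\<^sup>2 / 2 \<le> blinfun_apply p v - Ham M b q x p"
proof -
  let ?R = "\<lambda>p. riesz_vector (riem_metric M x) (blinfun_apply p)"
  note g = inner_form_riem_metric[OF M, of x]
  have R: "blinfun_apply p' w = riem_metric M x (?R p') w" for p' w
    using riesz_vector[OF g] by (simp add: blinfun.bounded_linear_right bounded_linear.linear)
  obtain \<pi> where \<pi>: "\<And>z. pmf \<pi> z = twisted_weight (tilted_rates q x (\<lambda>z. blinfun_apply p (b x z))) z"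
    "Ham M b q x p = measure_pmf.expectation \<pi> (Bfun M b x p) - DV q x \<pi>"
    "\<And>p'. measure_pmf.expectation \<pi> (Bfun M b x p') - DV q x \<pi> \<le> Ham M b q x p'"
    by (rule Ham_optimal_measure[of q x p b M, OF q]) blast
  have v: "v = ?R p + (\<Sum>z\<in>UNIV. pmf \<pi> z *\<^sub>R b x z)" by (simp add: v_def optimal_velocity_def \<pi>(1))
  have E: "blinfun_apply p' v - (measure_pmf.expectation \<pi> (Bfun M b x p') - DV q x \<pi>)
      = blinfun_apply p' (?R p) - (conorm M x p')\<^sup>2 / 2 + DV q x \<pi>" for p'
    by (simp add: v expectation_finite Bfun_def distrib_left sum.distrib blinfun.add_right blinfun.sum_right
        blinfun.scaleR_right sum_distrib_right[symmetric] sum_divide_distrib[symmetric] sum_pmf_finite)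
  have norm_p: "blinfun_apply p (?R p) = (conorm M x p)\<^sup>2"
    by (simp add: R conorm_eq_tnorm_riesz[OF M] tnorm_power2[OF M])
  have val: "blinfun_apply p v - Ham M b q x p = (conorm M x p)\<^sup>2 / 2 + DV q x \<pi>"
    using E[of p] by (simp add: \<pi>(2) norm_p)
  have upper: "blinfun_apply p' v - Ham M b q x p' \<le> blinfun_apply p v - Ham M b q x p" for p'
  proof -
    have "blinfun_apply p' (?R p) \<le> conorm M x p' * conorm M x p"
      using inner_form_Cauchy_Schwarz[OF g, of "?R p'" "?R p"]
      by (simp add: R conorm_eq_tnorm_riesz[OF M] tnorm_def)
    also have "\<dots> \<le> (conorm M x p')\<^sup>2 / 2 + (conorm M x p)\<^sup>2 / 2"
      using sum_squares_bound[of "conorm M x p'" "conorm M x p"] by simp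
    finally have "blinfun_apply p' (?R p) - (conorm M x p')\<^sup>2 / 2 + DV q x \<pi> \<le> (conorm M x p)\<^sup>2 / 2 + DV q x \<pi>"
      by simp
    then show ?thesis unfolding val E[symmetric] using \<pi>(3)[of p'] by linarith
  qed
  show "Lag M b q x v = blinfun_apply p v - Ham M b q x p"
    unfolding Lag_def by (rule cSup_eq_maximum) (use upper in auto)
  show "(conorm M x p)\<^sup>2 / 2 \<le> blinfun_apply p v - Ham M b q x p"
    unfolding val using DV_nonneg[of q x \<pi>, OF q(1)] by simp
qed

section \<open>Charts\<close>

context
  fixes M :: "('m::t2_space, 'e::euclidean_space) riem_structure"
  assumes M: "smooth_manifold M"
begin

lemma chart_at_atlas: "chart_at M x \<in> atlas M" and chart_at_dom: "x \<in> cdom (chart_at M x)"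
  using M by (auto simp: smooth_manifold_def)

lemma open_cdom: "c \<in> atlas M \<Longrightarrow> open (cdom c)"
  and open_chart_image: "c \<in> atlas M \<Longrightarrow> open (cmap c ` cdom c)"
  and chart_homeomorphism: "c \<in> atlas M \<Longrightarrow> homeomorphism (cdom c) (cmap c ` cdom c) (cmap c) (cinv c)"
  using M by (auto simp: smooth_manifold_def is_chart_def)

lemma cinv_cmap: "c \<in> atlas M \<Longrightarrow> x \<in> cdom c \<Longrightarrow> cinv c (cmap c x) = x"
  using homeomorphism_apply1[OF chart_homeomorphism] by blast

lemma cmap_cinv: "c \<in> atlas M \<Longrightarrow> y \<in> cmap c ` cdom c \<Longrightarrow> cmap c (cinv c y) = y"
  using homeomorphism_apply2[OF chart_homeomorphism] by blast

lemma cinv_in_cdom: "c \<in> atlas M \<Longrightarrow> y \<in> cmap c ` cdom c \<Longrightarrow> cinv c y \<in> cdom c"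
  using cinv_cmap by auto

lemma continuous_on_cmap: "c \<in> atlas M \<Longrightarrow> continuous_on (cdom c) (cmap c)"
  using homeomorphism_cont1[OF chart_homeomorphism] by blast

lemma continuous_on_cinv: "c \<in> atlas M \<Longrightarrow> continuous_on (cmap c ` cdom c) (cinv c)"
  using homeomorphism_cont2[OF chart_homeomorphism] by blast

lemma open_chart_overlap:
  assumes "c \<in> atlas M" "c' \<in> atlas M"
  shows "open (cmap c ` (cdom c \<inter> cdom c'))"
proof -
  have "openin (top_of_set (cdom c)) (cdom c \<inter> cdom c')"
    using open_cdom[OF assms(2)] by (simp add: openin_open_Int)
  then have "openin (top_of_set (cmap c ` cdom c)) (cmap c ` (cdom c \<inter> cdom c'))"
    by (rule homeomorphism_imp_open_map[OF chart_homeomorphism[OF assms(1)]])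
  then show ?thesis using open_chart_image[OF assms(1)] openin_open_trans by blast
qed

lemma change_has_derivative:
  assumes "c \<in> atlas M" "c' \<in> atlas M" "x \<in> cdom c" "x \<in> cdom c'"
  shows "((cmap c' \<circ> cinv c) has_derivative change_deriv c c' x) (at (cmap c x))"
proof -
  have "ck_on (Suc 0) (cmap c ` (cdom c \<inter> cdom c')) (cmap c' \<circ> cinv c)"
    using M assms unfolding smooth_manifold_def smooth_on_def by blast
  then have "(cmap c' \<circ> cinv c) differentiable (at (cmap c x))" using assms by auto
  then show ?thesis unfolding change_deriv_def using frechet_derivative_works by blast
qed

lemma linear_change_deriv:
  assumes "c \<in> atlas M" "c' \<in> atlas M" "x \<in> cdom c" "x \<in> cdom c'"
  shows "linear (change_deriv c c' x)"
  using has_derivative_linear[OF change_has_derivative[OF assms]] .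

lemma change_deriv_cocycle:
  assumes "c \<in> atlas M" "c' \<in> atlas M" "c'' \<in> atlas M" "x \<in> cdom c" "x \<in> cdom c'" "x \<in> cdom c''"
  shows "change_deriv c' c'' x (change_deriv c c' x v) = change_deriv c c'' x v"
proof -
  have eq: "(cmap c' \<circ> cinv c) (cmap c x) = cmap c' x" using assms by (simp add: cinv_cmap)
  have "((cmap c'' \<circ> cinv c') \<circ> (cmap c' \<circ> cinv c) has_derivative change_deriv c' c'' x \<circ> change_deriv c c' x) (at (cmap c x))"
    by (rule diff_chain_at, unfold eq) (use assms change_has_derivative in blast)+
  then have "(cmap c'' \<circ> cinv c has_derivative change_deriv c' c'' x \<circ> change_deriv c c' x) (at (cmap c x))"
    by (rule has_derivative_transform_within_open[OF _ open_chart_overlap[of c c']])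
       (use assms in \<open>auto simp: cinv_cmap\<close>)
  from has_derivative_unique[OF this change_has_derivative[of c c'' x]] assms
  show ?thesis by (metis comp_apply)
qed

lemma change_deriv_self:
  assumes "c \<in> atlas M" "x \<in> cdom c"
  shows "change_deriv c c x v = v"
proof -
  have "((\<lambda>y. y) has_derivative (\<lambda>v. v)) (at (cmap c x))" by (rule has_derivative_ident)
  then have "(cmap c \<circ> cinv c has_derivative (\<lambda>v. v)) (at (cmap c x))"
    by (rule has_derivative_transform_within_open[OF _ open_chart_image[OF assms(1)]])
       (use assms in \<open>auto simp: cinv_cmap\<close>)
  from has_derivative_unique[OF this change_has_derivative[of c c x]] assms
  show ?thesis by metis
qed

lemma continuous_on_UNIV_charts:
  assumes "\<And>c. c \<in> atlas M \<Longrightarrow> continuous_on (cdom c) h"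
  shows "continuous_on UNIV h"
proof -
  have "isCont h x" for x
    using assms[OF chart_at_atlas, of x] continuous_on_eq_continuous_at[OF open_cdom[OF chart_at_atlas]]
      chart_at_dom[of x] by blast
  then show ?thesis by (simp add: continuous_at_imp_continuous_on)
qed

end

section \<open>Continuous vector fields, the metric and the gradient\<close>

text \<open>The components of the vector field in the chart \<open>c\<close>. The values \<open>X x\<close> themselves refer to the
  chart selected at \<open>x\<close>, which may jump with \<open>x\<close>; only these components have a meaningful
  dependence on \<open>x\<close>.\<close>

definition in_chart ::
    "('m, 'e::euclidean_space) riem_structure \<Rightarrow> ('m, 'e) chart \<Rightarrow> ('m \<Rightarrow> 'e) \<Rightarrow> 'm \<Rightarrow> 'e" where
  "in_chart M c X x = change_deriv (chart_at M x) c x (X x)"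

definition continuous_field ::
    "('m::topological_space, 'e::euclidean_space) riem_structure \<Rightarrow> ('m \<Rightarrow> 'e) \<Rightarrow> bool" where
  "continuous_field M X \<longleftrightarrow> (\<forall>c\<in>atlas M. continuous_on (cdom c) (in_chart M c X))"

lemma bilinear_Basis_expansion:
  fixes g :: "'e::euclidean_space \<Rightarrow> 'e \<Rightarrow> real"
  assumes "bilinear g"
  shows "g u v = (\<Sum>i\<in>Basis. \<Sum>j\<in>Basis. (u \<bullet> i) * (v \<bullet> j) * g i j)"
proof -
  have l1: "linear (\<lambda>u. g u v)" and l2: "linear (g u)" for u v using assms by (auto simp: bilinear_def)
  have "g u v = g (\<Sum>i\<in>Basis. (u \<bullet> i) *\<^sub>R i) v" by (simp add: euclidean_representation)
  also have "\<dots> = (\<Sum>i\<in>Basis. (u \<bullet> i) * g i v)"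
    by (simp only: linear_sum[OF l1] linear_cmul[OF l1] real_scaleR_def)
  also have "\<dots> = (\<Sum>i\<in>Basis. (u \<bullet> i) * g i (\<Sum>j\<in>Basis. (v \<bullet> j) *\<^sub>R j))"
    by (simp add: euclidean_representation)
  also have "\<dots> = (\<Sum>i\<in>Basis. (u \<bullet> i) * (\<Sum>j\<in>Basis. (v \<bullet> j) * g i j))"
    by (simp only: linear_sum[OF l2] linear_cmul[OF l2] real_scaleR_def)
  finally show ?thesis by (simp add: sum_distrib_left mult.assoc)
qed

lemma linear_Basis_expansion:
  fixes h :: "'e::euclidean_space \<Rightarrow> real"
  assumes "linear h"
  shows "h v = (\<Sum>i\<in>Basis. (v \<bullet> i) * h i)"
proof -
  have "h v = h (\<Sum>i\<in>Basis. (v \<bullet> i) *\<^sub>R i)" by (simp add: euclidean_representation)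
  then show ?thesis by (simp only: linear_sum[OF assms] linear_cmul[OF assms] real_scaleR_def)
qed

lemma inner_form_elliptic:
  fixes g :: "'e::euclidean_space \<Rightarrow> 'e \<Rightarrow> real"
  assumes g: "inner_form g"
  obtains m where "0 < m" "\<And>v. m * (norm v)\<^sup>2 \<le> g v v"
proof -
  have bb: "bounded_bilinear g" using inner_form_bilinear[OF g] bilinear_conv_bounded_bilinear by blast
  have "continuous_on (sphere 0 1) (\<lambda>v. g v v)"
    by (intro bounded_bilinear.continuous_on[OF bb] continuous_intros)
  then obtain w where w: "w \<in> sphere 0 1" "\<And>v. v \<in> sphere 0 1 \<Longrightarrow> g w w \<le> g v v"
    using continuous_attains_inf[of "sphere 0 1" "\<lambda>v. g v v"] by auto
  show thesis
  proof
    show "0 < g w w" using w(1) by (intro inner_form_pos[OF g]) auto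
    show "g w w * (norm v)\<^sup>2 \<le> g v v" for v
    proof (cases "v = 0")
      case False
      have "g w w \<le> g ((1 / norm v) *\<^sub>R v) ((1 / norm v) *\<^sub>R v)" using False by (intro w(2)) simp
      also have "\<dots> = g v v / (norm v)\<^sup>2" by (simp add: inner_form_simps[OF g] power2_eq_square)
      finally show ?thesis using False by (simp add: pos_le_divide_eq)
    qed (simp add: inner_form_simps[OF g])
  qed
qed

text \<open>Let \<open>d\<close> be the difference of the Riesz vectors at \<open>y\<close> and at \<open>y0\<close>. Then \<open>G y d d\<close> equals
  \<open>\<alpha> y d - G y (w y0) d\<close>, which is at most \<open>E y |d|\<close> with \<open>E y\<close> tending to \<open>0\<close>. Near \<open>y0\<close> the form \<open>G y\<close> is
  uniformly elliptic, so \<open>|d|\<close> is bounded by a multiple of \<open>E y\<close>.\<close>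

lemma continuous_on_riesz_vector:
  fixes G :: "'a::topological_space \<Rightarrow> 'e::euclidean_space \<Rightarrow> 'e \<Rightarrow> real"
  assumes G: "\<And>y. y \<in> S \<Longrightarrow> inner_form (G y)" and \<alpha>: "\<And>y. y \<in> S \<Longrightarrow> linear (\<alpha> y)"
    and contG: "\<And>u v. continuous_on S (\<lambda>y. G y u v)" and cont\<alpha>: "\<And>v. continuous_on S (\<lambda>y. \<alpha> y v)"
  shows "continuous_on S (\<lambda>y. riesz_vector (G y) (\<alpha> y))"
  unfolding continuous_on_def
proof
  fix y0 assume y0: "y0 \<in> S"
  let ?F = "at y0 within S"
  define w where "w y = riesz_vector (G y) (\<alpha> y)" for y
  have w: "G y (w y) v = \<alpha> y v" if "y \<in> S" for y v
    unfolding w_def by (rule riesz_vector[OF G[OF that] \<alpha>[OF that]])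
  obtain m where m: "0 < m" "\<And>v. m * (norm v)\<^sup>2 \<le> G y0 v v" using inner_form_elliptic[OF G[OF y0]] by blast
  define D where "D y = (\<Sum>i\<in>Basis. \<Sum>j\<in>Basis. \<bar>G y i j - G y0 i j\<bar>)" for y
  define E where "E y = (\<Sum>i\<in>Basis. \<bar>\<alpha> y i - G y (w y0) i\<bar>)" for y
  have limG: "((\<lambda>y. G y u v) \<longlongrightarrow> G y0 u v) ?F" for u v using contG y0 by (simp add: continuous_on_def)
  have lim\<alpha>: "((\<lambda>y. \<alpha> y v) \<longlongrightarrow> \<alpha> y0 v) ?F" for v using cont\<alpha> y0 by (simp add: continuous_on_def)
  have "(D \<longlongrightarrow> (\<Sum>i\<in>(Basis::'e set). \<Sum>j\<in>(Basis::'e set). \<bar>G y0 i j - G y0 i j\<bar>)) ?F"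
    unfolding D_def by (intro tendsto_intros limG)
  then have D: "(D \<longlongrightarrow> 0) ?F" by simp
  have "(E \<longlongrightarrow> (\<Sum>i\<in>(Basis::'e set). \<bar>\<alpha> y0 i - G y0 (w y0) i\<bar>)) ?F"
    unfolding E_def by (intro tendsto_intros limG lim\<alpha>)
  then have E: "(E \<longlongrightarrow> 0) ?F" by (simp add: w[OF y0])
  have bound: "norm (w y - w y0) \<le> 2 * E y / m" if y: "y \<in> S" "D y < m / 2" for y
  proof -
    define d where "d = w y - w y0"
    note gy = G[OF y(1)] and g0 = G[OF y0]
    have di: "\<bar>d \<bullet> i\<bar> \<le> norm d" if "i \<in> Basis" for i using Basis_le_norm[OF that] .
    have "G y0 d d - G y d d = (\<Sum>i\<in>Basis. \<Sum>j\<in>Basis. (d \<bullet> i) * (d \<bullet> j) * (G y0 i j - G y i j))"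
      unfolding bilinear_Basis_expansion[OF inner_form_bilinear[OF gy], of d d]
        bilinear_Basis_expansion[OF inner_form_bilinear[OF g0], of d d]
      by (simp add: sum_subtractf right_diff_distrib)
    also have "\<dots> \<le> (\<Sum>i\<in>Basis. \<Sum>j\<in>Basis. norm d * norm d * \<bar>G y i j - G y0 i j\<bar>)"
    proof (intro sum_mono)
      fix i j :: 'e assume ij: "i \<in> Basis" "j \<in> Basis"
      have "(d \<bullet> i) * (d \<bullet> j) * (G y0 i j - G y i j) \<le> \<bar>d \<bullet> i\<bar> * \<bar>d \<bullet> j\<bar> * \<bar>G y i j - G y0 i j\<bar>"
        by (metis abs_ge_self abs_minus_commute abs_mult)
      also have "\<dots> \<le> norm d * norm d * \<bar>G y i j - G y0 i j\<bar>"
        using di ij by (intro mult_mono) auto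
      finally show "(d \<bullet> i) * (d \<bullet> j) * (G y0 i j - G y i j) \<le> norm d * norm d * \<bar>G y i j - G y0 i j\<bar>" .
    qed
    also have "\<dots> = D y * (norm d)\<^sup>2" by (simp add: D_def sum_distrib_left power2_eq_square mult.commute)
    also have "\<dots> \<le> m / 2 * (norm d)\<^sup>2" using y(2) by (intro mult_right_mono) auto
    finally have lower: "m / 2 * (norm d)\<^sup>2 \<le> G y d d" using m(2)[of d] by simp
    have lin: "linear (\<lambda>v. \<alpha> y v - G y (w y0) v)"
      by (intro linear_compose_sub \<alpha>[OF y(1)] linear_inner_form[OF gy])
    have "G y d d = \<alpha> y d - G y (w y0) d"
      using w[OF y(1), of d] unfolding d_def by (simp add: inner_form_simps[OF gy])
    also have "\<dots> = (\<Sum>i\<in>Basis. (d \<bullet> i) * (\<alpha> y i - G y (w y0) i))"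
      by (rule linear_Basis_expansion[OF lin])
    also have "\<dots> \<le> (\<Sum>i\<in>Basis. norm d * \<bar>\<alpha> y i - G y (w y0) i\<bar>)"
    proof (intro sum_mono)
      fix i :: 'e assume i: "i \<in> Basis"
      have "(d \<bullet> i) * (\<alpha> y i - G y (w y0) i) \<le> \<bar>d \<bullet> i\<bar> * \<bar>\<alpha> y i - G y (w y0) i\<bar>"
        by (metis abs_ge_self abs_mult)
      also have "\<dots> \<le> norm d * \<bar>\<alpha> y i - G y (w y0) i\<bar>" using di[OF i] by (intro mult_right_mono) auto
      finally show "(d \<bullet> i) * (\<alpha> y i - G y (w y0) i) \<le> norm d * \<bar>\<alpha> y i - G y (w y0) i\<bar>" .
    qed
    also have "\<dots> = E y * norm d" by (simp add: E_def sum_distrib_left mult.commute)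
    finally have "m / 2 * norm d * norm d \<le> E y * norm d" using lower by (simp add: power2_eq_square mult.assoc)
    then have "m / 2 * norm d \<le> E y"
      by (cases "d = 0") (auto simp: E_def sum_nonneg)
    then show ?thesis using m(1) by (simp add: d_def field_simps)
  qed
  have "((\<lambda>y. w y - w y0) \<longlongrightarrow> 0) ?F"
  proof (rule Lim_null_comparison)
    have "\<forall>\<^sub>F y in ?F. D y < m / 2" using order_tendstoD(2)[OF D, of "m / 2"] m(1) by simp
    moreover have "\<forall>\<^sub>F y in ?F. y \<in> S" by (simp add: eventually_at_filter)
    ultimately show "\<forall>\<^sub>F y in ?F. norm (w y - w y0) \<le> 2 * E y / m"
      by eventually_elim (rule bound)
    show "((\<lambda>y. 2 * E y / m) \<longlongrightarrow> 0) ?F"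
      using tendsto_mult_right_zero[OF E, of "2 / m"] by simp
  qed
  then show "((\<lambda>y. riesz_vector (G y) (\<alpha> y)) \<longlongrightarrow> riesz_vector (G y0) (\<alpha> y0)) ?F"
    unfolding w_def[symmetric] by (rule LIM_zero_cancel)
qed

context
  fixes M :: "('m::t2_space, 'e::euclidean_space) riem_structure"
  assumes RM: "riemannian_manifold M"
begin

lemma riemannian_smooth: "smooth_manifold M"
  using RM by (simp add: riemannian_manifold_def)

lemma in_chart_change:
  assumes "c \<in> atlas M" "c' \<in> atlas M" "x \<in> cdom c" "x \<in> cdom c'"
  shows "change_deriv c c' x (in_chart M c X x) = in_chart M c' X x"
  unfolding in_chart_def using assms
  by (intro change_deriv_cocycle[OF riemannian_smooth] chart_at_atlas[OF riemannian_smooth] chart_at_dom[OF riemannian_smooth])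

lemma in_chart_self: "in_chart M (chart_at M x) X x = X x"
  unfolding in_chart_def by (intro change_deriv_self[OF riemannian_smooth] chart_at_atlas[OF riemannian_smooth] chart_at_dom[OF riemannian_smooth])

lemma in_chart_back:
  assumes "c \<in> atlas M" "x \<in> cdom c"
  shows "change_deriv c (chart_at M x) x (change_deriv (chart_at M x) c x v) = v"
  using change_deriv_cocycle[OF riemannian_smooth, of "chart_at M x" c "chart_at M x" x v]
    change_deriv_self[OF riemannian_smooth, of "chart_at M x" x v] assms chart_at_atlas[OF riemannian_smooth] chart_at_dom[OF riemannian_smooth] by simp

lemma in_chart_forth:
  assumes "c \<in> atlas M" "x \<in> cdom c"
  shows "change_deriv (chart_at M x) c x (change_deriv c (chart_at M x) x v) = v"
  using change_deriv_cocycle[OF riemannian_smooth, of c "chart_at M x" c x v]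
    change_deriv_self[OF riemannian_smooth, of c x v] assms chart_at_atlas[OF riemannian_smooth] chart_at_dom[OF riemannian_smooth] by simp

lemma linear_to_chart: "c \<in> atlas M \<Longrightarrow> x \<in> cdom c \<Longrightarrow> linear (change_deriv (chart_at M x) c x)"
  and linear_from_chart: "c \<in> atlas M \<Longrightarrow> x \<in> cdom c \<Longrightarrow> linear (change_deriv c (chart_at M x) x)"
  by (intro linear_change_deriv[OF riemannian_smooth] chart_at_atlas[OF riemannian_smooth] chart_at_dom[OF riemannian_smooth]; assumption)+

lemma continuous_field_add:
  assumes "continuous_field M X" "continuous_field M Y"
  shows "continuous_field M (\<lambda>x. X x + Y x)"
  unfolding continuous_field_def
proof
  fix c assume c: "c \<in> atlas M"
  have "continuous_on (cdom c) (\<lambda>x. in_chart M c X x + in_chart M c Y x)"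
    using assms c by (intro continuous_intros) (auto simp: continuous_field_def)
  then show "continuous_on (cdom c) (in_chart M c (\<lambda>x. X x + Y x))"
    by (rule continuous_on_eq) (simp add: in_chart_def linear_add[OF linear_to_chart[OF c]])
qed

lemma continuous_field_zero: "continuous_field M (\<lambda>x. 0)"
  unfolding continuous_field_def
proof
  fix c assume c: "c \<in> atlas M"
  show "continuous_on (cdom c) (in_chart M c (\<lambda>x. 0))"
    by (rule continuous_on_eq[OF continuous_on_const[of _ 0]])
      (simp add: in_chart_def linear_0[OF linear_to_chart[OF c]])
qed

lemma continuous_field_scaleR:
  assumes "continuous_on UNIV h" "continuous_field M X"
  shows "continuous_field M (\<lambda>x. h x *\<^sub>R X x)"
  unfolding continuous_field_def
proof
  fix c assume c: "c \<in> atlas M"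
  have "continuous_on (cdom c) (\<lambda>x. h x *\<^sub>R in_chart M c X x)"
    using assms c by (intro continuous_intros continuous_on_subset[OF assms(1)]) (auto simp: continuous_field_def)
  then show "continuous_on (cdom c) (in_chart M c (\<lambda>x. h x *\<^sub>R X x))"
    by (rule continuous_on_eq) (simp add: in_chart_def linear_cmul[OF linear_to_chart[OF c]])
qed

lemma continuous_field_sum:
  assumes "finite I" "\<And>i. i \<in> I \<Longrightarrow> continuous_field M (X i)"
  shows "continuous_field M (\<lambda>x. \<Sum>i\<in>I. X i x)"
  using assms by (induction rule: finite_induct) (auto intro: continuous_field_add continuous_field_zero)

lemma c1_vector_field_continuous:
  assumes "c1_vector_field M X"
  shows "continuous_field M X"
  unfolding continuous_field_def
proof
  fix c assume c: "c \<in> atlas M"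
  let ?F = "\<lambda>y. let x = cinv c y in change_deriv (chart_at M x) c x (X x)"
  have "ck_on (Suc 0) (cmap c ` cdom c) ?F" using assms c by (simp add: c1_vector_field_def)
  then have "\<forall>y\<in>cmap c ` cdom c. ?F differentiable (at y)" by simp
  then have "continuous_on (cmap c ` cdom c) ?F"
    by (meson continuous_at_imp_continuous_on differentiable_imp_continuous_within)
  then have "continuous_on (cdom c) (\<lambda>x. ?F (cmap c x))"
    using continuous_on_cmap[OF riemannian_smooth c] by (rule continuous_on_compose2) auto
  then show "continuous_on (cdom c) (in_chart M c X)"
    by (rule continuous_on_eq) (simp add: in_chart_def cinv_cmap[OF riemannian_smooth c] Let_def)
qed

lemma metric_in_chart_apply:
  assumes "c \<in> atlas M" "x \<in> cdom c"
  shows "metric_in_chart M c (change_deriv (chart_at M x) c x u) (change_deriv (chart_at M x) c x v) (cmap c x)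
    = riem_metric M x u v"
  using assms by (simp add: metric_in_chart_def Let_def cinv_cmap[OF riemannian_smooth] in_chart_back)

lemma inner_form_metric_in_chart:
  assumes c: "c \<in> atlas M" "x \<in> cdom c"
  shows "inner_form (\<lambda>u v. metric_in_chart M c u v (cmap c x))"
proof -
  let ?T = "change_deriv c (chart_at M x) x"
  note g = inner_form_riem_metric[OF RM, of x]
  have eq: "metric_in_chart M c u v (cmap c x) = riem_metric M x (?T u) (?T v)" for u v
    using c by (simp add: metric_in_chart_def Let_def cinv_cmap[OF riemannian_smooth])
  have T: "linear ?T" by (rule linear_from_chart[OF c])
  have "?T v \<noteq> 0" if "v \<noteq> 0" for v
    using in_chart_forth[OF c, of v] linear_0[OF linear_to_chart[OF c]] that by metis
  then show ?thesis
    unfolding inner_form_def eq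
    using inner_form_pos[OF g] inner_form_sym[OF g]
    by (auto simp: bilinear_def inner_form_simps[OF g] linear_add[OF T] linear_cmul[OF T] intro!: linearI)
qed

lemma continuous_on_metric_in_chart:
  assumes "c \<in> atlas M"
  shows "continuous_on (cdom c) (\<lambda>x. metric_in_chart M c u v (cmap c x))"
proof -
  have "ck_on 0 (cmap c ` cdom c) (metric_in_chart M c u v)"
    using RM assms unfolding riemannian_manifold_def smooth_on_def by blast
  then have "continuous_on (cmap c ` cdom c) (metric_in_chart M c u v)" by simp
  then show ?thesis by (rule continuous_on_compose2[OF _ continuous_on_cmap[OF riemannian_smooth assms]]) auto
qed

lemma continuous_on_riem_metric:
  assumes "continuous_field M X" "continuous_field M Y"
  shows "continuous_on UNIV (\<lambda>x. riem_metric M x (X x) (Y x))"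
proof (rule continuous_on_UNIV_charts[OF riemannian_smooth])
  fix c assume c: "c \<in> atlas M"
  have XY: "continuous_on (cdom c) (in_chart M c X)" "continuous_on (cdom c) (in_chart M c Y)"
    using assms c by (auto simp: continuous_field_def)
  have "continuous_on (cdom c) (\<lambda>x. \<Sum>i\<in>Basis. \<Sum>j\<in>Basis.
      (in_chart M c X x \<bullet> i) * (in_chart M c Y x \<bullet> j) * metric_in_chart M c i j (cmap c x))"
    by (intro continuous_intros XY continuous_on_metric_in_chart[OF c])
  then show "continuous_on (cdom c) (\<lambda>x. riem_metric M x (X x) (Y x))"
  proof (rule continuous_on_eq)
    fix x assume x: "x \<in> cdom c"
    have "riem_metric M x (X x) (Y x) = metric_in_chart M c (in_chart M c X x) (in_chart M c Y x) (cmap c x)"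
      unfolding in_chart_def by (rule metric_in_chart_apply[OF c x, symmetric])
    also have "\<dots> = (\<Sum>i\<in>Basis. \<Sum>j\<in>Basis.
      (in_chart M c X x \<bullet> i) * (in_chart M c Y x \<bullet> j) * metric_in_chart M c i j (cmap c x))"
      by (rule bilinear_Basis_expansion[OF inner_form_bilinear[OF inner_form_metric_in_chart[OF c x]]])
    finally show "(\<Sum>i\<in>Basis. \<Sum>j\<in>Basis.
      (in_chart M c X x \<bullet> i) * (in_chart M c Y x \<bullet> j) * metric_in_chart M c i j (cmap c x))
      = riem_metric M x (X x) (Y x)" ..
  qed
qed

lemma c1_function_has_derivative:
  assumes "c1_function M f" "c \<in> atlas M" "x \<in> cdom c"
  shows "((f \<circ> cinv c) has_derivative frechet_derivative (f \<circ> cinv c) (at (cmap c x))) (at (cmap c x))"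
proof -
  have "ck_on (Suc 0) (cmap c ` cdom c) (f \<circ> cinv c)" using assms by (simp add: c1_function_def)
  then have "(f \<circ> cinv c) differentiable (at (cmap c x))" using assms(3) by simp
  then show ?thesis using frechet_derivative_works by blast
qed

lemma continuous_on_chart_derivative:
  assumes "c1_function M f" "c \<in> atlas M"
  shows "continuous_on (cdom c) (\<lambda>x. frechet_derivative (f \<circ> cinv c) (at (cmap c x)) v)"
proof -
  have "ck_on (Suc 0) (cmap c ` cdom c) (f \<circ> cinv c)" using assms by (simp add: c1_function_def)
  then have "continuous_on (cmap c ` cdom c) (\<lambda>y. frechet_derivative (f \<circ> cinv c) (at y) v)" by simp
  then show ?thesis by (rule continuous_on_compose2[OF _ continuous_on_cmap[OF riemannian_smooth assms(2)]]) auto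
qed

text \<open>Chain rule for the change of coordinates from the chart selected at \<open>x\<close> to \<open>c\<close>.\<close>

lemma differential_in_chart:
  assumes f: "c1_function M f" and c: "c \<in> atlas M" "x \<in> cdom c"
  shows "blinfun_apply (differential M f x) v
    = frechet_derivative (f \<circ> cinv c) (at (cmap c x)) (change_deriv (chart_at M x) c x v)"
proof -
  let ?c0 = "chart_at M x"
  note c0 = chart_at_atlas[OF riemannian_smooth, of x] chart_at_dom[OF riemannian_smooth, of x]
  have eq: "(cmap c \<circ> cinv ?c0) (cmap ?c0 x) = cmap c x" using c0 by (simp add: cinv_cmap[OF riemannian_smooth])
  have "((f \<circ> cinv c) \<circ> (cmap c \<circ> cinv ?c0) has_derivative
      frechet_derivative (f \<circ> cinv c) (at (cmap c x)) \<circ> change_deriv ?c0 c x) (at (cmap ?c0 x))"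
    by (rule diff_chain_at, unfold eq)
       (rule change_has_derivative[OF riemannian_smooth c0(1) c(1) c0(2) c(2)] c1_function_has_derivative[OF f c])+
  then have "(f \<circ> cinv ?c0 has_derivative
      frechet_derivative (f \<circ> cinv c) (at (cmap c x)) \<circ> change_deriv ?c0 c x) (at (cmap ?c0 x))"
    by (rule has_derivative_transform_within_open[OF _ open_chart_overlap[OF riemannian_smooth c0(1) c(1)]])
       (use c c0 in \<open>auto simp: cinv_cmap[OF riemannian_smooth]\<close>)
  from has_derivative_unique[OF this c1_function_has_derivative[OF f c0]]
  have "frechet_derivative (f \<circ> cinv ?c0) (at (cmap ?c0 x)) v
      = frechet_derivative (f \<circ> cinv c) (at (cmap c x)) (change_deriv ?c0 c x v)" by (metis comp_apply)
  moreover have "bounded_linear (frechet_derivative (f \<circ> cinv ?c0) (at (cmap ?c0 x)))"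
    using c1_function_has_derivative[OF f c0] by (rule has_derivative_bounded_linear)
  ultimately show ?thesis by (simp add: differential_def Let_def bounded_linear_Blinfun_apply)
qed

lemma continuous_on_differential:
  assumes f: "c1_function M f" and X: "continuous_field M X"
  shows "continuous_on UNIV (\<lambda>x. blinfun_apply (differential M f x) (X x))"
proof (rule continuous_on_UNIV_charts[OF riemannian_smooth])
  fix c assume c: "c \<in> atlas M"
  have XY: "continuous_on (cdom c) (in_chart M c X)" using X c by (auto simp: continuous_field_def)
  have "continuous_on (cdom c) (\<lambda>x. \<Sum>i\<in>Basis.
      (in_chart M c X x \<bullet> i) * frechet_derivative (f \<circ> cinv c) (at (cmap c x)) i)"
    by (intro continuous_intros XY continuous_on_chart_derivative[OF f c])
  then show "continuous_on (cdom c) (\<lambda>x. blinfun_apply (differential M f x) (X x))"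
  proof (rule continuous_on_eq)
    fix x assume x: "x \<in> cdom c"
    have "linear (frechet_derivative (f \<circ> cinv c) (at (cmap c x)))"
      using c1_function_has_derivative[OF f c x] by (rule has_derivative_linear)
    from linear_Basis_expansion[OF this, of "in_chart M c X x"]
    show "(\<Sum>i\<in>Basis. (in_chart M c X x \<bullet> i) * frechet_derivative (f \<circ> cinv c) (at (cmap c x)) i)
      = blinfun_apply (differential M f x) (X x)"
      unfolding differential_in_chart[OF f c x] in_chart_def by simp
  qed
qed

definition gradient :: "('m \<Rightarrow> real) \<Rightarrow> 'm \<Rightarrow> 'e" where
  "gradient f x = riesz_vector (riem_metric M x) (blinfun_apply (differential M f x))"

text \<open>In a chart the gradient is the Riesz vector of the coordinate derivative of \<open>f\<close> for the coordinate
  expression of the metric, and both are continuous.\<close>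

lemma continuous_field_gradient:
  assumes f: "c1_function M f"
  shows "continuous_field M (gradient f)"
  unfolding continuous_field_def
proof
  fix c assume c: "c \<in> atlas M"
  let ?D = "\<lambda>x. frechet_derivative (f \<circ> cinv c) (at (cmap c x))"
  let ?G = "\<lambda>x u v. metric_in_chart M c u v (cmap c x)"
  have lin: "linear (?D x)" if "x \<in> cdom c" for x
    using c1_function_has_derivative[OF f c that] by (rule has_derivative_linear)
  have "continuous_on (cdom c) (\<lambda>x. riesz_vector (?G x) (?D x))"
    by (rule continuous_on_riesz_vector)
       (use inner_form_metric_in_chart[OF c] lin continuous_on_metric_in_chart[OF c]
         continuous_on_chart_derivative[OF f c] in auto)
  then show "continuous_on (cdom c) (in_chart M c (gradient f))"
  proof (rule continuous_on_eq)
    fix x assume x: "x \<in> cdom c"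
    let ?T = "change_deriv c (chart_at M x) x"
    have "?G x (in_chart M c (gradient f) x) v = ?D x v" for v
    proof -
      have "?G x (in_chart M c (gradient f) x) v = ?G x (in_chart M c (gradient f) x) (change_deriv (chart_at M x) c x (?T v))"
        by (simp add: in_chart_forth[OF c x])
      also have "\<dots> = riem_metric M x (gradient f x) (?T v)"
        unfolding in_chart_def by (rule metric_in_chart_apply[OF c x])
      also have "\<dots> = blinfun_apply (differential M f x) (?T v)"
        unfolding gradient_def using riesz_vector[OF inner_form_riem_metric[OF RM]]
        by (simp add: blinfun.bounded_linear_right bounded_linear.linear)
      also have "\<dots> = ?D x v" unfolding differential_in_chart[OF f c x] by (simp add: in_chart_forth[OF c x])
      finally show ?thesis .
    qed
    then show "riesz_vector (?G x) (?D x) = in_chart M c (gradient f) x"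
      by (rule riesz_vector_unique[OF inner_form_metric_in_chart[OF c x] lin[OF x]])
  qed
qed

end

section \<open>Integral curves\<close>

definition integral_curve_on ::
    "('m::metric_space, 'e::euclidean_space) riem_structure \<Rightarrow> ('m \<Rightarrow> 'e) \<Rightarrow> real set \<Rightarrow> (real \<Rightarrow> 'm) \<Rightarrow> bool" where
  "integral_curve_on M X I \<gamma> \<longleftrightarrow> continuous_on I \<gamma> \<and>
     (\<forall>c\<in>atlas M. \<forall>t\<in>I. \<gamma> t \<in> cdom c \<longrightarrow>
        ((cmap c \<circ> \<gamma>) has_vector_derivative in_chart M c X (\<gamma> t)) (at t within I))"

lemma integral_curve_on_subset:
  assumes "integral_curve_on M X I \<gamma>" "J \<subseteq> I"
  shows "integral_curve_on M X J \<gamma>"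
  unfolding integral_curve_on_def
proof (intro conjI ballI impI)
  show "continuous_on J \<gamma>"
    using assms continuous_on_subset by (auto simp: integral_curve_on_def)
  fix c t assume "c \<in> atlas M" "t \<in> J" "\<gamma> t \<in> cdom c"
  then have "((cmap c \<circ> \<gamma>) has_vector_derivative in_chart M c X (\<gamma> t)) (at t within I)"
    using assms by (simp add: integral_curve_on_def subset_iff)
  then show "((cmap c \<circ> \<gamma>) has_vector_derivative in_chart M c X (\<gamma> t)) (at t within J)"
    by (rule has_vector_derivative_within_subset[OF _ assms(2)])
qed

lemma integral_curve_on_cong:
  assumes \<gamma>: "integral_curve_on M X I \<gamma>" and eq: "\<And>t. t \<in> I \<Longrightarrow> \<gamma> t = \<delta> t"
  shows "integral_curve_on M X I \<delta>"
  unfolding integral_curve_on_def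
proof (intro conjI ballI impI)
  show "continuous_on I \<delta>"
    using \<gamma> continuous_on_eq[OF _ eq] by (auto simp: integral_curve_on_def)
  fix c t assume "c \<in> atlas M" "t \<in> I" "\<delta> t \<in> cdom c"
  then have "((cmap c \<circ> \<gamma>) has_vector_derivative in_chart M c X (\<gamma> t)) (at t within I)"
    using \<gamma> eq by (simp add: integral_curve_on_def)
  then show "((cmap c \<circ> \<delta>) has_vector_derivative in_chart M c X (\<delta> t)) (at t within I)"
    using has_vector_derivative_transform[OF \<open>t \<in> I\<close>, of "cmap c \<circ> \<delta>" "cmap c \<circ> \<gamma>"] eq \<open>t \<in> I\<close> by simp
qed

lemma continuous_curve_locally_in:
  fixes \<gamma> :: "real \<Rightarrow> 'm::metric_space"
  assumes "continuous_on I \<gamma>" "t \<in> I" "open U" "\<gamma> t \<in> U"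
  obtains d where "0 < d" "\<And>s. s \<in> I \<Longrightarrow> dist s t < d \<Longrightarrow> \<gamma> s \<in> U"
proof -
  obtain e where e: "0 < e" "ball (\<gamma> t) e \<subseteq> U" using assms(3,4) open_contains_ball by blast
  then obtain d where "0 < d" "\<And>s. s \<in> I \<Longrightarrow> dist s t < d \<Longrightarrow> dist (\<gamma> s) (\<gamma> t) < e"
    using assms(1,2) unfolding continuous_on_iff by blast
  then show ?thesis using e by (intro that[of d]) (auto simp: dist_commute mem_ball)
qed

context
  fixes M :: "('m::metric_space, 'e::euclidean_space) riem_structure"
  assumes RM: "riemannian_manifold M"
begin

lemmas smooth = riemannian_smooth[OF RM]

text \<open>Components of vectors and derivatives of curves obey the same rule under a change of chart, so one
  chart around every point decides.\<close>

lemma integral_curve_onI: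
  assumes cont: "continuous_on I \<gamma>"
    and deriv: "\<And>t. t \<in> I \<Longrightarrow> \<exists>c\<in>atlas M. \<gamma> t \<in> cdom c \<and>
        ((cmap c \<circ> \<gamma>) has_vector_derivative in_chart M c X (\<gamma> t)) (at t within I)"
  shows "integral_curve_on M X I \<gamma>"
  unfolding integral_curve_on_def
proof (intro conjI cont ballI impI)
  fix c' t assume c': "c' \<in> atlas M" and t: "t \<in> I" and t': "\<gamma> t \<in> cdom c'"
  obtain c where c: "c \<in> atlas M" "\<gamma> t \<in> cdom c"
    and D: "((cmap c \<circ> \<gamma>) has_vector_derivative in_chart M c X (\<gamma> t)) (at t within I)" using deriv[OF t] by blast
  let ?v = "in_chart M c X (\<gamma> t)"
  let ?T = "change_deriv c c' (\<gamma> t)"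
  have "((cmap c' \<circ> cinv c) has_derivative ?T) (at ((cmap c \<circ> \<gamma>) t))"
    using change_has_derivative[OF smooth c(1) c' c(2) t'] by simp
  then have "((cmap c' \<circ> cinv c) \<circ> (cmap c \<circ> \<gamma>) has_derivative ?T \<circ> (\<lambda>h. h *\<^sub>R ?v)) (at t within I)"
    by (rule diff_chain_within[OF D[unfolded has_vector_derivative_def] has_derivative_at_withinI])
  moreover have "?T \<circ> (\<lambda>h. h *\<^sub>R ?v) = (\<lambda>h. h *\<^sub>R in_chart M c' X (\<gamma> t))"
    by (simp add: fun_eq_iff linear_cmul[OF linear_change_deriv[OF smooth c(1) c' c(2) t']]
        in_chart_change[OF RM c(1) c' c(2) t'])
  ultimately have chain: "((cmap c' \<circ> cinv c) \<circ> (cmap c \<circ> \<gamma>) has_vector_derivative in_chart M c' X (\<gamma> t)) (at t within I)"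
    by (simp add: has_vector_derivative_def)
  obtain d where d: "0 < d" "\<And>s. s \<in> I \<Longrightarrow> dist s t < d \<Longrightarrow> \<gamma> s \<in> cdom c"
    using continuous_curve_locally_in[OF cont t open_cdom[OF smooth c(1)] c(2)] by blast
  show "((cmap c' \<circ> \<gamma>) has_vector_derivative in_chart M c' X (\<gamma> t)) (at t within I)"
    by (rule has_vector_derivative_transform_within[OF chain d(1) t])
       (use d(2) cinv_cmap[OF smooth c(1)] in auto)
qed

lemma integral_curve_local_existence:
  assumes X: "continuous_field M X"
  obtains e \<gamma> where "0 < e" "\<gamma> 0 = y" "integral_curve_on M X {0..e} \<gamma>"
proof -
  let ?c = "chart_at M y"
  note c = chart_at_atlas[OF smooth, of y] chart_at_dom[OF smooth, of y]
  let ?U = "cmap ?c ` cdom ?c"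
  let ?F = "\<lambda>z. in_chart M ?c X (cinv ?c z)"
  have "continuous_on ?U ?F"
    by (rule continuous_on_compose2[OF _ continuous_on_cinv[OF smooth c(1)], of "cdom ?c"])
       (use X c cinv_cmap[OF smooth c(1)] in \<open>auto simp: continuous_field_def\<close>)
  moreover have "cmap ?c y \<in> ?U" using c by blast
  ultimately obtain e x where e: "0 < e" and x0: "x 0 = cmap ?c y" and xU: "\<And>t. t \<in> {0..e} \<Longrightarrow> x t \<in> ?U"
    and xd: "\<And>t. t \<in> {0..e} \<Longrightarrow> (x has_vector_derivative ?F (x t)) (at t within {0..e::real})"
    using peano_existence[OF open_chart_image[OF smooth c(1)]] by blast
  define \<gamma> where "\<gamma> = cinv ?c \<circ> x"
  have contx: "continuous_on {0..e} x"
    using has_vector_derivative_continuous[OF xd] by (simp add: continuous_on_eq_continuous_within)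
  have cont: "continuous_on {0..e} \<gamma>" unfolding \<gamma>_def
    by (rule continuous_on_compose[OF contx continuous_on_subset[OF continuous_on_cinv[OF smooth c(1)]]]) (use xU in auto)
  have "integral_curve_on M X {0..e} \<gamma>"
  proof (rule integral_curve_onI[OF cont], intro bexI[OF _ c(1)] conjI)
    fix t assume t: "t \<in> {0..e}"
    show "\<gamma> t \<in> cdom ?c" using cinv_in_cdom[OF smooth c(1) xU[OF t]] by (simp add: \<gamma>_def)
    show "((cmap ?c \<circ> \<gamma>) has_vector_derivative in_chart M ?c X (\<gamma> t)) (at t within {0..e})"
      by (rule has_vector_derivative_transform[OF t, of _ x])
         (use xd[OF t] xU cmap_cinv[OF smooth c(1)] in \<open>auto simp: \<gamma>_def\<close>)
  qed
  moreover have "\<gamma> 0 = y" using c by (simp add: \<gamma>_def x0 cinv_cmap[OF smooth])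
  ultimately show thesis using that e by blast
qed

lemma integral_curve_shift:
  assumes "integral_curve_on M X {0..e} \<gamma>"
  shows "integral_curve_on M X {a..a + e} (\<lambda>t. \<gamma> (t - a))"
  unfolding integral_curve_on_def
proof (intro conjI ballI impI)
  have img: "(\<lambda>t. t - a) ` {a..a + e} = {0..e}" by (simp add: image_minus_const_atLeastAtMost')
  show "continuous_on {a..a + e} (\<lambda>t. \<gamma> (t - a))"
  proof (rule continuous_on_compose2[of "{0..e}" \<gamma>])
    show "continuous_on {0..e} \<gamma>" using assms by (simp add: integral_curve_on_def)
    show "continuous_on {a..a + e} (\<lambda>t. t - a)" by (intro continuous_intros)
    show "(\<lambda>t. t - a) ` {a..a + e} \<subseteq> {0..e}" unfolding img by simp
  qed
  fix c t assume c: "c \<in> atlas M" and t: "t \<in> {a..a + e}" and dom: "\<gamma> (t - a) \<in> cdom c"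
  have "((\<lambda>t. t - a) has_vector_derivative 1) (at t within {a..a + e})"
    by (auto intro!: derivative_eq_intros)
  moreover have "((cmap c \<circ> \<gamma>) has_vector_derivative in_chart M c X (\<gamma> (t - a))) (at (t - a) within (\<lambda>t. t - a) ` {a..a + e})"
    using assms c t dom unfolding img integral_curve_on_def by auto
  ultimately have "((cmap c \<circ> \<gamma>) \<circ> (\<lambda>t. t - a) has_vector_derivative 1 *\<^sub>R in_chart M c X (\<gamma> (t - a))) (at t within {a..a + e})"
    by (rule vector_diff_chain_within)
  then show "(cmap c \<circ> (\<lambda>t. \<gamma> (t - a)) has_vector_derivative in_chart M c X (\<gamma> (t - a))) (at t within {a..a + e})"
    by (simp add: o_def)
qed

lemma integral_curve_concat:
  assumes \<gamma>: "integral_curve_on M X {a..b} \<gamma>" and \<delta>: "integral_curve_on M X {b..d} \<delta>"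
    and "\<gamma> b = \<delta> b" "a \<le> b" "b \<le> d"
  shows "integral_curve_on M X {a..d} (\<lambda>t. if t \<in> {a..b} then \<gamma> t else \<delta> t)"
  unfolding integral_curve_on_def
proof (intro conjI ballI impI)
  have un: "{a..d} = {a..b} \<union> {b..d}" using assms by auto
  have cl: "{a..b} \<union> (closure {a..b} \<inter> closure {b..d}) = {a..b}"
    "{b..d} \<union> (closure {a..b} \<inter> closure {b..d}) = {b..d}" using assms by auto
  have "continuous_on ({a..b} \<union> {b..d}) (\<lambda>t. if t \<in> {a..b} then \<gamma> t else \<delta> t)"
  proof (rule continuous_on_cases)
    show "continuous_on {a..b} \<gamma>" "continuous_on {b..d} \<delta>"
      using \<gamma> \<delta> by (simp_all add: integral_curve_on_def)
    show "\<forall>t. t \<in> {a..b} \<and> t \<notin> {a..b} \<or> t \<in> {b..d} \<and> t \<in> {a..b} \<longrightarrow> \<gamma> t = \<delta> t"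
    proof (intro allI impI)
      fix t assume "t \<in> {a..b} \<and> t \<notin> {a..b} \<or> t \<in> {b..d} \<and> t \<in> {a..b}"
      then have "t = b" by auto
      then show "\<gamma> t = \<delta> t" using assms(3) by simp
    qed
  qed auto
  then show "continuous_on {a..d} (\<lambda>t. if t \<in> {a..b} then \<gamma> t else \<delta> t)" unfolding un .
  fix c t assume c: "c \<in> atlas M" and t: "t \<in> {a..d}" and dom: "(if t \<in> {a..b} then \<gamma> t else \<delta> t) \<in> cdom c"
  have "((\<lambda>t. if t \<in> {a..b} then (cmap c \<circ> \<gamma>) t else (cmap c \<circ> \<delta>) t) has_vector_derivative
      (if t \<in> {a..b} then in_chart M c X (\<gamma> t) else in_chart M c X (\<delta> t))) (at t within {a..d})"
  proof (rule has_vector_derivative_If_within_closures[OF _ un]; (unfold cl)?)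
    show "t \<in> {a..b} \<union> {b..d}" using t un by blast
    show "((cmap c \<circ> \<gamma>) has_vector_derivative in_chart M c X (\<gamma> t)) (at t within {a..b})" if "t \<in> {a..b}"
      using \<gamma> c dom that by (simp add: integral_curve_on_def)
    show "((cmap c \<circ> \<delta>) has_vector_derivative in_chart M c X (\<delta> t)) (at t within {b..d})" if "t \<in> {b..d}"
    proof -
      have "\<delta> t \<in> cdom c"
        using dom that assms(3,4) by (cases "t = b") auto
      then show ?thesis using \<delta> c that by (simp add: integral_curve_on_def)
    qed
    have "t = b" if "t \<in> closure {a..b}" "t \<in> closure {b..d}" using that by auto
    then show "(cmap c \<circ> \<gamma>) t = (cmap c \<circ> \<delta>) t" "in_chart M c X (\<gamma> t) = in_chart M c X (\<delta> t)"
      if "t \<in> closure {a..b}" "t \<in> closure {b..d}" using that assms(3) by auto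
  qed
  moreover have "(\<lambda>t. if t \<in> {a..b} then (cmap c \<circ> \<gamma>) t else (cmap c \<circ> \<delta>) t) = cmap c \<circ> (\<lambda>t. if t \<in> {a..b} then \<gamma> t else \<delta> t)"
    by auto
  ultimately show "(cmap c \<circ> (\<lambda>t. if t \<in> {a..b} then \<gamma> t else \<delta> t) has_vector_derivative
      in_chart M c X (if t \<in> {a..b} then \<gamma> t else \<delta> t)) (at t within {a..d})"
    by (cases "t \<in> {a..b}") (simp_all only: if_True if_False)
qed

text \<open>At \<open>T\<close> only continuity is known. In a chart the curve is the integral of its continuous velocity up
  to \<open>T\<close>, which yields the one-sided derivative there.\<close>

lemma integral_curve_closed_endpoint:
  assumes X: "continuous_field M X" and "0 < T" and cont: "continuous_on {0..T} \<gamma>"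
    and \<gamma>: "\<And>S. 0 \<le> S \<Longrightarrow> S < T \<Longrightarrow> integral_curve_on M X {0..S} \<gamma>"
  shows "integral_curve_on M X {0..T} \<gamma>"
proof (rule integral_curve_onI[OF cont])
  fix t assume t: "t \<in> {0..T}"
  let ?c = "chart_at M (\<gamma> t)"
  note c = chart_at_atlas[OF smooth, of "\<gamma> t"] chart_at_dom[OF smooth, of "\<gamma> t"]
  have "((cmap ?c \<circ> \<gamma>) has_vector_derivative in_chart M ?c X (\<gamma> t)) (at t within {0..T})"
  proof (cases "t < T")
    case True
    then obtain S where S: "t < S" "S < T" using dense by blast
    have "((cmap ?c \<circ> \<gamma>) has_vector_derivative in_chart M ?c X (\<gamma> t)) (at t within {0..S})"
      using \<gamma>[of S] S t c unfolding integral_curve_on_def by auto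
    moreover have "at t within {0..S} = at t within {0..T}"
      by (rule at_within_nhd[of _ "{..<S}"]) (use S in auto)
    ultimately show ?thesis by simp
  next
    case False
    with t have tT: "t = T" by simp
    obtain d where d: "0 < d" "\<And>s. s \<in> {0..T} \<Longrightarrow> dist s T < d \<Longrightarrow> \<gamma> s \<in> cdom ?c"
      using continuous_curve_locally_in[OF cont t open_cdom[OF smooth c(1)] c(2)] unfolding tT by blast
    define s where "s = max 0 (T - d / 2)"
    have s: "0 \<le> s" "s < T" using \<open>0 < T\<close> d(1) by (auto simp: s_def)
    have dom: "\<gamma> u \<in> cdom ?c" if "u \<in> {s..T}" for u
      using that d(1) \<open>0 < T\<close> by (intro d(2)) (auto simp: s_def dist_real_def)
    have cont': "continuous_on {s..T} \<gamma>" using cont s by (rule_tac continuous_on_subset) auto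
    let ?k = "\<lambda>u. in_chart M ?c X (\<gamma> u)"
    have "continuous_on (cdom ?c) (in_chart M ?c X)" using X c(1) by (simp add: continuous_field_def)
    then have contk: "continuous_on {s..T} ?k"
      by (rule continuous_on_compose2[OF _ cont']) (use dom in auto)
    have conth: "continuous_on {s..T} (cmap ?c \<circ> \<gamma>)"
      by (rule continuous_on_compose[OF cont' continuous_on_subset[OF continuous_on_cmap[OF smooth c(1)]]]) (use dom in auto)
    have interior: "((cmap ?c \<circ> \<gamma>) has_vector_derivative ?k u) (at u)" if u: "u \<in> {s<..<T}" for u
    proof -
      obtain S where S: "u < S" "S < T" using u dense[of u T] by auto
      have "((cmap ?c \<circ> \<gamma>) has_vector_derivative ?k u) (at u within {0..S})"
        using \<gamma>[of S] S u s c dom[of u] unfolding integral_curve_on_def by auto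
      moreover have "at u within {0..S} = at u"
        using S u s by (intro at_within_Icc_at) auto
      ultimately show ?thesis by simp
    qed
    have integral_eq: "(cmap ?c \<circ> \<gamma>) u = (cmap ?c \<circ> \<gamma>) s + integral {s..u} ?k" if u: "u \<in> {s..T}" for u
    proof -
      have "(?k has_integral (cmap ?c \<circ> \<gamma>) u - (cmap ?c \<circ> \<gamma>) s) {s..u}"
      proof (rule fundamental_theorem_of_calculus_interior)
        show "continuous_on {s..u} (cmap ?c \<circ> \<gamma>)" by (rule continuous_on_subset[OF conth]) (use u in auto)
        show "((cmap ?c \<circ> \<gamma>) has_vector_derivative ?k r) (at r)" if "r \<in> {s<..<u}" for r
          by (rule interior) (use that u in auto)
      qed (use u in auto)
      from integral_unique[OF this] show ?thesis by simp
    qed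
    have Tin: "T \<in> {s..T}" using s by simp
    have "((cmap ?c \<circ> \<gamma>) has_vector_derivative ?k T) (at T within {s..T})"
    proof (rule has_vector_derivative_transform[OF Tin integral_eq])
      show "((\<lambda>u. (cmap ?c \<circ> \<gamma>) s + integral {s..u} ?k) has_vector_derivative ?k T) (at T within {s..T})"
        using has_vector_derivative_add[OF has_vector_derivative_const integral_has_vector_derivative[OF contk Tin]] by simp
    qed
    moreover have "at T within {s..T} = at T within {0..T}"
      by (rule at_within_nhd[of _ "{s<..}"]) (use s in auto)
    ultimately show ?thesis using tT by simp
  qed
  then show "\<exists>c\<in>atlas M. \<gamma> t \<in> cdom c \<and>
      ((cmap c \<circ> \<gamma>) has_vector_derivative in_chart M c X (\<gamma> t)) (at t within {0..T})"
    using c by blast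
qed

lemma derivative_along_integral_curve:
  assumes f: "c1_function M f" and \<gamma>: "integral_curve_on M X I \<gamma>" and t: "t \<in> I"
  shows "((\<lambda>t. f (\<gamma> t)) has_real_derivative blinfun_apply (differential M f (\<gamma> t)) (X (\<gamma> t))) (at t within I)"
proof -
  let ?c = "chart_at M (\<gamma> t)"
  note c = chart_at_atlas[OF smooth, of "\<gamma> t"] chart_at_dom[OF smooth, of "\<gamma> t"]
  let ?v = "in_chart M ?c X (\<gamma> t)"
  let ?D = "frechet_derivative (f \<circ> cinv ?c) (at (cmap ?c (\<gamma> t)))"
  have cont: "continuous_on I \<gamma>" using \<gamma> by (simp add: integral_curve_on_def)
  have D: "((cmap ?c \<circ> \<gamma>) has_derivative (\<lambda>h. h *\<^sub>R ?v)) (at t within I)"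
    using \<gamma> t c unfolding integral_curve_on_def has_vector_derivative_def by blast
  have fD: "((f \<circ> cinv ?c) has_derivative ?D) (at ((cmap ?c \<circ> \<gamma>) t))"
    using c1_function_has_derivative[OF RM f c] by simp
  then have "((f \<circ> cinv ?c) \<circ> (cmap ?c \<circ> \<gamma>) has_derivative ?D \<circ> (\<lambda>h. h *\<^sub>R ?v)) (at t within I)"
    by (rule diff_chain_within[OF D has_derivative_at_withinI])
  moreover have "?D \<circ> (\<lambda>h. h *\<^sub>R ?v) = (*) (blinfun_apply (differential M f (\<gamma> t)) (X (\<gamma> t)))"
    using linear_cmul[OF has_derivative_linear[OF fD]]
    by (auto simp: fun_eq_iff differential_in_chart[OF RM f c] in_chart_def)
  ultimately have chain: "((f \<circ> cinv ?c) \<circ> (cmap ?c \<circ> \<gamma>) has_derivative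
      (*) (blinfun_apply (differential M f (\<gamma> t)) (X (\<gamma> t)))) (at t within I)" by simp
  obtain d where d: "0 < d" "\<And>s. s \<in> I \<Longrightarrow> dist s t < d \<Longrightarrow> \<gamma> s \<in> cdom ?c"
    using continuous_curve_locally_in[OF cont t open_cdom[OF smooth c(1)] c(2)] by blast
  show ?thesis unfolding has_field_derivative_def
    by (rule has_derivative_transform_within[OF chain d(1) t])
       (use d(2) cinv_cmap[OF smooth c(1)] in auto)
qed

lemma velocity_integral_curve:
  assumes "integral_curve_on M X {a..b} \<gamma>" "t \<in> {a<..<b}"
  shows "velocity M \<gamma> t = X (\<gamma> t)"
proof -
  have "((cmap (chart_at M (\<gamma> t)) \<circ> \<gamma>) has_vector_derivative in_chart M (chart_at M (\<gamma> t)) X (\<gamma> t)) (at t within {a..b})"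
    using assms chart_at_atlas[OF smooth] chart_at_dom[OF smooth] unfolding integral_curve_on_def by auto
  then have "((cmap (chart_at M (\<gamma> t)) \<circ> \<gamma>) has_vector_derivative X (\<gamma> t)) (at t)"
    using assms(2) by (simp add: in_chart_self[OF RM] at_within_Icc_at)
  then show ?thesis unfolding velocity_def by (rule vector_derivative_at)
qed

lemma continuous_on_tnorm:
  assumes "continuous_field M X"
  shows "continuous_on UNIV (\<lambda>x. tnorm M x (X x))"
  unfolding tnorm_def by (intro continuous_intros continuous_on_riem_metric[OF RM assms assms])

lemma curve_length_nonneg: "0 \<le> curve_length M \<gamma>"
  unfolding curve_length_def set_lebesgue_integral_def
  by (intro Bochner_Integration.integral_nonneg) (auto simp: tnorm_nonneg[OF RM] indicator_def)

lemma riem_dist_le_curve_length: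
  assumes "piecewise_c1_path M \<gamma>"
  shows "riem_dist M (\<gamma> 0) (\<gamma> 1) \<le> curve_length M \<gamma>"
  unfolding riem_dist_def
proof (rule cInf_lower)
  show "curve_length M \<gamma> \<in> {curve_length M \<gamma>' |\<gamma>'. piecewise_c1_path M \<gamma>' \<and> \<gamma>' 0 = \<gamma> 0 \<and> \<gamma>' 1 = \<gamma> 1}"
    using assms by blast
  show "bdd_below {curve_length M \<gamma>' |\<gamma>'. piecewise_c1_path M \<gamma>' \<and> \<gamma>' 0 = \<gamma> 0 \<and> \<gamma>' 1 = \<gamma> 1}"
    by (rule bdd_belowI[of _ 0]) (auto simp: curve_length_nonneg)
qed

text \<open>The curve, reparametrised over \<open>[0, 1]\<close>, competes in the infimum that defines the distance; \<open>\<phi>\<close>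
  is a primitive of its speed.\<close>

lemma riem_dist_le_length_integral_curve:
  assumes X: "continuous_field M X" and \<gamma>: "integral_curve_on M X {s..t} \<gamma>" and "s \<le> t"
    and \<phi>: "\<And>r. r \<in> {s..t} \<Longrightarrow> (\<phi> has_real_derivative tnorm M (\<gamma> r) (X (\<gamma> r))) (at r within {s..t})"
    and refl: "\<And>x. riem_dist M x x = 0"
  shows "riem_dist M (\<gamma> s) (\<gamma> t) \<le> \<phi> t - \<phi> s"
proof (cases "s = t")
  case True
  then show ?thesis by (simp add: refl)
next
  case False
  with \<open>s \<le> t\<close> have st: "s < t" by simp
  define l where "l = (\<lambda>r. s + r * (t - s))"
  define \<eta> where "\<eta> r = \<gamma> (l r)" for r
  have l_in: "l r \<in> {s..t}" if "r \<in> {0..1}" for r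
  proof -
    have "r * (t - s) \<le> 1 * (t - s)" "0 \<le> r * (t - s)"
      using that st by (auto intro: mult_right_mono)
    then show ?thesis by (simp add: l_def)
  qed
  have l_img: "l ` {0..1} \<subseteq> {s..t}" using l_in by (rule image_subsetI)
  have ld: "(l has_vector_derivative (t - s)) (at r within A)" for r A
    unfolding l_def has_real_derivative_iff_has_vector_derivative[symmetric] by (auto intro!: derivative_eq_intros)
  have contl: "continuous_on {0..1} l" unfolding l_def by (intro continuous_intros)
  have cont\<gamma>: "continuous_on {s..t} \<gamma>" using \<gamma> by (simp add: integral_curve_on_def)
  have cont\<eta>: "continuous_on {0..1} \<eta>"
    unfolding \<eta>_def by (rule continuous_on_compose2[OF cont\<gamma> contl l_img])
  have deriv: "((cmap c \<circ> \<eta>) has_vector_derivative (t - s) *\<^sub>R in_chart M c X (\<eta> r)) (at r within {0..1})"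
    if c: "c \<in> atlas M" and r: "r \<in> {0..1}" and dom: "\<eta> r \<in> cdom c" for c r
  proof -
    have "((cmap c \<circ> \<gamma>) has_vector_derivative in_chart M c X (\<gamma> (l r))) (at (l r) within {s..t})"
      using \<gamma> c l_in[OF r] dom unfolding \<eta>_def integral_curve_on_def by blast
    then have "((cmap c \<circ> \<gamma>) has_vector_derivative in_chart M c X (\<gamma> (l r))) (at (l r) within l ` {0..1})"
      by (rule has_vector_derivative_within_subset[OF _ l_img])
    from vector_diff_chain_within[OF ld this] show ?thesis by (simp add: \<eta>_def o_def)
  qed
  have path: "piecewise_c1_path M \<eta>"
    unfolding piecewise_c1_path_def
  proof (intro exI[of _ 1] exI[of _ real] conjI allI impI)
    fix i :: nat assume "i < 1"
    then have i: "i = 0" by simp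
    show "c1_curve_on M (real i) (real (Suc i)) \<eta>"
      unfolding c1_curve_on_def i
    proof (simp only: of_nat_0 of_nat_Suc add_0_right, intro conjI ballI)
      show "continuous_on {0..1} \<eta>" by (rule cont\<eta>)
      fix c assume c: "c \<in> atlas M"
      show "\<exists>D. continuous_on {r \<in> {0..1}. \<eta> r \<in> cdom c} D \<and>
          (\<forall>r\<in>{0..1}. \<eta> r \<in> cdom c \<longrightarrow> (cmap c \<circ> \<eta> has_vector_derivative D r) (at r within {0..1}))"
      proof (intro exI[of _ "\<lambda>r. (t - s) *\<^sub>R in_chart M c X (\<eta> r)"] conjI ballI impI deriv[OF c])
        have "continuous_on (cdom c) (in_chart M c X)" using X c by (simp add: continuous_field_def)
        then show "continuous_on {r \<in> {0..1}. \<eta> r \<in> cdom c} (\<lambda>r. (t - s) *\<^sub>R in_chart M c X (\<eta> r))"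
          by (intro continuous_on_scaleR continuous_on_const
                continuous_on_compose2[OF _ continuous_on_subset[OF cont\<eta>]]) auto
      qed
    qed
  qed auto
  let ?h = "\<lambda>r. (t - s) * tnorm M (\<eta> r) (X (\<eta> r))"
  have speed: "tnorm M (\<eta> r) (velocity M \<eta> r) = ?h r" if r: "r \<in> {0..1} - {0, 1}" for r
  proof -
    let ?c = "chart_at M (\<eta> r)"
    have "((cmap ?c \<circ> \<eta>) has_vector_derivative (t - s) *\<^sub>R X (\<eta> r)) (at r within {0..1})"
      using deriv[of ?c r] r chart_at_atlas[OF smooth] chart_at_dom[OF smooth] by (simp add: in_chart_self[OF RM])
    then have "((cmap ?c \<circ> \<eta>) has_vector_derivative (t - s) *\<^sub>R X (\<eta> r)) (at r)"
      using r by (simp add: at_within_Icc_at)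
    then have "velocity M \<eta> r = (t - s) *\<^sub>R X (\<eta> r)" unfolding velocity_def by (rule vector_derivative_at)
    then show ?thesis using st
      by (simp add: tnorm_def inner_form_simps[OF inner_form_riem_metric[OF RM]] real_sqrt_mult)
  qed
  have conth: "continuous_on {0..1} ?h"
    by (intro continuous_on_mult continuous_on_const continuous_on_compose2[OF continuous_on_tnorm[OF X] cont\<eta>]) auto
  have neg: "negligible {0, 1::real}" by simp
  have "curve_length M \<eta> = integral {0..1} (\<lambda>r. tnorm M (\<eta> r) (velocity M \<eta> r))"
    unfolding curve_length_def
    by (intro set_lebesgue_integral_eq_integral absolutely_integrable_spike[OF absolutely_integrable_continuous_real[OF conth] neg] speed)
  also have "\<dots> = integral {0..1} ?h"
    using speed by (intro integral_spike[OF neg]) auto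
  also have "\<dots> = \<phi> (l 1) - \<phi> (l 0)"
  proof (rule integral_unique, rule fundamental_theorem_of_calculus[of 0 1 "\<phi> \<circ> l", unfolded o_def])
    fix r :: real assume r: "r \<in> {0..1}"
    have "(\<phi> has_vector_derivative tnorm M (\<gamma> (l r)) (X (\<gamma> (l r)))) (at (l r) within {s..t})"
      using \<phi>[OF l_in[OF r]] by (simp add: has_real_derivative_iff_has_vector_derivative)
    from vector_diff_chain_within[OF ld has_vector_derivative_within_subset[OF this l_img]]
    show "((\<lambda>r. \<phi> (l r)) has_vector_derivative ?h r) (at r within {0..1})"
      by (simp add: \<eta>_def o_def)
  qed simp
  also have "\<dots> = \<phi> t - \<phi> s" by (simp add: l_def)
  finally have "curve_length M \<eta> = \<phi> t - \<phi> s" .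
  then show ?thesis using riem_dist_le_curve_length[OF path] by (simp add: \<eta>_def l_def)
qed

end

section \<open>Integral curves of bounded length on a complete manifold\<close>

context
  fixes M :: "('m::metric_space, 'e::euclidean_space) riem_structure"
  assumes RM: "riemannian_manifold M" and dist: "\<And>x y. dist x y = riem_dist M x y"
begin

lemma continuous_on_speed:
  assumes "continuous_field M X" "integral_curve_on M X I \<gamma>"
  shows "continuous_on I (\<lambda>t. tnorm M (\<gamma> t) (X (\<gamma> t)))"
  by (rule continuous_on_compose2[OF continuous_on_tnorm[OF RM assms(1)]])
     (use assms(2) in \<open>simp_all add: integral_curve_on_def\<close>)

lemma dist_le_speed_integral:
  assumes X: "continuous_field M X" and \<gamma>: "integral_curve_on M X {0..S} \<gamma>"
    and "0 \<le> s" "s \<le> t" "t \<le> S"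
  shows "dist (\<gamma> s) (\<gamma> t) \<le> integral {0..t} (\<lambda>r. tnorm M (\<gamma> r) (X (\<gamma> r)))
    - integral {0..s} (\<lambda>r. tnorm M (\<gamma> r) (X (\<gamma> r)))"
  unfolding dist
proof (rule riem_dist_le_length_integral_curve[OF RM X])
  show "integral_curve_on M X {s..t} \<gamma>"
    by (rule integral_curve_on_subset[OF \<gamma>]) (use assms in auto)
  show "((\<lambda>t. integral {0..t} (\<lambda>r. tnorm M (\<gamma> r) (X (\<gamma> r)))) has_real_derivative tnorm M (\<gamma> r) (X (\<gamma> r))) (at r within {s..t})"
    if r: "r \<in> {s..t}" for r
  proof (rule DERIV_subset[where s = "{0..S}"])
    show "((\<lambda>t. integral {0..t} (\<lambda>r. tnorm M (\<gamma> r) (X (\<gamma> r)))) has_real_derivative tnorm M (\<gamma> r) (X (\<gamma> r))) (at r within {0..S})"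
      by (rule integral_has_real_derivative[OF continuous_on_speed[OF X \<gamma>]]) (use r assms in auto)
    show "{s..t} \<subseteq> {0..S}" using assms by auto
  qed
  show "riem_dist M x x = 0" for x using dist[of x x] by simp
qed (rule assms(4))

lemma integral_curve_extend:
  assumes X: "continuous_field M X" and \<gamma>: "integral_curve_on M X {0..T} \<gamma>" and "0 \<le> T"
  obtains e \<delta> where "0 < e" "integral_curve_on M X {0..T + e} \<delta>" "\<And>t. t \<in> {0..T} \<Longrightarrow> \<delta> t = \<gamma> t"
proof -
  obtain e \<eta> where e: "0 < e" and \<eta>: "\<eta> 0 = \<gamma> T" "integral_curve_on M X {0..e} \<eta>"
    using integral_curve_local_existence[OF RM X] by blast
  have "integral_curve_on M X {T..T + e} (\<lambda>t. \<eta> (t - T))"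
    by (rule integral_curve_shift[OF RM \<eta>(2)])
  from integral_curve_concat[OF RM \<gamma> this] \<open>0 \<le> T\<close> e \<eta>(1)
  have "integral_curve_on M X {0..T + e} (\<lambda>t. if t \<in> {0..T} then \<gamma> t else \<eta> (t - T))" by simp
  then show thesis by (rule that[OF e]) simp
qed

text \<open>Distances along the curve are bounded by increments of a bounded increasing function. So the
  curve is Cauchy as time tends to \<open>T\<close>, and by completeness it has a limit point to continue with.\<close>

lemma integral_curve_limit:
  assumes X: "continuous_field M X" and complete: "complete (UNIV :: 'm set)" and "0 < T"
    and \<gamma>: "\<And>S. 0 \<le> S \<Longrightarrow> S < T \<Longrightarrow> integral_curve_on M X {0..S} \<gamma>"
    and bound: "\<And>S. 0 \<le> S \<Longrightarrow> S < T \<Longrightarrow> integral {0..S} (\<lambda>r. tnorm M (\<gamma> r) (X (\<gamma> r))) \<le> B"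
  obtains z where "integral_curve_on M X {0..T} (\<gamma>(T := z))"
proof -
  define \<phi> where "\<phi> S = integral {0..S} (\<lambda>r. tnorm M (\<gamma> r) (X (\<gamma> r)))" for S
  define L where "L = (SUP S\<in>{0..<T}. \<phi> S)"
  have bdd: "bdd_above (\<phi> ` {0..<T})"
    using bound by (intro bdd_aboveI[of _ B]) (auto simp: \<phi>_def)
  have ne: "{0..<T} \<noteq> {}" using \<open>0 < T\<close> by auto
  \<comment> \<open>\<open>L - \<phi> s\<close> is the length of the curve after time \<open>s\<close>.\<close>
  have d_le: "dist (\<gamma> s) (\<gamma> t) \<le> L - \<phi> s" if "0 \<le> s" "s \<le> t" "t < T" for s t
  proof -
    have "dist (\<gamma> s) (\<gamma> t) \<le> \<phi> t - \<phi> s"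
      unfolding \<phi>_def by (rule dist_le_speed_integral[OF X \<gamma>[of t]]) (use that in auto)
    also have "\<phi> t \<le> L" unfolding L_def by (rule cSUP_upper[OF _ bdd]) (use that in auto)
    finally show ?thesis by simp
  qed
  have approx: "\<exists>s\<in>{0..<T}. L - \<phi> s < e" if "0 < e" for e
  proof -
    have "L - e < L" using that by simp
    then show ?thesis unfolding L_def less_cSUP_iff[OF ne bdd] by (auto simp: algebra_simps)
  qed
  define u where "u n = T - T / real (Suc n)" for n
  have u_less: "u n < T" for n using \<open>0 < T\<close> by (simp add: u_def)
  have u_nn: "0 \<le> u n" for n using \<open>0 < T\<close> by (simp add: u_def field_simps)
  have "(\<lambda>n. T * inverse (real (Suc n))) \<longlonglongrightarrow> T * 0"
    by (intro tendsto_intros LIMSEQ_inverse_real_of_nat)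
  then have "(\<lambda>n. T - T * inverse (real (Suc n))) \<longlonglongrightarrow> T - T * 0"
    by (rule tendsto_diff[OF tendsto_const])
  then have u_lim: "u \<longlonglongrightarrow> T" by (simp add: u_def[abs_def] divide_inverse)
  have late: "\<forall>\<^sub>F n in sequentially. s \<le> u n" if "s < T" for s
    using order_tendstoD(1)[OF u_lim that] by eventually_elim simp
  have "Cauchy (\<lambda>n. \<gamma> (u n))"
  proof (rule metric_CauchyI)
    fix e :: real assume "0 < e"
    then obtain s where s: "0 \<le> s" "s < T" "L - \<phi> s < e / 2" using approx[of "e / 2"] by auto
    obtain n0 where n0: "\<And>n. n0 \<le> n \<Longrightarrow> s \<le> u n"
      using late[OF s(2)] unfolding eventually_sequentially by blast
    have "dist (\<gamma> (u m)) (\<gamma> (u n)) < e" if "n0 \<le> m" "n0 \<le> n" for m n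
      using dist_triangle3[of "\<gamma> (u m)" "\<gamma> (u n)" "\<gamma> s"] d_le[OF s(1) n0[OF that(1)] u_less]
        d_le[OF s(1) n0[OF that(2)] u_less] s(3) by linarith
    then show "\<exists>n0. \<forall>m\<ge>n0. \<forall>n\<ge>n0. dist (\<gamma> (u m)) (\<gamma> (u n)) < e" by blast
  qed
  then obtain z where z: "(\<lambda>n. \<gamma> (u n)) \<longlonglongrightarrow> z" using complete unfolding complete_def by blast
  have dz: "dist (\<gamma> s) z \<le> L - \<phi> s" if s: "0 \<le> s" "s < T" for s
  proof (rule tendsto_upperbound)
    show "(\<lambda>n. dist (\<gamma> s) (\<gamma> (u n))) \<longlonglongrightarrow> dist (\<gamma> s) z" by (intro tendsto_dist tendsto_const z)
    show "\<forall>\<^sub>F n in sequentially. dist (\<gamma> s) (\<gamma> (u n)) \<le> L - \<phi> s"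
      using late[OF s(2)] by eventually_elim (rule d_le[OF s(1) _ u_less])
  qed simp
  let ?\<delta> = "\<gamma>(T := z)"
  have cont: "continuous_on {0..T} ?\<delta>"
    unfolding continuous_on_iff
  proof (intro ballI allI impI)
    fix t e :: real assume t: "t \<in> {0..T}" and e: "0 < e"
    show "\<exists>d>0. \<forall>s\<in>{0..T}. dist s t < d \<longrightarrow> dist (?\<delta> s) (?\<delta> t) < e"
    proof (cases "t = T")
      case True
      obtain s0 where s0: "0 \<le> s0" "s0 < T" "L - \<phi> s0 < e / 2" using approx[of "e / 2"] e by auto
      have "dist (?\<delta> s) z < e" if s: "s \<in> {0..T}" "dist s T < T - s0" for s
      proof (cases "s = T")
        case False
        then have s': "s0 \<le> s" "s < T" using s by (auto simp: dist_real_def)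
        have "dist (\<gamma> s) z \<le> dist (\<gamma> s0) (\<gamma> s) + dist (\<gamma> s0) z" by (rule dist_triangle3)
        then have "dist (\<gamma> s) z < e" using d_le[OF s0(1) s'] dz[OF s0(1,2)] s0(3) by linarith
        then show ?thesis using False by simp
      qed (use e in simp)
      then show ?thesis using s0 True by (intro exI[of _ "T - s0"]) auto
    next
      case False
      with t have tT: "t < T" by simp
      then obtain S where S: "t < S" "S < T" using dense by blast
      have "continuous_on {0..S} \<gamma>" using \<gamma>[of S] S t by (simp add: integral_curve_on_def)
      then obtain d where d: "0 < d" "\<And>s. s \<in> {0..S} \<Longrightarrow> dist s t < d \<Longrightarrow> dist (\<gamma> s) (\<gamma> t) < e"
        using t S(1) e unfolding continuous_on_iff
        by (metis (no_types) atLeastAtMost_iff less_imp_le)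
      show ?thesis
        using d(1) S t d(2) by (intro exI[of _ "min d (S - t)"]) (auto simp: dist_real_def)
    qed
  qed
  have "integral_curve_on M X {0..T} ?\<delta>"
  proof (rule integral_curve_closed_endpoint[OF RM X \<open>0 < T\<close> cont])
    show "integral_curve_on M X {0..S} ?\<delta>" if "0 \<le> S" "S < T" for S
      by (rule integral_curve_on_cong[OF \<gamma>[OF that]]) (use that in auto)
  qed
  then show thesis by (rule that)
qed

lemma global_integral_curve:
  assumes X: "continuous_field M X" and complete: "complete (UNIV :: 'm set)"
    and bound: "\<And>T. 0 < T \<Longrightarrow> \<exists>B. \<forall>S \<gamma>. 0 \<le> S \<longrightarrow> S < T \<longrightarrow> \<gamma> 0 = y \<longrightarrow> integral_curve_on M X {0..S} \<gamma> \<longrightarrow>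
        integral {0..S} (\<lambda>r. tnorm M (\<gamma> r) (X (\<gamma> r))) \<le> B"
  obtains \<gamma> where "\<gamma> 0 = y" "\<And>T. 0 \<le> T \<Longrightarrow> integral_curve_on M X {0..T} \<gamma>"
proof -
  define P where "P T \<gamma> \<longleftrightarrow> 0 \<le> T \<and> \<gamma> 0 = y \<and> integral_curve_on M X {0..T} \<gamma>" for T \<gamma>
  obtain e \<gamma>0 where e: "0 < e" "\<gamma>0 0 = y" "integral_curve_on M X {0..e} \<gamma>0"
    using integral_curve_local_existence[OF RM X] by blast
  have "\<exists>\<gamma>. \<gamma> 0 = \<gamma>0 0 \<and> (\<forall>T\<ge>0. P T \<gamma>)"
  proof (rule global_continuation)
    show "P T \<delta>" if "P T \<gamma>" "\<And>t. t \<in> {0..T} \<Longrightarrow> \<gamma> t = \<delta> t" for T \<gamma> \<delta>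
      using that integral_curve_on_cong[of M X "{0..T}" \<gamma> \<delta>] by (auto simp: P_def)
    show "P S \<gamma>" if "P T \<gamma>" "0 \<le> S" "S \<le> T" for S T \<gamma>
      using that integral_curve_on_subset[of M X "{0..T}" \<gamma> "{0..S}"] by (auto simp: P_def)
    show "\<exists>e>0. \<exists>\<delta>. P (T + e) \<delta> \<and> (\<forall>t\<in>{0..T}. \<delta> t = \<gamma> t)" if "0 \<le> T" "P T \<gamma>" for T \<gamma>
    proof -
      obtain e \<delta> where "0 < e" "integral_curve_on M X {0..T + e} \<delta>" "\<And>t. t \<in> {0..T} \<Longrightarrow> \<delta> t = \<gamma> t"
        using integral_curve_extend[OF X, of T \<gamma>] \<open>P T \<gamma>\<close> unfolding P_def by blast
      moreover from this have "\<delta> 0 = y" using \<open>P T \<gamma>\<close> by (simp add: P_def)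
      ultimately show ?thesis using \<open>0 \<le> T\<close> unfolding P_def
        by (intro exI[of _ e] conjI exI[of _ \<delta>]) auto
    qed
    show "\<exists>\<delta>. P T \<delta> \<and> (\<forall>t\<in>{0..<T}. \<delta> t = \<gamma> t)" if T: "0 < T" and P: "\<And>S. 0 \<le> S \<Longrightarrow> S < T \<Longrightarrow> P S \<gamma>" for T \<gamma>
    proof -
      obtain B where B: "\<And>S \<gamma>. 0 \<le> S \<Longrightarrow> S < T \<Longrightarrow> \<gamma> 0 = y \<Longrightarrow> integral_curve_on M X {0..S} \<gamma> \<Longrightarrow>
        integral {0..S} (\<lambda>r. tnorm M (\<gamma> r) (X (\<gamma> r))) \<le> B" using bound[OF T] by blast
      have ic: "integral_curve_on M X {0..S} \<gamma>" "\<gamma> 0 = y" if "0 \<le> S" "S < T" for S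
        using P[OF that] by (auto simp: P_def)
      obtain z where "integral_curve_on M X {0..T} (\<gamma>(T := z))"
        by (rule integral_curve_limit[OF X complete T ic(1) B[OF _ _ ic(2) ic(1)]])
      moreover have "(\<gamma>(T := z)) 0 = y" using ic(2)[of 0] T by simp
      ultimately have "P T (\<gamma>(T := z))" using T by (simp add: P_def)
      then show ?thesis by (intro exI[of _ "\<gamma>(T := z)"]) auto
    qed
    show "P 0 \<gamma>0" using e integral_curve_on_subset[OF e(3), of "{0..0}"] by (auto simp: P_def)
  qed
  then obtain \<gamma> where "\<gamma> 0 = y" "\<And>T. 0 \<le> T \<Longrightarrow> P T \<gamma>" using e(2) by auto
  then show thesis using that[of \<gamma>] by (simp add: P_def)
qed

lemma abs_continuous_integral_curve:
  assumes X: "continuous_field M X" and \<gamma>: "\<And>T. 0 \<le> T \<Longrightarrow> integral_curve_on M X {0..T} \<gamma>"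
  shows "abs_continuous_curve \<gamma>"
  unfolding abs_continuous_curve_def abs_continuous_curve_on_def
proof (intro allI impI)
  fix T \<epsilon> :: real assume T: "0 < T" and \<epsilon>: "0 < \<epsilon>"
  let ?\<sigma> = "\<lambda>r. tnorm M (\<gamma> r) (X (\<gamma> r))"
  have ic: "integral_curve_on M X {0..T} \<gamma>" using \<gamma> T by simp
  have cont: "continuous_on {0..T} ?\<sigma>" by (rule continuous_on_speed[OF X ic])
  have "bounded (?\<sigma> ` {0..T})"
    by (rule compact_imp_bounded[OF compact_continuous_image[OF cont]]) simp
  then obtain m where m: "0 < m" "\<And>r. r \<in> {0..T} \<Longrightarrow> norm (?\<sigma> r) \<le> m"
    unfolding bounded_pos by auto
  have lip: "dist (\<gamma> u) (\<gamma> v) \<le> m * (v - u)" if uv: "0 \<le> u" "u < v" "v \<le> T" for u v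
  proof -
    have "dist (\<gamma> u) (\<gamma> v) \<le> integral {0..v} ?\<sigma> - integral {0..u} ?\<sigma>"
      by (rule dist_le_speed_integral[OF X ic]) (use uv in auto)
    also have "\<dots> = integral {u..v} ?\<sigma>"
      using Henstock_Kurzweil_Integration.integral_combine[of 0 u v ?\<sigma>] uv
        integrable_continuous_real[OF continuous_on_subset[OF cont, of "{0..v}"]] by simp
    also have "\<dots> \<le> norm (integral {u..v} ?\<sigma>)" by simp
    also have "\<dots> \<le> m * (v - u)"
      by (rule integral_bound) (use uv m(2) continuous_on_subset[OF cont, of "{u..v}"] in auto)
    finally show ?thesis .
  qed
  show "\<exists>\<delta>>0. \<forall>D. finite D \<longrightarrow> (\<forall>(u, v)\<in>D. 0 \<le> u \<and> u < v \<and> v \<le> T) \<longrightarrow>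
      pairwise (\<lambda>(u, v) (u', v'). {u<..<v} \<inter> {u'<..<v'} = {}) D \<longrightarrow>
      (\<Sum>(u, v)\<in>D. v - u) < \<delta> \<longrightarrow> (\<Sum>(u, v)\<in>D. dist (\<gamma> u) (\<gamma> v)) < \<epsilon>"
  proof (intro exI[of _ "\<epsilon> / m"] conjI allI impI)
    show "0 < \<epsilon> / m" using \<epsilon> m by simp
    fix D :: "(real \<times> real) set"
    assume D: "\<forall>(u, v)\<in>D. 0 \<le> u \<and> u < v \<and> v \<le> T" and small: "(\<Sum>(u, v)\<in>D. v - u) < \<epsilon> / m"
    have "(\<Sum>(u, v)\<in>D. dist (\<gamma> u) (\<gamma> v)) \<le> (\<Sum>(u, v)\<in>D. m * (v - u))"
      by (rule sum_mono) (use D lip in auto)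
    also have "\<dots> = m * (\<Sum>(u, v)\<in>D. v - u)" by (simp add: sum_distrib_left case_prod_unfold)
    also have "\<dots> < \<epsilon>" using small m(1) by (simp add: pos_less_divide_eq mult.commute)
    finally show "(\<Sum>(u, v)\<in>D. dist (\<gamma> u) (\<gamma> v)) < \<epsilon>" .
  qed
qed

end

section \<open>The optimal velocity field and its integral curves\<close>

lemma tnorm_triangle:
  assumes RM: "riemannian_manifold M"
  shows "tnorm M x (u + v) \<le> tnorm M x u + tnorm M x v"
proof (rule power2_le_imp_le)
  note g = inner_form_riem_metric[OF RM, of x]
  have "riem_metric M x u v \<le> tnorm M x u * tnorm M x v"
    using inner_form_Cauchy_Schwarz[OF g, of u v] by (simp add: tnorm_def)
  then show "(tnorm M x (u + v))\<^sup>2 \<le> (tnorm M x u + tnorm M x v)\<^sup>2"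
    by (simp add: tnorm_power2[OF RM] power2_sum inner_form_simps[OF g] inner_form_sym[OF g, of v u])
qed (simp add: tnorm_nonneg[OF RM])

lemma tnorm_sum_le:
  assumes RM: "riemannian_manifold M" and "\<And>z. 0 \<le> w z" "finite I"
  shows "tnorm M x (\<Sum>z\<in>I. w z *\<^sub>R b z) \<le> (\<Sum>z\<in>I. w z * tnorm M x (b z))"
  using assms(3)
proof (induction rule: finite_induct)
  case empty
  show ?case by (simp add: tnorm_def inner_form_simps[OF inner_form_riem_metric[OF RM]])
next
  case (insert z I)
  have "tnorm M x (w z *\<^sub>R b z) = w z * tnorm M x (b z)"
    using assms(2)[of z]
    by (simp add: tnorm_def inner_form_simps[OF inner_form_riem_metric[OF RM]] real_sqrt_mult)
  then show ?case
    using insert tnorm_triangle[OF RM, of x "w z *\<^sub>R b z" "\<Sum>z\<in>I. w z *\<^sub>R b z"] by simp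
qed

lemma compact_insert_limit_range:
  fixes f :: "nat \<Rightarrow> 'a::topological_space"
  assumes "f \<longlonglongrightarrow> l"
  shows "compact (insert l (range f))"
proof (rule compactI)
  fix C assume C: "\<forall>U\<in>C. open U" "insert l (range f) \<subseteq> \<Union>C"
  then have "l \<in> \<Union>C" by simp
  then obtain U where U: "U \<in> C" "l \<in> U" by (rule UnionE)
  then have "\<forall>\<^sub>F n in sequentially. f n \<in> U" using topological_tendstoD[OF assms, of U] C(1) by simp
  then have "\<exists>n0. \<forall>n\<ge>n0. f n \<in> U" by (simp only: eventually_sequentially)
  then obtain n0 where n0: "\<And>n. n0 \<le> n \<Longrightarrow> f n \<in> U" by auto
  have "compact (f ` {..<n0})" by (rule finite_imp_compact) simp
  then obtain D where D: "D \<subseteq> C" "finite D" "f ` {..<n0} \<subseteq> \<Union>D"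
    by (rule compactE[of _ C]) (use C in auto)
  have "f n \<in> \<Union>(insert U D)" for n
    using D(3) n0[of n] by (cases "n < n0") auto
  then have "range f \<subseteq> \<Union>(insert U D)" by (rule image_subsetI)
  then have "insert l (range f) \<subseteq> \<Union>(insert U D)" using U(2) by (simp add: insert_subset)
  then show "\<exists>C'\<subseteq>C. finite C' \<and> insert l (range f) \<subseteq> \<Union>C'"
    using U(1) D(1,2) by (intro exI[of _ "insert U D"] conjI) simp_all
qed

text \<open>A Lipschitz bound on the compact set formed by a convergent sequence and its limit suffices.\<close>

lemma continuous_on_locally_lipschitz:
  fixes h :: "'m::metric_space \<Rightarrow> real"
  assumes "\<And>K. compact K \<Longrightarrow> \<exists>C. \<forall>x\<in>K. \<forall>y\<in>K. \<bar>h x - h y\<bar> \<le> C * dist x y"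
  shows "continuous_on UNIV h"
  unfolding continuous_on_sequentially
proof (intro allI ballI impI)
  fix s :: "nat \<Rightarrow> 'm" and x assume "(\<forall>n. s n \<in> UNIV) \<and> s \<longlonglongrightarrow> x"
  then have s: "s \<longlonglongrightarrow> x" by simp
  obtain C where C: "\<forall>y\<in>insert x (range s). \<forall>z\<in>insert x (range s). \<bar>h y - h z\<bar> \<le> C * dist y z"
    using assms[OF compact_insert_limit_range[OF s]] by (rule exE)
  have C': "norm (h (s n) - h x) \<le> C * dist (s n) x" for n
    unfolding real_norm_def by (rule C[rule_format]) simp_all
  have "(\<lambda>n. h (s n) - h x) \<longlonglongrightarrow> 0"
  proof (rule Lim_null_comparison)
    show "\<forall>\<^sub>F n in sequentially. norm (h (s n) - h x) \<le> C * dist (s n) x" by (intro always_eventually allI C')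
    show "(\<lambda>n. C * dist (s n) x) \<longlonglongrightarrow> 0"
      by (rule tendsto_mult_right_zero[OF tendsto_dist_iff[THEN iffD1, OF s]])
  qed
  then show "(h \<circ> s) \<longlonglongrightarrow> h x" unfolding o_def by (rule LIM_zero_cancel)
qed

lemma continuous_field_optimal_velocity:
  fixes M :: "('m::metric_space, 'e::euclidean_space) riem_structure" and b :: "'m \<Rightarrow> 's::finite \<Rightarrow> 'e"
  assumes RM: "riemannian_manifold M" and f: "c1_function M f"
    and b: "\<And>i. continuous_field M (\<lambda>x. b x i)"
    and Q: "\<And>x. conservative_rates (\<lambda>i j. q i j x)" "\<And>x. irreducible_rates (\<lambda>i j. q i j x)"
    and q: "\<And>i j. continuous_on UNIV (q i j)"
  shows "continuous_field M (\<lambda>x. optimal_velocity M b q x (differential M f x))"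
proof -
  let ?A = "\<lambda>x. tilted_rates q x (\<lambda>z. blinfun_apply (differential M f x) (b x z))"
  have entry: "continuous_on UNIV (\<lambda>x. if i = j then blinfun_apply (differential M f x) (b x i) else 0)" for i j
    using continuous_on_differential[OF RM f b] by (cases "i = j") auto
  have A: "continuous_on UNIV ?A"
    unfolding tilted_rates_def
    by (rule continuous_on_vec_lambda, rule continuous_on_vec_lambda, rule continuous_on_add[OF q entry])
  have w: "continuous_on UNIV (\<lambda>x. twisted_weight (?A x) z)" for z
    by (rule continuous_on_compose2[OF continuous_on_twisted_weight A])
       (use irreducible_metzler_tilted_rates[of q, OF Q] in auto)
  have "continuous_field M (\<lambda>x. gradient M f x + (\<Sum>z\<in>UNIV. twisted_weight (?A x) z *\<^sub>R b x z))"
    by (intro continuous_field_add[OF RM] continuous_field_sum[OF RM] continuous_field_scaleR[OF RM w]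
          continuous_field_gradient[OF RM f] b) auto
  then show ?thesis unfolding optimal_velocity_def gradient_def[OF RM] .
qed

lemma tnorm_optimal_velocity_le:
  fixes M :: "('m::topological_space, 'e::euclidean_space) riem_structure" and b :: "'m \<Rightarrow> 's::finite \<Rightarrow> 'e"
  assumes RM: "riemannian_manifold M"
    and Q: "conservative_rates (\<lambda>i j. q i j x)" "irreducible_rates (\<lambda>i j. q i j x)"
    and b: "\<And>i. tnorm M x (b x i) \<le> \<beta>"
  shows "tnorm M x (optimal_velocity M b q x p) \<le> conorm M x p + \<beta>"
proof -
  let ?w = "twisted_weight (tilted_rates q x (\<lambda>z. blinfun_apply p (b x z)))"
  have A: "irreducible_metzler (tilted_rates q x (\<lambda>z. blinfun_apply p (b x z)))"
    by (rule irreducible_metzler_tilted_rates[of q, OF Q])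
  have "tnorm M x (\<Sum>z\<in>UNIV. ?w z *\<^sub>R b x z) \<le> (\<Sum>z\<in>UNIV. ?w z * tnorm M x (b x z))"
    by (rule tnorm_sum_le[OF RM twisted_weight_nonneg[OF A]]) simp
  also have "\<dots> \<le> (\<Sum>z\<in>UNIV. ?w z * \<beta>)"
    by (intro sum_mono mult_left_mono b twisted_weight_nonneg[OF A])
  also have "\<dots> = \<beta>" by (simp add: sum_distrib_right[symmetric] twisted_weight_sum[OF A])
  finally show ?thesis
    unfolding optimal_velocity_def conorm_eq_tnorm_riesz[OF RM]
    using tnorm_triangle[OF RM, of x "riesz_vector (riem_metric M x) (blinfun_apply p)" "\<Sum>z\<in>UNIV. ?w z *\<^sub>R b x z"]
    by linarith
qed

text \<open>Let \<open>\<sigma>\<close> be the speed, \<open>\<phi>\<close> the length and \<open>P\<close> the derivative of \<open>f\<close> along the curve. The linear growth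
  of \<open>b\<close> and \<open>|df| \<le> 1 / 2 + |df|\<^sup>2 / 2 \<le> 1 / 2 + P - \<^bold>Hf\<close> give \<open>\<sigma> - C \<phi> \<le> P + K\<close>. The right-hand side is
  nonnegative and \<open>P\<close> integrates to a difference of values of \<open>f\<close>, so
  \<open>exp (- C t) \<phi> - f - K t\<close> decreases along the curve.\<close>

lemma optimal_curve_length_bound:
  fixes M :: "('m::metric_space, 'e::euclidean_space) riem_structure" and b :: "'m \<Rightarrow> 's::finite \<Rightarrow> 'e"
  assumes X_def: "\<And>x. X x = optimal_velocity M b q x (differential M f x)"
    and RM: "riemannian_manifold M" and dist: "\<And>x y. dist x y = riem_dist M x y"
    and f: "c1_function M f" and X: "continuous_field M X"
    and Q: "\<And>x. conservative_rates (\<lambda>i j. q i j x)" "\<And>x. irreducible_rates (\<lambda>i j. q i j x)"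
    and C: "0 < C" "\<And>x i. tnorm M x (b x i) \<le> C * (1 + dist x x0)"
    and F: "\<And>x. \<bar>f x\<bar> \<le> F" and N: "\<And>x. \<bar>Hop M b q f x\<bar> \<le> N"
    and \<gamma>: "integral_curve_on M X {0..S} \<gamma>" and S: "0 \<le> S" "S < T"
  shows "integral {0..S} (\<lambda>r. tnorm M (\<gamma> r) (X (\<gamma> r)))
    \<le> exp (C * T) * (2 * F + (1 / 2 + N + C * (1 + dist (\<gamma> 0) x0)) * T)"
proof -
  define K where "K = 1 / 2 + N + C * (1 + dist (\<gamma> 0) x0)"
  define \<sigma> where "\<sigma> r = tnorm M (\<gamma> r) (X (\<gamma> r))" for r
  define \<phi> where "\<phi> t = integral {0..t} \<sigma>" for t
  define P where "P r = blinfun_apply (differential M f (\<gamma> r)) (X (\<gamma> r))" for r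
  define \<psi> where "\<psi> t = exp (- (C * t)) * \<phi> t - f (\<gamma> t) - K * t" for t
  have N0: "0 \<le> N" using N[of x0] by linarith
  have F0: "0 \<le> F" using F[of x0] by linarith
  have K0: "0 \<le> K" using N0 C(1) by (simp add: K_def)
  have cont\<sigma>: "continuous_on {0..S} \<sigma>"
    unfolding \<sigma>_def by (rule continuous_on_speed[OF RM dist X \<gamma>])
  have d\<phi>: "(\<phi> has_real_derivative \<sigma> t) (at t within {0..S})" if "t \<in> {0..S}" for t
    unfolding \<phi>_def by (rule integral_has_real_derivative[OF cont\<sigma> that])
  have d\<psi>: "(\<psi> has_real_derivative exp (- (C * t)) * (\<sigma> t - C * \<phi> t) - P t - K) (at t within {0..S})"
    if t: "t \<in> {0..S}" for t
    unfolding \<psi>_def P_def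
    by (rule derivative_eq_intros d\<phi>[OF t] derivative_along_integral_curve[OF RM f \<gamma> t] refl)+
       (simp add: algebra_simps)
  have \<sigma>_le: "\<sigma> t - C * \<phi> t \<le> P t + K" if t: "t \<in> {0..S}" for t
  proof -
    let ?p = "differential M f (\<gamma> t)"
    have "\<sigma> t \<le> conorm M (\<gamma> t) ?p + C * (1 + dist (\<gamma> t) x0)"
      unfolding \<sigma>_def X_def by (rule tnorm_optimal_velocity_le[OF RM Q C(2)])
    moreover have "C * dist (\<gamma> t) x0 \<le> C * (dist (\<gamma> 0) x0 + \<phi> t)"
    proof (rule mult_left_mono)
      have "dist (\<gamma> 0) (\<gamma> t) \<le> \<phi> t"
        using dist_le_speed_integral[OF RM dist X \<gamma>, of 0 t] t by (simp add: \<phi>_def \<sigma>_def[abs_def])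
      then show "dist (\<gamma> t) x0 \<le> dist (\<gamma> 0) x0 + \<phi> t"
        using dist_triangle3[of "\<gamma> t" x0 "\<gamma> 0"] by linarith
    qed (use C(1) in simp)
    moreover have "conorm M (\<gamma> t) ?p \<le> 1 / 2 + (conorm M (\<gamma> t) ?p)\<^sup>2 / 2"
      using sum_squares_bound[of "conorm M (\<gamma> t) ?p" 1] by simp
    moreover have "(conorm M (\<gamma> t) ?p)\<^sup>2 / 2 \<le> P t - Hop M b q f (\<gamma> t)"
      unfolding P_def X_def Hop_def by (rule Lag_optimal_velocity(2)[OF RM Q])
    moreover have "- Hop M b q f (\<gamma> t) \<le> N" using N[of "\<gamma> t"] by linarith
    ultimately show ?thesis by (simp add: K_def distrib_left)
  qed
  have PK0: "0 \<le> P t + K" for t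
  proof -
    have "0 \<le> (conorm M (\<gamma> t) (differential M f (\<gamma> t)))\<^sup>2 / 2" by simp
    also have "\<dots> \<le> P t - Hop M b q f (\<gamma> t)"
      unfolding P_def X_def Hop_def by (rule Lag_optimal_velocity(2)[OF RM Q])
    also have "\<dots> \<le> P t + N" using N[of "\<gamma> t"] by linarith
    also have "\<dots> \<le> P t + K" using C(1) by (simp add: K_def)
    finally show ?thesis .
  qed
  have "\<psi> S \<le> \<psi> 0"
  proof (rule DERIV_nonpos_imp_decreasing_open[OF S(1)])
    show "continuous_on {0..S} \<psi>" by (rule DERIV_continuous_on[OF d\<psi>])
    fix t assume t: "0 < t" "t < S"
    then have tin: "t \<in> {0..S}" by simp
    have "exp (- (C * t)) * (\<sigma> t - C * \<phi> t) \<le> exp (- (C * t)) * (P t + K)"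
      by (rule mult_left_mono[OF \<sigma>_le[OF tin]]) simp
    also have "\<dots> \<le> 1 * (P t + K)"
      by (rule mult_right_mono[OF _ PK0]) (use C(1) t in simp)
    finally have "exp (- (C * t)) * (\<sigma> t - C * \<phi> t) - P t - K \<le> 0" by simp
    moreover have "(\<psi> has_real_derivative exp (- (C * t)) * (\<sigma> t - C * \<phi> t) - P t - K) (at t)"
      using d\<psi>[OF tin] t by (simp add: at_within_Icc_at)
    ultimately show "\<exists>y. (\<psi> has_real_derivative y) (at t) \<and> y \<le> 0" by blast
  qed
  then have "exp (- (C * S)) * \<phi> S \<le> f (\<gamma> S) - f (\<gamma> 0) + K * S" by (simp add: \<psi>_def \<phi>_def)
  also have "\<dots> \<le> 2 * F + K * T"
    using F[of "\<gamma> S"] F[of "\<gamma> 0"] mult_left_mono[OF less_imp_le[OF S(2)] K0] by linarith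
  finally have "exp (C * S) * (exp (- (C * S)) * \<phi> S) \<le> exp (C * S) * (2 * F + K * T)" by simp
  then have "\<phi> S \<le> exp (C * S) * (2 * F + K * T)" by (simp add: mult.assoc[symmetric] exp_add[symmetric])
  also have "\<dots> \<le> exp (C * T) * (2 * F + K * T)"
    using C(1) S K0 F0 by (intro mult_right_mono) auto
  finally show ?thesis by (simp add: \<phi>_def \<sigma>_def[abs_def] K_def)
qed

theorem proposition5p20:
  fixes M :: "('m::metric_space, 'e::euclidean_space) riem_structure"
    and b :: "'m \<Rightarrow> 's::finite \<Rightarrow> 'e"
    and q :: "'s \<Rightarrow> 's \<Rightarrow> 'm \<Rightarrow> real"
  assumes "riemannian_manifold M"
    and "\<forall>x y. dist x y = riem_dist M x y"
    and "connected (UNIV :: 'm set)"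
    and "complete (UNIV :: 'm set)"
    and "\<forall>i. c1_vector_field M (\<lambda>x. b x i)"
    and "\<exists>x0. \<exists>C>0. \<forall>x i. tnorm M x (b x i) \<le> C * (1 + dist x x0)"
    and "\<forall>x. conservative_rates (\<lambda>i j. q i j x) \<and> irreducible_rates (\<lambda>i j. q i j x)"
    and "\<forall>K. compact K \<longrightarrow>
           (\<exists>CK. \<forall>x\<in>K. \<forall>y\<in>K. \<forall>i j. \<bar>q i j x - q i j y\<bar> \<le> CK * dist x y)"
    and "{(f, Hop M b q f) |f. f \<in> domH M b q} \<subseteq> Cb1 M \<times> bcontfun"
  shows "\<forall>xinit. \<forall>f\<in>domH M b q. \<exists>x :: real \<Rightarrow> 'm.
           x 0 = xinit \<and> abs_continuous_curve x \<and>
           (\<forall>t>0.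
              set_integrable lebesgue {0..t} (\<lambda>s. Ham M b q (x s) (differential M f (x s))) \<and>
              set_integrable lebesgue {0..t} (\<lambda>s. Lag M b q (x s) (velocity M x s)) \<and>
              set_integrable lebesgue {0..t}
                (\<lambda>s. blinfun_apply (differential M f (x s)) (velocity M x s)) \<and>
              (LINT s:{0..t}|lebesgue. Ham M b q (x s) (differential M f (x s))) +
              (LINT s:{0..t}|lebesgue. Lag M b q (x s) (velocity M x s)) =
              (LINT s:{0..t}|lebesgue. blinfun_apply (differential M f (x s)) (velocity M x s)))"
proof (intro allI ballI)
  fix y :: 'm and f assume f: "f \<in> domH M b q"
  note RM = assms(1)
  have dist: "\<And>x y. dist x y = riem_dist M x y" using assms(2) by blast
  have Q: "\<And>x. conservative_rates (\<lambda>i j. q i j x)" "\<And>x. irreducible_rates (\<lambda>i j. q i j x)"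
    using assms(7) by auto
  obtain x0 C where C: "0 < C" "\<And>x i. tnorm M x (b x i) \<le> C * (1 + dist x x0)" using assms(6) by blast
  have "f \<in> Cb1 M" "Hop M b q f \<in> bcontfun" using assms(9) f by auto
  then have f1: "c1_function M f" and "bounded (range f)"
    and contH: "continuous_on UNIV (Hop M b q f)" and "bounded (range (Hop M b q f))"
    by (auto simp: Cb1_def bcontfun_def)
  then obtain F N where F: "\<And>x. \<bar>f x\<bar> \<le> F" and N: "\<And>x. \<bar>Hop M b q f x\<bar> \<le> N"
    unfolding bounded_iff by auto
  have q: "continuous_on UNIV (q i j)" for i j
  proof (rule continuous_on_locally_lipschitz)
    fix K :: "'m set" assume "compact K"
    with assms(8) obtain L where "\<forall>x\<in>K. \<forall>y\<in>K. \<forall>i j. \<bar>q i j x - q i j y\<bar> \<le> L * dist x y" by blast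
    then show "\<exists>L. \<forall>x\<in>K. \<forall>y\<in>K. \<bar>q i j x - q i j y\<bar> \<le> L * dist x y" by blast
  qed
  define X where "X x = optimal_velocity M b q x (differential M f x)" for x
  have X: "continuous_field M X"
    unfolding X_def
    by (rule continuous_field_optimal_velocity[OF RM f1 c1_vector_field_continuous[OF RM] Q q]) (use assms(5) in blast)
  have bound: "\<exists>B. \<forall>S \<gamma>. 0 \<le> S \<longrightarrow> S < T \<longrightarrow> \<gamma> 0 = y \<longrightarrow> integral_curve_on M X {0..S} \<gamma> \<longrightarrow>
        integral {0..S} (\<lambda>r. tnorm M (\<gamma> r) (X (\<gamma> r))) \<le> B" for T
  proof (intro exI allI impI)
    fix S \<gamma> assume "0 \<le> S" "S < T" "\<gamma> 0 = y" "integral_curve_on M X {0..S} \<gamma>"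
    then show "integral {0..S} (\<lambda>r. tnorm M (\<gamma> r) (X (\<gamma> r)))
        \<le> exp (C * T) * (2 * F + (1 / 2 + N + C * (1 + dist y x0)) * T)"
      using optimal_curve_length_bound[OF X_def RM dist f1 X Q C F N, of S \<gamma> T] by simp
  qed
  obtain x where x0: "x 0 = y" and x: "\<And>T. 0 \<le> T \<Longrightarrow> integral_curve_on M X {0..T} x"
    using global_integral_curve[OF RM dist X assms(4) bound] by blast
  let ?P = "\<lambda>s. blinfun_apply (differential M f (x s)) (X (x s))"
  let ?H = "\<lambda>s. Ham M b q (x s) (differential M f (x s))"
  \<comment> \<open>At time \<open>0\<close> the two-sided derivative in the definition of the velocity may fail to exist. This is
    a null set.\<close>
  have vel: "velocity M x s = X (x s)" if "0 < s" for s
    by (rule velocity_integral_curve[OF RM x[of "s + 1"]]) (use that in auto)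
  have Lag: "Lag M b q (x s) (velocity M x s) = ?P s - ?H s" if "0 < s" for s
    unfolding vel[OF that] X_def by (rule Lag_optimal_velocity(1)[OF RM Q])
  have main: "set_integrable lebesgue {0..t} ?H \<and>
      set_integrable lebesgue {0..t} (\<lambda>s. Lag M b q (x s) (velocity M x s)) \<and>
      set_integrable lebesgue {0..t} (\<lambda>s. blinfun_apply (differential M f (x s)) (velocity M x s)) \<and>
      (LINT s:{0..t}|lebesgue. ?H s) + (LINT s:{0..t}|lebesgue. Lag M b q (x s) (velocity M x s)) =
      (LINT s:{0..t}|lebesgue. blinfun_apply (differential M f (x s)) (velocity M x s))" if t: "0 < t" for t
  proof -
    have contx: "continuous_on {0..t} x" using x[of t] t by (simp add: integral_curve_on_def)
    have H: "continuous_on {0..t} ?H"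
      using continuous_on_compose2[OF contH contx] by (simp add: Hop_def)
    have P: "continuous_on {0..t} ?P"
      using continuous_on_compose2[OF continuous_on_differential[OF RM f1 X] contx] by simp
    have neg: "negligible {0::real}" by simp
    have iH: "set_integrable lebesgue {0..t} ?H" by (rule absolutely_integrable_continuous_real[OF H])
    have iL: "set_integrable lebesgue {0..t} (\<lambda>s. Lag M b q (x s) (velocity M x s))"
      by (rule absolutely_integrable_spike[OF absolutely_integrable_continuous_real[OF continuous_on_diff[OF P H]] neg])
         (use Lag in auto)
    have iP: "set_integrable lebesgue {0..t} (\<lambda>s. blinfun_apply (differential M f (x s)) (velocity M x s))"
      by (rule absolutely_integrable_spike[OF absolutely_integrable_continuous_real[OF P] neg])
         (use vel in auto)
    have "integral {0..t} (\<lambda>s. Lag M b q (x s) (velocity M x s)) = integral {0..t} (\<lambda>s. ?P s - ?H s)"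
      by (rule integral_spike[OF neg]) (use Lag in auto)
    also have "\<dots> = integral {0..t} ?P - integral {0..t} ?H"
      by (intro Henstock_Kurzweil_Integration.integral_diff integrable_continuous_real P H)
    also have "integral {0..t} ?P = integral {0..t} (\<lambda>s. blinfun_apply (differential M f (x s)) (velocity M x s))"
      by (rule integral_spike[OF neg]) (use vel in auto)
    finally show ?thesis
      using iH iL iP by (simp add: set_lebesgue_integral_eq_integral(2))
  qed
  show "\<exists>x. x 0 = y \<and> abs_continuous_curve x \<and>
           (\<forall>t>0.
              set_integrable lebesgue {0..t} (\<lambda>s. Ham M b q (x s) (differential M f (x s))) \<and>
              set_integrable lebesgue {0..t} (\<lambda>s. Lag M b q (x s) (velocity M x s)) \<and>
              set_integrable lebesgue {0..t}
                (\<lambda>s. blinfun_apply (differential M f (x s)) (velocity M x s)) \<and>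
              (LINT s:{0..t}|lebesgue. Ham M b q (x s) (differential M f (x s))) +
              (LINT s:{0..t}|lebesgue. Lag M b q (x s) (velocity M x s)) =
              (LINT s:{0..t}|lebesgue. blinfun_apply (differential M f (x s)) (velocity M x s)))"
  proof (rule exI[of _ x], intro conjI[OF x0] conjI[OF abs_continuous_integral_curve[OF RM dist X x]])
    show "\<forall>t>0. set_integrable lebesgue {0..t} ?H \<and>
        set_integrable lebesgue {0..t} (\<lambda>s. Lag M b q (x s) (velocity M x s)) \<and>
        set_integrable lebesgue {0..t} (\<lambda>s. blinfun_apply (differential M f (x s)) (velocity M x s)) \<and>
        (LINT s:{0..t}|lebesgue. ?H s) + (LINT s:{0..t}|lebesgue. Lag M b q (x s) (velocity M x s)) =
        (LINT s:{0..t}|lebesgue. blinfun_apply (differential M f (x s)) (velocity M x s))"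
      using main by simp
  qed
qed

end
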